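(* Let $e$ be an interior edge of the coarse mesh with endpoints $x_{i_1},x_{i_2}$ and oversampling region $W$. Let $\psi_{i_1}^*,\psi_{i_2}^*$ be the solutions of the optimization problems $$\min_{\psi_{i_j}}\ \|\psi_{i_j}\|_{V_W}\quad\text{subject to}\quad \psi_{i_j}\in V_W,\quad \psi_{i_j}(x_{i_k})=\delta_{jk}\ (k=1,2),\qquad j=1,2,$$ and let $\psi_{i_1},\psi_{i_2}$ be any two other multi-scale interpolation basis functions associated with $x_{i_1},x_{i_2}$. Let $P_{OS}^*$ and $P_{OS}$ be the oversampling operators for the edge $e$ built with $\psi_{i_1}^*,\psi_{i_2}^*$ and with $\psi_{i_1},\psi_{i_2}$, respectively, and let $\sigma_i^*$ and $\sigma_i$, $i=1,2,\dots$, be their singular values, both arranged in descending order. Then $$\sigma_i^*\le\sigma_i\qquad\text{for all } i=1,2,\dots$$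
   Context: $\Omega=(0,1)^2$, discretized by a uniform coarse mesh of closed squares $D_1,\dots,D_N$ of side length $H$ with disjoint interiors. The coefficient $a\in L^\infty(\Omega)$ is scalar with $a(x)\in[\lambda_{\min},\lambda_{\max}]$ a.e., $0<\lambda_{\min}\le\lambda_{\max}<\infty$. A function is $a(x)$-harmonic on a set if $-\mathrm{div}(a\nabla u)=0$ weakly in its interior. An interior edge $e$ is an edge of the coarse mesh not contained in $\partial\Omega$; $D_u,D_d$ are the two coarse elements sharing $e$. The oversampling region $W$ is the union of the coarse elements that intersect $e$ (six elements if $e$ does not meet $\partial\Omega$). $V_W$ is the space of $u_W\in H^1(W)$ with $\mathrm{div}(a\nabla u_W)\in L^2(W)$ and $u_W=0$ on $\partial W\cap\partial\Omega$. Write $u_W=u_W^1+u_W^2$, with $u_W^1$ $a(x)$-harmonic on $W$, $u_W^1=u_W$ on $\partial W$, and $u_W^2=0$ on $\partial W$. The (Hilbertian) norm on $V_W$ is $$\|u_W\|_{V_W}^2=\int_W\big[(\nabla u_W^1)^t a\nabla u_W^1+(u_W^1)^2\big]dx+\int_W[\mathrm{div}(a\nabla u_W)]^2dx .$$ Functions in $V_W$ are continuous near $e$, so point values at $x_{i_1},x_{i_2}$ make sense. It is assumed that the minimization problems in the claim have solutions. $H^{1/2}(e)$ denotes the functions on $e$ (vanishing at the endpoints) whose extensions by zero to $\partial D_u$ and $\partial D_d$ are in $H^{1/2}(\partial D_u)$ and $H^{1/2}(\partial D_d)$, with norm $$\|v\|_{H^{1/2}(e)}^2=\tfrac12\int_{D_u}(\nabla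 v^u)^t a\nabla v^u\,dx+\tfrac12\int_{D_d}(\nabla v^d)^t a\nabla v^d\,dx,$$ where $v^u,v^d$ are the $a(x)$-harmonic functions on $D_u,D_d$ equal to $v$ on $e$ and $0$ on the rest of the boundary. Multi-scale interpolation basis functions associated with coarse nodes $x_i$: continuous functions $\psi_i\in H_0^1(\Omega)$ with $\psi_i(x_j)=\delta_{ij}$ at all coarse nodes, $a(x)$-harmonic on each $D_j$, supported on the four coarse elements around $x_i$. The oversampling operator for $e$ built with a pair $\psi_{i_1},\psi_{i_2}$ (only their restrictions to $e$ matter) is $P_{OS}:V_W\to H^{1/2}(e)$, $$P_{OS}u_W=u_W|_e-u_W(x_{i_1})\psi_{i_1}|_e-u_W(x_{i_2})\psi_{i_2}|_e .$$ The pairs considered are such that this is a compact operator into $H^{1/2}(e)$; its singular values are taken with respect to the norms above. *)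

theory Defs
  imports "HOL-Analysis.Analysis"
begin

section \<open>Sobolev functions\<close>

text \<open>
  Elements of Lebesgue and Sobolev spaces are represented by ordinary functions; two functions
  that agree almost everywhere represent the same element.
\<close>

definition square_integrable ::
    "'a::euclidean_space set \<Rightarrow> ('a \<Rightarrow> 'b::euclidean_space) \<Rightarrow> bool" where
  "square_integrable U f \<longleftrightarrow>
     f \<in> borel_measurable (lebesgue_on U) \<and> integrable (lebesgue_on U) (\<lambda>x. (norm (f x))\<^sup>2)"

primrec times_differentiable :: "nat \<Rightarrow> ('a::euclidean_space \<Rightarrow> real) \<Rightarrow> bool" where
  "times_differentiable 0 f \<longleftrightarrow> continuous_on UNIV f"
| "times_differentiable (Suc k) f \<longleftrightarrow>
     (\<forall>x. f differentiable (at x)) \<and>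
     (\<forall>b\<in>Basis. times_differentiable k (\<lambda>x. frechet_derivative f (at x) b))"

definition smooth :: "('a::euclidean_space \<Rightarrow> real) \<Rightarrow> bool" where
  "smooth f \<longleftrightarrow> (\<forall>k. times_differentiable k f)"

definition test_function :: "'a::euclidean_space set \<Rightarrow> ('a \<Rightarrow> real) \<Rightarrow> bool" where
  "test_function U \<phi> \<longleftrightarrow>
     smooth \<phi> \<and> compact (closure {x. \<phi> x \<noteq> 0}) \<and> closure {x. \<phi> x \<noteq> 0} \<subseteq> U"

definition weak_gradient ::
    "'a::euclidean_space set \<Rightarrow> ('a \<Rightarrow> real) \<Rightarrow> ('a \<Rightarrow> 'a) \<Rightarrow> bool" where
  "weak_gradient U u g \<longleftrightarrow>
     (\<forall>\<phi> b. test_function U \<phi> \<longrightarrow> b \<in> Basis \<longrightarrow>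
        (LINT x|lebesgue_on U. u x * frechet_derivative \<phi> (at x) b) =
          - (LINT x|lebesgue_on U. (g x \<bullet> b) * \<phi> x))"

definition H1 :: "'a::euclidean_space set \<Rightarrow> ('a \<Rightarrow> real) set" where
  "H1 U = {u. square_integrable U u \<and> (\<exists>g. square_integrable U g \<and> weak_gradient U u g)}"

definition grad :: "'a::euclidean_space set \<Rightarrow> ('a \<Rightarrow> real) \<Rightarrow> 'a \<Rightarrow> 'a" where
  "grad U u = (SOME g. square_integrable U g \<and> weak_gradient U u g)"

definition H1_norm :: "'a::euclidean_space set \<Rightarrow> ('a \<Rightarrow> real) \<Rightarrow> real" where
  "H1_norm U u = sqrt ((LINT x|lebesgue_on U. (u x)\<^sup>2) +
                       (LINT x|lebesgue_on U. (norm (grad U u x))\<^sup>2))"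

text \<open>
  The trace of \<open>u\<close> on the segment from \<open>p\<close> to \<open>q\<close> is \<open>g\<close>: it is the \<open>L\<^sup>2\<close>-limit
  on the segment of the restrictions of smooth functions that converge to \<open>u\<close> in \<open>H\<^sup>1\<close>.
\<close>

definition trace_on_segment ::
    "'a::euclidean_space set \<Rightarrow> 'a \<Rightarrow> 'a \<Rightarrow> ('a \<Rightarrow> real) \<Rightarrow> ('a \<Rightarrow> real) \<Rightarrow> bool" where
  "trace_on_segment U p q u g \<longleftrightarrow>
     square_integrable {0..1::real} (\<lambda>t. g (linepath p q t)) \<and>
     (\<exists>\<phi>. (\<forall>k::nat. smooth (\<phi> k)) \<and>
          (\<lambda>k. H1_norm U (\<lambda>x. \<phi> k x - u x)) \<longlonglongrightarrow> 0 \<and>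
          (\<lambda>k. LINT t|lebesgue_on {0..1::real}.
                  (\<phi> k (linepath p q t) - g (linepath p q t))\<^sup>2) \<longlonglongrightarrow> 0)"

text \<open>
  All domains below are closed polygons \<open>D\<close> in the plane; Sobolev spaces live on their interior.
  A boundary portion \<open>\<Gamma>\<close> is a union of segments, and \<open>u = g\<close> on \<open>\<Gamma>\<close> in the sense of
  traces means that this holds on each nondegenerate segment contained in \<open>\<Gamma>\<close>.
\<close>

definition trace_on ::
    "(real^2) set \<Rightarrow> (real^2) set \<Rightarrow> (real^2 \<Rightarrow> real) \<Rightarrow> (real^2 \<Rightarrow> real) \<Rightarrow> bool" where
  "trace_on D \<Gamma> u g \<longleftrightarrow>
     (\<forall>p q. p \<noteq> q \<longrightarrow> closed_segment p q \<subseteq> \<Gamma> \<longrightarrow> trace_on_segment (interior D) p q u g)"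

definition H10 :: "(real^2) set \<Rightarrow> (real^2 \<Rightarrow> real) set" where
  "H10 D = {u \<in> H1 (interior D). trace_on D (frontier D) u (\<lambda>_. 0)}"

definition H_half_boundary :: "(real^2) set \<Rightarrow> (real^2 \<Rightarrow> real) set" where
  "H_half_boundary D = {g. \<exists>w \<in> H1 (interior D). trace_on D (frontier D) w g}"

section \<open>The operator \<open>div (a \<nabla>u)\<close>\<close>

definition energy_form ::
    "(real^2 \<Rightarrow> real) \<Rightarrow> (real^2) set \<Rightarrow> (real^2 \<Rightarrow> real) \<Rightarrow> (real^2 \<Rightarrow> real) \<Rightarrow> real" where
  "energy_form a D u v =
     (LINT x|lebesgue_on (interior D). a x * (grad (interior D) u x \<bullet> grad (interior D) v x))"

definition weak_div ::
    "(real^2 \<Rightarrow> real) \<Rightarrow> (real^2) set \<Rightarrow> (real^2 \<Rightarrow> real) \<Rightarrow> (real^2 \<Rightarrow> real) \<Rightarrow> bool" where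
  "weak_div a D u f \<longleftrightarrow>
     square_integrable (interior D) f \<and>
     (\<forall>\<phi> \<in> H10 D. energy_form a D u \<phi> = - (LINT x|lebesgue_on (interior D). f x * \<phi> x))"

definition div_a :: "(real^2 \<Rightarrow> real) \<Rightarrow> (real^2) set \<Rightarrow> (real^2 \<Rightarrow> real) \<Rightarrow> real^2 \<Rightarrow> real" where
  "div_a a D u = (SOME f. weak_div a D u f)"

definition a_harmonic :: "(real^2 \<Rightarrow> real) \<Rightarrow> (real^2) set \<Rightarrow> (real^2 \<Rightarrow> real) \<Rightarrow> bool" where
  "a_harmonic a D u \<longleftrightarrow> u \<in> H1 (interior D) \<and> weak_div a D u (\<lambda>_. 0)"

section \<open>The coarse mesh of the unit square\<close>

definition Omega :: "(real^2) set" where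
  "Omega = box 0 1"

text \<open>The mesh has \<open>n\<close> squares in each direction, so that \<open>N = n\<^sup>2\<close> and \<open>H = 1 / n\<close>.\<close>

definition node :: "nat \<Rightarrow> nat \<Rightarrow> nat \<Rightarrow> real^2" where
  "node n j k = vector [real j / real n, real k / real n]"

definition nodes :: "nat \<Rightarrow> (real^2) set" where
  "nodes n = {node n j k | j k. j \<le> n \<and> k \<le> n}"

definition elements :: "nat \<Rightarrow> (real^2) set set" where
  "elements n = {cbox (node n j k) (node n (Suc j) (Suc k)) | j k. j < n \<and> k < n}"

definition interior_edge :: "nat \<Rightarrow> real^2 \<Rightarrow> real^2 \<Rightarrow> bool" where
  "interior_edge n p q \<longleftrightarrow>
     p \<in> nodes n \<and> q \<in> nodes n \<and> dist p q = 1 / real n \<and>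
     \<not> closed_segment p q \<subseteq> frontier Omega"

definition oversampling_region :: "nat \<Rightarrow> (real^2) set \<Rightarrow> (real^2) set" where
  "oversampling_region n e = \<Union>{D \<in> elements n. D \<inter> e \<noteq> {}}"

definition ms_basis_function ::
    "nat \<Rightarrow> (real^2 \<Rightarrow> real) \<Rightarrow> real^2 \<Rightarrow> (real^2 \<Rightarrow> real) \<Rightarrow> bool" where
  "ms_basis_function n a x \<psi> \<longleftrightarrow>
     continuous_on (closure Omega) \<psi> \<and>
     \<psi> \<in> H10 (closure Omega) \<and>
     (\<forall>y \<in> nodes n. \<psi> y = (if y = x then 1 else 0)) \<and>
     (\<forall>D \<in> elements n. a_harmonic a D \<psi>) \<and>
     (\<forall>y \<in> closure Omega - \<Union>{D \<in> elements n. x \<in> D}. \<psi> y = 0)"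

section \<open>The space \<open>V\<^sub>W\<close>\<close>

definition V :: "(real^2 \<Rightarrow> real) \<Rightarrow> (real^2) set \<Rightarrow> (real^2 \<Rightarrow> real) set" where
  "V a W = {u \<in> H1 (interior W).
              (\<exists>f. weak_div a W u f) \<and>
              trace_on W (frontier W \<inter> frontier Omega) u (\<lambda>_. 0)}"

text \<open>
  The component \<open>u\<^sup>1\<close> of \<open>u = u\<^sup>1 + u\<^sup>2\<close>; that \<open>u\<^sup>1 = u\<close> on the boundary, equivalently
  \<open>u\<^sup>2 = 0\<close> there, is membership of \<open>u - u\<^sup>1\<close> in \<open>H10 W\<close>.
\<close>

definition harmonic_part ::
    "(real^2 \<Rightarrow> real) \<Rightarrow> (real^2) set \<Rightarrow> (real^2 \<Rightarrow> real) \<Rightarrow> real^2 \<Rightarrow> real" where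
  "harmonic_part a W u = (SOME w. a_harmonic a W w \<and> (\<lambda>x. u x - w x) \<in> H10 W)"

definition V_inner ::
    "(real^2 \<Rightarrow> real) \<Rightarrow> (real^2) set \<Rightarrow> (real^2 \<Rightarrow> real) \<Rightarrow> (real^2 \<Rightarrow> real) \<Rightarrow> real" where
  "V_inner a W u v =
     energy_form a W (harmonic_part a W u) (harmonic_part a W v) +
     (LINT x|lebesgue_on (interior W). harmonic_part a W u x * harmonic_part a W v x) +
     (LINT x|lebesgue_on (interior W). div_a a W u x * div_a a W v x)"

definition V_norm :: "(real^2 \<Rightarrow> real) \<Rightarrow> (real^2) set \<Rightarrow> (real^2 \<Rightarrow> real) \<Rightarrow> real" where
  "V_norm a W u = sqrt (V_inner a W u u)"

text \<open>
  Point values are those of a representative that is continuous, up to the boundary of \<open>W\<close>,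
  near the point in question.
\<close>

definition continuous_representative_near ::
    "(real^2) set \<Rightarrow> (real^2) set \<Rightarrow> (real^2 \<Rightarrow> real) \<Rightarrow> (real^2 \<Rightarrow> real) \<Rightarrow> bool" where
  "continuous_representative_near W E u v \<longleftrightarrow>
     (\<exists>S. open S \<and> E \<subseteq> S \<and> continuous_on (S \<inter> W) v \<and>
          (AE y in lebesgue_on (S \<inter> W). u y = v y))"

definition point_value :: "(real^2) set \<Rightarrow> (real^2 \<Rightarrow> real) \<Rightarrow> real^2 \<Rightarrow> real" where
  "point_value W u x = (THE c. \<exists>v. continuous_representative_near W {x} u v \<and> v x = c)"

definition constrained_minimizer ::
    "(real^2 \<Rightarrow> real) \<Rightarrow> (real^2) set \<Rightarrow> real^2 \<Rightarrow> real^2 \<Rightarrow> (real^2 \<Rightarrow> real) \<Rightarrow> bool" where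
  "constrained_minimizer a W x y \<psi> \<longleftrightarrow>
     (let feasible = {\<phi> \<in> V a W. point_value W \<phi> x = 1 \<and> point_value W \<phi> y = 0}
      in \<psi> \<in> feasible \<and> (\<forall>\<phi> \<in> feasible. V_norm a W \<psi> \<le> V_norm a W \<phi>))"

section \<open>The space \<open>H\<^sup>1\<^sup>/\<^sup>2(e)\<close> on the edge with endpoints \<open>p\<close> and \<open>q\<close>\<close>

definition zero_extension :: "(real^2) set \<Rightarrow> (real^2 \<Rightarrow> real) \<Rightarrow> real^2 \<Rightarrow> real" where
  "zero_extension e v = (\<lambda>x. if x \<in> e then v x else 0)"

text \<open>The two elements sharing the edge, if it is interior.\<close>

definition edge_elements :: "nat \<Rightarrow> (real^2) set \<Rightarrow> (real^2) set set" where
  "edge_elements n e = {D \<in> elements n. e \<subseteq> D}"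

text \<open>Only the values on the edge matter for membership and for the inner product.\<close>

definition H_half :: "nat \<Rightarrow> real^2 \<Rightarrow> real^2 \<Rightarrow> (real^2 \<Rightarrow> real) set" where
  "H_half n p q = {v. v p = 0 \<and> v q = 0 \<and>
     (\<forall>D \<in> edge_elements n (closed_segment p q).
        zero_extension (closed_segment p q) v \<in> H_half_boundary D)}"

definition harmonic_extension ::
    "(real^2 \<Rightarrow> real) \<Rightarrow> (real^2) set \<Rightarrow> (real^2) set \<Rightarrow> (real^2 \<Rightarrow> real) \<Rightarrow> real^2 \<Rightarrow> real" where
  "harmonic_extension a D e v =
     (SOME w. a_harmonic a D w \<and> trace_on D (frontier D) w (zero_extension e v))"

definition H_half_inner ::
    "nat \<Rightarrow> (real^2 \<Rightarrow> real) \<Rightarrow> real^2 \<Rightarrow> real^2 \<Rightarrow> (real^2 \<Rightarrow> real) \<Rightarrow> (real^2 \<Rightarrow> real) \<Rightarrow> real" where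
  "H_half_inner n a p q v w =
     (\<Sum>D \<in> edge_elements n (closed_segment p q).
        1 / 2 * energy_form a D (harmonic_extension a D (closed_segment p q) v)
                                (harmonic_extension a D (closed_segment p q) w))"

section \<open>The oversampling operator\<close>

text \<open>The arguments \<open>g\<close> and \<open>h\<close> are the restrictions to the edge of the two basis functions.\<close>

definition P_OS ::
    "(real^2) set \<Rightarrow> real^2 \<Rightarrow> real^2 \<Rightarrow> (real^2 \<Rightarrow> real) \<Rightarrow> (real^2 \<Rightarrow> real) \<Rightarrow>
     (real^2 \<Rightarrow> real) \<Rightarrow> real^2 \<Rightarrow> real" where
  "P_OS W p q g h u =
     (\<lambda>x. point_value W u x - point_value W u p * g x - point_value W u q * h x)"

section \<open>Compact operators and singular values\<close>

text \<open>
  A Hilbert space is given by a carrier \<open>X\<close> of representatives and its inner product \<open>ip\<close>;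
  the zero element is represented by every \<open>u\<close> with \<open>ip u u = 0\<close>.
\<close>

definition compact_operator ::
    "'f set \<Rightarrow> ('f \<Rightarrow> 'f \<Rightarrow> real) \<Rightarrow> ('x \<Rightarrow> real) set \<Rightarrow> (('x \<Rightarrow> real) \<Rightarrow> ('x \<Rightarrow> real) \<Rightarrow> real) \<Rightarrow>
     ('f \<Rightarrow> 'x \<Rightarrow> real) \<Rightarrow> bool" where
  "compact_operator X ipX Y ipY T \<longleftrightarrow>
     T ` X \<subseteq> Y \<and>
     (\<forall>u::nat \<Rightarrow> 'f. (\<forall>k. u k \<in> X) \<and> (\<exists>C. \<forall>k. ipX (u k) (u k) \<le> C) \<longrightarrow>
        (\<exists>r y. strict_mono r \<and> y \<in> Y \<and>
           (\<lambda>k. ipY (\<lambda>x. T (u (r k)) x - y x) (\<lambda>x. T (u (r k)) x - y x)) \<longlonglongrightarrow> 0))"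

text \<open>\<open>T\<^sup>* T u = \<mu> u\<close>, the adjoint being expressed by \<open>\<langle>T\<^sup>* T u, v\<rangle> = \<langle>T u, T v\<rangle>\<close>.\<close>

definition gram_eigen ::
    "'f set \<Rightarrow> ('f \<Rightarrow> 'f \<Rightarrow> real) \<Rightarrow> ('g \<Rightarrow> 'g \<Rightarrow> real) \<Rightarrow> ('f \<Rightarrow> 'g) \<Rightarrow> real \<Rightarrow> 'f \<Rightarrow> bool" where
  "gram_eigen X ipX ipY T \<mu> u \<longleftrightarrow> u \<in> X \<and> (\<forall>v \<in> X. ipY (T u) (T v) = \<mu> * ipX u v)"

text \<open>
  The numbers \<open>\<sigma> 0 \<ge> \<sigma> 1 \<ge> \<dots>\<close> (numbering starts at 0) are the singular values of \<open>T\<close>: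
  the square roots of the positive eigenvalues of \<open>T\<^sup>* T\<close>, repeated according to multiplicity,
  followed by zeros if \<open>T\<close> has finite rank. Multiplicity is counted by orthonormal eigenvectors:
  by the last condition those belonging to an eigenvalue \<open>\<mu> > 0\<close> span its eigenspace, which
  is finite-dimensional if \<open>T\<close> is compact.
\<close>

definition singular_values ::
    "'f set \<Rightarrow> ('f \<Rightarrow> 'f \<Rightarrow> real) \<Rightarrow> ('g \<Rightarrow> 'g \<Rightarrow> real) \<Rightarrow> ('f \<Rightarrow> 'g) \<Rightarrow> (nat \<Rightarrow> real) \<Rightarrow> bool" where
  "singular_values X ipX ipY T \<sigma> \<longleftrightarrow>
     antimono \<sigma> \<and> (\<forall>i. 0 \<le> \<sigma> i) \<and>
     (\<exists>u. (\<forall>i. \<sigma> i > 0 \<longrightarrow> gram_eigen X ipX ipY T ((\<sigma> i)\<^sup>2) (u i)) \<and>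
          (\<forall>i j. \<sigma> i > 0 \<longrightarrow> \<sigma> j > 0 \<longrightarrow> ipX (u i) (u j) = (if i = j then 1 else 0)) \<and>
          (\<forall>\<mu> w. \<mu> > 0 \<longrightarrow> gram_eigen X ipX ipY T \<mu> w \<longrightarrow>
             (\<forall>i. \<sigma> i > 0 \<longrightarrow> ipX w (u i) = 0) \<longrightarrow> ipX w w = 0))"

end

theory Submission
  imports Defs
begin

text \<open>
  Let \<open>V\<^sub>0\<close> be the space of the functions in \<open>V\<^sub>W\<close> that vanish at both endpoints of the edge.
  Adding an element of \<open>V\<^sub>0\<close> to a minimizer \<open>\<psi>\<^sup>*\<close> preserves its constraints, so minimality of the norm
  makes \<open>\<psi>\<^sup>*\<close> orthogonal to \<open>V\<^sub>0\<close> (\<open>minimizer_orthogonal\<close>). Therefore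
  \<open>T u = u - u(x\<^sub>1) \<psi>\<^sub>1\<^sup>* - u(x\<^sub>2) \<psi>\<^sub>2\<^sup>*\<close> is the orthogonal projection onto \<open>V\<^sub>0\<close>, in particular a
  contraction. On \<open>V\<^sub>0\<close> every oversampling operator is the mere restriction to the edge, whichever
  interpolation functions it is built with. Hence \<open>P\<^sub>O\<^sub>S\<^sup>* = P\<^sub>O\<^sub>S \<circ> T\<close>, and composing with a contraction
  does not increase singular values (\<open>singular_values_contraction\<close>).

  The last step is the min-max principle. Singular values are given by eigenvectors here, so its
  upper half needs that a compact quadratic form attains its maximum on the orthogonal complement of
  finitely many eigenvectors (\<open>eigenvector_of_maximum\<close>, \<open>quotient_le_singular_value\<close>). This
  is where completeness of \<open>V\<^sub>W\<close> enters; in an incomplete space eigenvectors could be missing, and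
  the definition of singular values could be satisfied by zeros.

  Most of the text establishes that \<open>V\<^sub>W\<close> is a Hilbert space. The harmonic parts of a Cauchy
  sequence converge in \<open>H\<^sup>1\<close> and their divergences converge in \<open>L\<^sup>2\<close>; the limit is the limit
  of the harmonic parts plus the solution of a Poisson problem with zero boundary values. This
  takes the completeness of \<open>L\<^sup>2\<close> and \<open>H\<^sup>1\<close>, the uniqueness of weak gradients and divergences
  (\<open>fundamental_lemma\<close>), the closedness of zero traces under \<open>H\<^sup>1\<close>-limits
  (\<open>trace_on_segment_closed\<close>), the Poincare inequality (\<open>H10_Poincare\<close>) and the Riesz
  representation theorem for the energy. The same facts make the inner product on the edge space
  bilinear. The oversampling region is a rectangle (\<open>oversampling_region_box\<close>), so rectangles
  are the only domains that occur.

  A function space is a set of functions with a positive semidefinite inner product. Instead of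
  passing to classes of functions, functions at distance zero are exchanged inside inner products,
  which is allowed by the Cauchy-Schwarz inequality (\<open>ip_cong_null\<close>).
\<close>

section \<open>Semi-inner-product spaces\<close>

text \<open>The two uses are the Cauchy-Schwarz inequality and the orthogonality of a minimizer.\<close>

lemma discriminant_nonneg_quadratic:
  fixes A B C :: real
  assumes poly: "\<And>c. 0 \<le> A + 2 * c * B + c\<^sup>2 * C" and C: "0 \<le> C"
  shows "B\<^sup>2 \<le> A * C"
proof (cases "C = 0")
  case True
  have "A \<ge> 0" using poly[of 0] by simp
  have "B = 0"
  proof (rule ccontr)
    assume "B \<noteq> 0"
    then show False using poly[of "- (A + 1) / B"] True \<open>A \<ge> 0\<close> by simp
  qed
  then show ?thesis using True by simp
next
  case False
  have "0 \<le> A + 2 * (- B / C) * B + (- B / C)\<^sup>2 * C" by (rule poly)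
  also have "\<dots> = A - B\<^sup>2 / C" using False by (simp add: field_simps power2_eq_square)
  finally show ?thesis using C False by (simp add: field_simps)
qed

locale semi_inner_space =
  fixes X :: "('x \<Rightarrow> real) set" and ip :: "('x \<Rightarrow> real) \<Rightarrow> ('x \<Rightarrow> real) \<Rightarrow> real"
  assumes zero_in: "(\<lambda>_. 0) \<in> X"
    and lin_in: "\<And>u v c. u \<in> X \<Longrightarrow> v \<in> X \<Longrightarrow> (\<lambda>x. u x + c * v x) \<in> X"
    and ip_sym: "\<And>u v. u \<in> X \<Longrightarrow> v \<in> X \<Longrightarrow> ip u v = ip v u"
    and ip_lin: "\<And>u v w c. u \<in> X \<Longrightarrow> v \<in> X \<Longrightarrow> w \<in> X \<Longrightarrow>
                   ip (\<lambda>x. u x + c * v x) w = ip u w + c * ip v w"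
    and ip_nonneg: "\<And>u. u \<in> X \<Longrightarrow> 0 \<le> ip u u"
begin

lemma ip_lin_right:
  assumes "u \<in> X" "v \<in> X" "w \<in> X"
  shows "ip w (\<lambda>x. u x + c * v x) = ip w u + c * ip w v"
  using assms ip_lin[of u v w c] ip_sym[of w] lin_in[of u v c] by simp

lemma add_in: "u \<in> X \<Longrightarrow> v \<in> X \<Longrightarrow> (\<lambda>x. u x + v x) \<in> X"
  using lin_in[of u v 1] by simp

lemma diff_in: "u \<in> X \<Longrightarrow> v \<in> X \<Longrightarrow> (\<lambda>x. u x - v x) \<in> X"
  using lin_in[of u v "-1"] by simp

lemma scale_in: "u \<in> X \<Longrightarrow> (\<lambda>x. c * u x) \<in> X"
  using lin_in[of "\<lambda>_. 0" u c] zero_in by simp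

lemma ip_diff: "u \<in> X \<Longrightarrow> v \<in> X \<Longrightarrow> w \<in> X \<Longrightarrow> ip (\<lambda>x. u x - v x) w = ip u w - ip v w"
  using ip_lin[of u v w "-1"] by simp

lemma ip_diff_right: "u \<in> X \<Longrightarrow> v \<in> X \<Longrightarrow> w \<in> X \<Longrightarrow> ip w (\<lambda>x. u x - v x) = ip w u - ip w v"
  using ip_lin_right[of u v w "-1"] by simp

lemma ip_zero: "w \<in> X \<Longrightarrow> ip (\<lambda>_. 0) w = 0"
  using ip_lin[of "\<lambda>_. 0" "\<lambda>_. 0" w 1] zero_in by simp

lemma ip_scale: "u \<in> X \<Longrightarrow> w \<in> X \<Longrightarrow> ip (\<lambda>x. c * u x) w = c * ip u w"
  using ip_lin[of "\<lambda>_. 0" u w c] zero_in ip_zero by simp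

lemma ip_scale_right: "u \<in> X \<Longrightarrow> w \<in> X \<Longrightarrow> ip w (\<lambda>x. c * u x) = c * ip w u"
  using ip_scale ip_sym scale_in by metis

lemma ip_expand:
  assumes "u \<in> X" "v \<in> X"
  shows "ip (\<lambda>x. u x + c * v x) (\<lambda>x. u x + c * v x) = ip u u + 2 * c * ip u v + c\<^sup>2 * ip v v"
  using assms
  by (simp add: ip_lin ip_lin_right lin_in ip_sym[of v u] power2_eq_square algebra_simps)

lemma ip_diff_expand:
  assumes "u \<in> X" "v \<in> X"
  shows "ip (\<lambda>x. u x - v x) (\<lambda>x. u x - v x) = ip u u - 2 * ip u v + ip v v"
  using ip_expand[OF assms, of "-1"] by simp

lemma ip_add_expand:
  assumes "u \<in> X" "v \<in> X"
  shows "ip (\<lambda>x. u x + v x) (\<lambda>x. u x + v x) = ip u u + 2 * ip u v + ip v v"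
  using ip_expand[OF assms, of "1"] by simp

lemma Cauchy_Schwarz:
  assumes u: "u \<in> X" and v: "v \<in> X"
  shows "(ip u v)\<^sup>2 \<le> ip u u * ip v v"
  using ip_nonneg[OF lin_in[OF u v]] ip_nonneg[OF v]
  by (intro discriminant_nonneg_quadratic) (auto simp: ip_expand[OF u v])

lemma ip_null:
  assumes "u \<in> X" "v \<in> X" "ip u u = 0"
  shows "ip u v = 0" and "ip v u = 0"
  using Cauchy_Schwarz[of u v] ip_sym[of u v] assms by auto

text \<open>
  Functions at distance zero are interchangeable in inner products, which replaces the passage to
  equivalence classes.
\<close>

lemma ip_cong_null:
  assumes "u \<in> X" "v \<in> X" "w \<in> X" "ip (\<lambda>x. u x - v x) (\<lambda>x. u x - v x) = 0"
  shows "ip u w = ip v w"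
  using ip_null(1)[OF diff_in[OF assms(1,2)] assms(3,4)] ip_diff[OF assms(1-3)] by simp

definition nrm :: "('x \<Rightarrow> real) \<Rightarrow> real" where "nrm u = sqrt (ip u u)"

lemma nrm_nonneg: "u \<in> X \<Longrightarrow> 0 \<le> nrm u"
  by (simp add: nrm_def ip_nonneg)

lemma nrm_sq: "u \<in> X \<Longrightarrow> (nrm u)\<^sup>2 = ip u u"
  by (simp add: nrm_def ip_nonneg)

lemma abs_ip_le: "u \<in> X \<Longrightarrow> v \<in> X \<Longrightarrow> \<bar>ip u v\<bar> \<le> nrm u * nrm v"
  unfolding nrm_def using Cauchy_Schwarz[of u v]
  by (metis real_sqrt_abs real_sqrt_le_iff real_sqrt_mult)

lemma nrm_triangle:
  assumes u: "u \<in> X" and v: "v \<in> X"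
  shows "nrm (\<lambda>x. u x + v x) \<le> nrm u + nrm v"
proof (rule power2_le_imp_le)
  show "(nrm (\<lambda>x. u x + v x))\<^sup>2 \<le> (nrm u + nrm v)\<^sup>2"
    using abs_ip_le[OF u v]
    by (simp add: nrm_sq add_in u v ip_add_expand power2_sum)
qed (simp add: nrm_nonneg u v)

lemma nrm_minus_commute:
  assumes u: "u \<in> X" and v: "v \<in> X"
  shows "nrm (\<lambda>x. u x - v x) = nrm (\<lambda>x. v x - u x)"
  unfolding nrm_def by (simp add: ip_diff_expand u v ip_sym)

lemma nrm_triangle_diff:
  assumes u: "u \<in> X" and v: "v \<in> X" and w: "w \<in> X"
  shows "nrm (\<lambda>x. u x - w x) \<le> nrm (\<lambda>x. u x - v x) + nrm (\<lambda>x. v x - w x)"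
  using nrm_triangle[OF diff_in[OF u v] diff_in[OF v w]] by simp

lemma nrm_scale: "u \<in> X \<Longrightarrow> nrm (\<lambda>x. c * u x) = \<bar>c\<bar> * nrm u"
  unfolding nrm_def by (simp add: ip_scale ip_scale_right scale_in real_sqrt_mult)

lemma nrm_diff_ge:
  assumes u: "u \<in> X" and v: "v \<in> X"
  shows "\<bar>nrm u - nrm v\<bar> \<le> nrm (\<lambda>x. u x - v x)"
proof -
  have "nrm u \<le> nrm (\<lambda>x. u x - v x) + nrm v"
    using nrm_triangle[OF diff_in[OF u v] v] by simp
  moreover have "nrm v \<le> nrm (\<lambda>x. v x - u x) + nrm u"
    using nrm_triangle[OF diff_in[OF v u] u] by simp
  ultimately show ?thesis using nrm_minus_commute[OF u v] by simp
qed

lemma ip_tendsto_0_iff: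
  assumes "\<And>k. u k \<in> X"
  shows "(\<lambda>k. ip (u k) (u k)) \<longlonglongrightarrow> 0 \<longleftrightarrow> (\<lambda>k. nrm (u k)) \<longlonglongrightarrow> 0"
proof
  assume "(\<lambda>k. ip (u k) (u k)) \<longlonglongrightarrow> 0"
  then show "(\<lambda>k. nrm (u k)) \<longlonglongrightarrow> 0" unfolding nrm_def using tendsto_real_sqrt by fastforce
next
  assume "(\<lambda>k. nrm (u k)) \<longlonglongrightarrow> 0"
  then have "(\<lambda>k. (nrm (u k))\<^sup>2) \<longlonglongrightarrow> 0" using tendsto_power[of _ 0 _ 2] by fastforce
  then show "(\<lambda>k. ip (u k) (u k)) \<longlonglongrightarrow> 0" by (simp add: nrm_sq assms)
qed

lemma nrm_tendsto:
  assumes "\<And>k. u k \<in> X" "w \<in> X" "(\<lambda>k. nrm (\<lambda>x. u k x - w x)) \<longlonglongrightarrow> 0"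
  shows "(\<lambda>k. nrm (u k)) \<longlonglongrightarrow> nrm w"
proof -
  have "(\<lambda>k. nrm (u k) - nrm w) \<longlonglongrightarrow> 0"
    by (rule Lim_null_comparison[OF _ assms(3)]) (simp add: nrm_diff_ge assms)
  then show ?thesis by (rule LIM_zero_cancel)
qed

lemma ip_tendsto:
  assumes u: "\<And>k. u k \<in> X" and w: "w \<in> X" and v: "v \<in> X"
    and lim: "(\<lambda>k. nrm (\<lambda>x. u k x - w x)) \<longlonglongrightarrow> 0"
  shows "(\<lambda>k. ip (u k) v) \<longlonglongrightarrow> ip w v"
proof -
  have "(\<lambda>k. ip (u k) v - ip w v) \<longlonglongrightarrow> 0"
  proof (rule Lim_null_comparison)
    show "\<forall>\<^sub>F k in sequentially. norm (ip (u k) v - ip w v) \<le> nrm (\<lambda>x. u k x - w x) * nrm v"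
      using abs_ip_le[OF diff_in[OF u w] v] by (simp add: ip_diff u v w)
    show "(\<lambda>k. nrm (\<lambda>x. u k x - w x) * nrm v) \<longlonglongrightarrow> 0"
      using tendsto_mult_left_zero[OF lim] .
  qed
  then show ?thesis by (rule LIM_zero_cancel)
qed

definition Cauchy_seq :: "(nat \<Rightarrow> 'x \<Rightarrow> real) \<Rightarrow> bool" where
  "Cauchy_seq u \<longleftrightarrow> (\<forall>d>0. \<exists>N. \<forall>k\<ge>N. \<forall>m\<ge>N. nrm (\<lambda>x. u k x - u m x) < d)"

lemma Cauchy_seqI_tendsto:
  assumes u: "\<And>k. u k \<in> X" and w: "w \<in> X" and lim: "(\<lambda>k. nrm (\<lambda>x. u k x - w x)) \<longlonglongrightarrow> 0"
  shows "Cauchy_seq u"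
  unfolding Cauchy_seq_def
proof (intro allI impI)
  fix d :: real assume "d > 0"
  then have "\<forall>\<^sub>F k in sequentially. nrm (\<lambda>x. u k x - w x) < d / 2"
    using order_tendstoD(2)[OF lim, of "d/2"] by simp
  then obtain N where N: "\<And>k. k \<ge> N \<Longrightarrow> nrm (\<lambda>x. u k x - w x) < d / 2"
    by (auto simp: eventually_sequentially)
  have "nrm (\<lambda>x. u k x - u m x) < d" if "k \<ge> N" "m \<ge> N" for k m
    using nrm_triangle_diff[OF u w u, of k m] nrm_minus_commute[OF u w, of m] N[OF that(1)] N[OF that(2)]
    by simp
  then show "\<exists>N. \<forall>k\<ge>N. \<forall>m\<ge>N. nrm (\<lambda>x. u k x - u m x) < d" by blast
qed

text \<open>
  The form in which uniform convexity is used: \<open>\<delta> k\<close> is the amount by which \<open>u k\<close> misses the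
  minimum.
\<close>

lemma Cauchy_seqI_defect:
  assumes u: "\<And>k. u k \<in> X"
    and bound: "\<And>k m. ip (\<lambda>x. u k x - u m x) (\<lambda>x. u k x - u m x) \<le> C * (\<delta> k + \<delta> m)"
    and lim: "\<delta> \<longlonglongrightarrow> 0" and C: "C \<ge> 0"
  shows "Cauchy_seq u"
  unfolding Cauchy_seq_def
proof (intro allI impI)
  fix d :: real assume d: "d > 0"
  define t where "t = d\<^sup>2 / (2 * (C + 1))"
  have td: "(C + 1) * (t + t) = d\<^sup>2" using C unfolding t_def
    by (simp add: add_divide_distrib[symmetric] field_simps del: distrib_left)
  have "t > 0" using d C by (simp add: t_def)
  then obtain N where N: "\<And>k. k \<ge> N \<Longrightarrow> \<delta> k < t"
    using order_tendstoD(2)[OF lim] by (auto simp: eventually_sequentially)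
  have "nrm (\<lambda>x. u k x - u m x) < d" if "k \<ge> N" "m \<ge> N" for k m
  proof -
    have "C * (\<delta> k + \<delta> m) \<le> C * (t + t)"
      using N[OF that(1)] N[OF that(2)] C by (intro mult_left_mono) auto
    also have "\<dots> < (C + 1) * (t + t)" using \<open>t > 0\<close> by (simp add: algebra_simps)
    also have "\<dots> = d\<^sup>2" by (rule td)
    finally have "C * (\<delta> k + \<delta> m) < d\<^sup>2" .
    then have "ip (\<lambda>x. u k x - u m x) (\<lambda>x. u k x - u m x) < d\<^sup>2" using bound[of k m] by simp
    then show ?thesis unfolding nrm_def using d real_less_lsqrt by (simp add: real_sqrt_less_iff)
  qed
  then show "\<exists>N. \<forall>k\<ge>N. \<forall>m\<ge>N. nrm (\<lambda>x. u k x - u m x) < d" by blast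
qed

lemma sum_in: "finite J \<Longrightarrow> (\<And>j. j \<in> J \<Longrightarrow> u j \<in> X) \<Longrightarrow> (\<lambda>x. \<Sum>j\<in>J. c j * u j x) \<in> X"
proof (induction J rule: finite_induct)
  case empty
  then show ?case using zero_in by simp
next
  case (insert j J)
  then show ?case using lin_in[of "\<lambda>x. \<Sum>j\<in>J. c j * u j x" "u j" "c j"] by (simp add: add.commute)
qed

lemma ip_sum:
  "finite J \<Longrightarrow> (\<And>j. j \<in> J \<Longrightarrow> u j \<in> X) \<Longrightarrow> w \<in> X \<Longrightarrow>
     ip (\<lambda>x. \<Sum>j\<in>J. c j * u j x) w = (\<Sum>j\<in>J. c j * ip (u j) w)"
proof (induction J rule: finite_induct)
  case empty
  then show ?case using ip_zero by simp
next
  case (insert j J)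
  then show ?case using ip_lin[of "\<lambda>x. \<Sum>j\<in>J. c j * u j x" "u j" w "c j"] sum_in[of J u c]
    by (simp add: add.commute)
qed

lemma subspace_semi_inner_space:
  assumes "Y \<subseteq> X" "(\<lambda>_. 0) \<in> Y" "\<And>u v c. u \<in> Y \<Longrightarrow> v \<in> Y \<Longrightarrow> (\<lambda>x. u x + c * v x) \<in> Y"
  shows "semi_inner_space Y ip"
  using assms by unfold_locales (auto intro: ip_sym ip_lin ip_nonneg)

end

section \<open>Hilbert spaces and the Riesz representation theorem\<close>

locale semi_Hilbert_space = semi_inner_space +
  assumes complete: "\<And>u. (\<And>k. u k \<in> X) \<Longrightarrow> Cauchy_seq u \<Longrightarrow>
                       \<exists>w\<in>X. (\<lambda>k. nrm (\<lambda>x. u k x - w x)) \<longlonglongrightarrow> 0"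
begin

lemma closed_subspace:
  assumes Y: "Y \<subseteq> X" "(\<lambda>_. 0) \<in> Y" "\<And>u v c. u \<in> Y \<Longrightarrow> v \<in> Y \<Longrightarrow> (\<lambda>x. u x + c * v x) \<in> Y"
    and closed: "\<And>u w. (\<And>k::nat. u k \<in> Y) \<Longrightarrow> w \<in> X \<Longrightarrow> (\<lambda>k. nrm (\<lambda>x. u k x - w x)) \<longlonglongrightarrow> 0 \<Longrightarrow> w \<in> Y"
  shows "semi_Hilbert_space Y ip"
proof -
  interpret Y: semi_inner_space Y ip by (rule subspace_semi_inner_space[OF Y])
  show ?thesis
  proof
    fix u :: "nat \<Rightarrow> 'a \<Rightarrow> real" assume u: "\<And>k. u k \<in> Y" and C: "Cauchy_seq u"
    have "u k \<in> X" for k using u Y(1) by blast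
    from complete[OF this C] obtain w where w: "w \<in> X" "(\<lambda>k. nrm (\<lambda>x. u k x - w x)) \<longlonglongrightarrow> 0" by blast
    from closed[OF u w] w(2) show "\<exists>w\<in>Y. (\<lambda>k. nrm (\<lambda>x. u k x - w x)) \<longlonglongrightarrow> 0" by blast
  qed
qed

text \<open>
  The representer minimizes \<open>J v = ip v v - 2 F v\<close>; by the parallelogram identity a minimizing
  sequence is Cauchy.
\<close>

lemma Riesz_representation:
  assumes F_lin: "\<And>u v c. u \<in> X \<Longrightarrow> v \<in> X \<Longrightarrow> F (\<lambda>x. u x + c * v x) = F u + c * F v"
    and F_bounded: "\<And>u. u \<in> X \<Longrightarrow> \<bar>F u\<bar> \<le> C * nrm u"
  shows "\<exists>w\<in>X. \<forall>v\<in>X. ip w v = F v"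
proof -
  define J where "J v = ip v v - 2 * F v" for v
  have bdd: "J v \<ge> - C\<^sup>2" if "v \<in> X" for v
  proof -
    have "0 \<le> (nrm v - C)\<^sup>2" by simp
    then show ?thesis using F_bounded[OF that] nrm_sq[OF that]
      unfolding J_def power2_diff by (simp add: abs_le_iff mult.commute)
  qed
  define m where "m = Inf (J ` X)"
  have bb: "bdd_below (J ` X)" by (rule bdd_belowI2[where m = "- C\<^sup>2"]) (rule bdd)
  have m_le: "m \<le> J v" if "v \<in> X" for v
    unfolding m_def using bb that by (intro cInf_lower) auto
  have "\<exists>v\<in>X. J v < m + inverse (real (Suc k))" for k
  proof -
    have "Inf (J ` X) < m + inverse (real (Suc k))" unfolding m_def by simp
    then show ?thesis using cInf_less_iff[of "J ` X"] zero_in bb by auto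
  qed
  then obtain u where u: "\<And>k. u k \<in> X" and Ju: "\<And>k. J (u k) < m + inverse (real (Suc k))"
    by metis
  have defect: "ip (\<lambda>x. v x - w x) (\<lambda>x. v x - w x) \<le> 2 * ((J v - m) + (J w - m))"
    if v: "v \<in> X" and w: "w \<in> X" for v w
  proof -
    define z where "z = (\<lambda>x. 1/2 * (v x + 1 * w x))"
    have mid: "z \<in> X" unfolding z_def by (intro scale_in lin_in v w)
    have "F z = F v / 2 + F w / 2"
      unfolding z_def using F_lin[OF zero_in lin_in[OF v w, of 1], of "1/2"] F_lin[OF zero_in zero_in, of 1] F_lin[OF v w, of 1]
      by simp
    moreover have "ip z z = ip v v / 4 + ip v w / 2 + ip w w / 4"
      using ip_scale[OF lin_in[OF v w, of 1] mid[unfolded z_def], of "1/2"]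
        ip_scale_right[OF lin_in[OF v w, of 1] lin_in[OF v w, of 1], of "1/2"] ip_expand[OF v w, of 1]
      unfolding z_def by simp
    ultimately have "m \<le> ip v v / 4 + ip v w / 2 + ip w w / 4 - F v - F w"
      using m_le[OF mid] unfolding J_def by linarith
    then show ?thesis unfolding J_def ip_diff_expand[OF v w] by simp
  qed
  have "Cauchy_seq u"
  proof (rule Cauchy_seqI_defect[OF u, where C = 2 and \<delta> = "\<lambda>k. inverse (real (Suc k))"])
    fix k l
    show "ip (\<lambda>x. u k x - u l x) (\<lambda>x. u k x - u l x)
            \<le> 2 * (inverse (real (Suc k)) + inverse (real (Suc l)))"
      using defect[OF u u, of k l] Ju[of k] Ju[of l] by simp
  qed (use LIMSEQ_inverse_real_of_nat in auto)
  then obtain w where w: "w \<in> X" and lim: "(\<lambda>k. nrm (\<lambda>x. u k x - w x)) \<longlonglongrightarrow> 0"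
    using complete[of u] u by blast
  have "(\<lambda>k. F (u k) - F w) \<longlonglongrightarrow> 0"
  proof (rule Lim_null_comparison)
    show "\<forall>\<^sub>F k in sequentially. norm (F (u k) - F w) \<le> C * nrm (\<lambda>x. u k x - w x)"
      using F_bounded[OF diff_in[OF u w]] F_lin[OF u w, of _ "-1"] by simp
    show "(\<lambda>k. C * nrm (\<lambda>x. u k x - w x)) \<longlonglongrightarrow> 0" using tendsto_mult_right_zero[OF lim] .
  qed
  then have "(\<lambda>k. F (u k)) \<longlonglongrightarrow> F w" by (rule LIM_zero_cancel)
  moreover have "(\<lambda>k. ip (u k) (u k)) \<longlonglongrightarrow> ip w w"
    using tendsto_power[OF nrm_tendsto[OF u w lim], of 2] by (simp add: nrm_sq u w)
  ultimately have "(\<lambda>k. J (u k)) \<longlonglongrightarrow> J w" unfolding J_def by (intro tendsto_intros)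
  moreover have "(\<lambda>k. J (u k)) \<longlonglongrightarrow> m"
  proof (rule tendsto_sandwich[OF _ _ tendsto_const])
    show "(\<lambda>k. m + inverse (real (Suc k))) \<longlonglongrightarrow> m"
      using tendsto_add[OF tendsto_const LIMSEQ_inverse_real_of_nat, of m] by simp
    show "\<forall>\<^sub>F k in sequentially. J (u k) \<le> m + inverse (real (Suc k))"
      using less_imp_le[OF Ju] by (intro always_eventually allI)
  qed (use m_le[OF u] in simp)
  ultimately have Jw: "J w = m" by (rule LIMSEQ_unique)
  have "ip w v = F v" if v: "v \<in> X" for v
  proof -
    have ineq: "0 \<le> 2 * t * (ip w v - F v) + t\<^sup>2 * ip v v" for t
      using m_le[OF lin_in[OF w v, of t]] Jw unfolding J_def ip_expand[OF w v] F_lin[OF w v]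
      by (simp add: algebra_simps)
    show ?thesis
    proof (rule ccontr)
      assume ne: "ip w v \<noteq> F v"
      define d where "d = ip w v - F v"
      have nn: "ip v v \<ge> 0" using ip_nonneg[OF v] .
      let ?t = "- d / (ip v v + 1)"
      have "2 * ?t * d + ?t\<^sup>2 * ip v v = - d\<^sup>2 / (ip v v + 1) * (2 - ip v v / (ip v v + 1))"
        using nn by (simp add: divide_simps power2_eq_square) (simp add: algebra_simps)
      also have "\<dots> < 0"
      proof (rule mult_neg_pos)
        show "- d\<^sup>2 / (ip v v + 1) < 0" using nn ne by (simp add: d_def divide_neg_pos)
        show "0 < 2 - ip v v / (ip v v + 1)" using nn by (simp add: divide_less_eq)
      qed
      finally show False using ineq[of ?t] unfolding d_def by simp
    qed
  qed
  then show ?thesis using w by blast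
qed

end

section \<open>Compact quadratic forms and their singular values\<close>

text \<open>
  For a compact operator \<open>S\<close> on \<open>X\<close>, the form \<open>q u v = \<langle>S u, S v\<rangle>\<close> carries all the information
  about its singular values, and compactness of \<open>S\<close> says that bounded sequences have
  subsequences that are Cauchy for \<open>q\<close>. The target space therefore does not appear
  in the locale.
\<close>

locale compact_form = semi_Hilbert_space X ip + Q: semi_inner_space X q
  for X :: "('x \<Rightarrow> real) set" and ip q +
  assumes compact: "\<And>u. (\<And>k::nat. u k \<in> X) \<Longrightarrow> (\<exists>C. \<forall>k. ip (u k) (u k) \<le> C) \<Longrightarrow>
                      \<exists>r. strict_mono r \<and> Q.Cauchy_seq (\<lambda>k. u (r k))"
begin

text \<open>
  If \<open>q (u k) (u k) > k\<^sup>2 ip (u k) (u k)\<close>, then rescaling \<open>u k\<close> to \<open>q\<close>-norm \<open>k\<close> gives an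
  \<open>ip\<close>-bounded sequence without a \<open>q\<close>-Cauchy subsequence. Rescaling in the \<open>q\<close>-norm also covers
  the case that \<open>ip (u k) (u k)\<close> is zero.
\<close>

lemma bounded: "\<exists>C\<ge>0. \<forall>u\<in>X. q u u \<le> C * ip u u"
proof (rule ccontr)
  assume "\<not> ?thesis"
  then have "\<exists>u\<in>X. q u u > (real k)\<^sup>2 * ip u u" for k :: nat
    by (metis linorder_not_le zero_le_power2)
  then obtain u where u: "\<And>k. u k \<in> X" and qu: "\<And>k. q (u k) (u k) > (real k)\<^sup>2 * ip (u k) (u k)"
    by metis
  have Qpos: "Q.nrm (u k) > 0" for k
    unfolding Q.nrm_def using qu[of k] ip_nonneg[OF u, of k]
    by (simp add: le_less_trans[OF mult_nonneg_nonneg[OF zero_le_power2]])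
  define c where "c k = real k / Q.nrm (u k)" for k
  define v where "v k = (\<lambda>x. c k * u k x)" for k
  have v: "v k \<in> X" for k unfolding v_def by (intro scale_in u)
  have "ip (v k) (v k) \<le> 1" for k
  proof -
    have "ip (v k) (v k) = (c k)\<^sup>2 * ip (u k) (u k)"
      unfolding v_def by (simp add: ip_scale ip_scale_right scale_in u power2_eq_square)
    also have "\<dots> = ((real k)\<^sup>2 * ip (u k) (u k)) / q (u k) (u k)"
      unfolding c_def by (simp add: power_divide Q.nrm_sq u)
    also have "\<dots> \<le> 1"
    proof -
      have "q (u k) (u k) > 0" using Q.nrm_sq[OF u, of k] Qpos[of k] by (metis zero_less_power)
      then show ?thesis using qu[of k] by simp
    qed
    finally show ?thesis .
  qed
  then obtain r where r: "strict_mono r" and C: "Q.Cauchy_seq (\<lambda>k. v (r k))"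
    using compact[of v] v by blast
  obtain N where N: "\<And>k m. k \<ge> N \<Longrightarrow> m \<ge> N \<Longrightarrow> Q.nrm (\<lambda>x. v (r k) x - v (r m) x) < 1"
    using C unfolding Q.Cauchy_seq_def by (metis zero_less_one)
  have Qv: "Q.nrm (v k) = real k" for k
    unfolding v_def Q.nrm_scale[OF u] c_def using Qpos[of k] by simp
  obtain k where k: "real k > real (r N) + 1" using reals_Archimedean2 by blast
  let ?k = "max k N"
  have "Q.nrm (v (r ?k)) \<ge> real k" unfolding Qv using seq_suble[OF r, of ?k] by simp
  moreover have "Q.nrm (v (r ?k)) \<le> real (r N) + 1"
    using Q.nrm_diff_ge[OF v v, of "r ?k" "r N"] N[of ?k N] unfolding Qv by simp
  ultimately show False using k by simp
qed

text \<open>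
  Along a maximizing sequence on the unit sphere that is Cauchy for \<open>q\<close>, the midpoints are almost
  maximizing too, which by the parallelogram identity forces the sequence to be Cauchy for \<open>ip\<close>. Its
  limit maximizes the quotient of \<open>q\<close> and \<open>ip\<close>, hence is an eigenvector.
\<close>

lemma eigenvector_of_maximum:
  assumes pos: "w0 \<in> X" "q w0 w0 > t * ip w0 w0" and t: "t \<ge> 0"
  shows "\<exists>w\<in>X. \<exists>s>t. ip w w = 1 \<and> (\<forall>v\<in>X. q w v = s * ip w v)"
proof -
  obtain C where C: "C \<ge> 0" and qC: "\<And>u. u \<in> X \<Longrightarrow> q u u \<le> C * ip u u" using bounded by blast
  define S where "S = {q u u | u. u \<in> X \<and> ip u u = 1}"
  define s where "s = Sup S"
  have bS: "bdd_above S" unfolding S_def using qC by (intro bdd_aboveI[where M = C]) force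
  have normalize: "(\<lambda>x. inverse (nrm u) * u x) \<in> X \<and>
      ip (\<lambda>x. inverse (nrm u) * u x) (\<lambda>x. inverse (nrm u) * u x) = 1 \<and>
      q (\<lambda>x. inverse (nrm u) * u x) (\<lambda>x. inverse (nrm u) * u x) = q u u / ip u u"
    if u: "u \<in> X" "ip u u > 0" for u
  proof -
    have n2: "nrm u * nrm u = ip u u" using nrm_sq[OF u(1)] by (simp add: power2_eq_square)
    have "nrm u \<noteq> 0" using n2 u(2) by auto
    then have "inverse (nrm u) * (inverse (nrm u) * ip u u) = 1"
      unfolding n2[symmetric] by (simp add: field_simps)
    moreover have "inverse (nrm u) * (inverse (nrm u) * q u u) = q u u / ip u u"
      unfolding n2[symmetric] by (simp add: field_simps)
    ultimately show ?thesis
      by (simp add: scale_in u ip_scale ip_scale_right Q.ip_scale Q.ip_scale_right)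
  qed
  have q_le: "q u u \<le> s * ip u u" if u: "u \<in> X" for u
  proof (cases "ip u u = 0")
    case True
    then show ?thesis using qC[OF u] by simp
  next
    case False
    then have p: "ip u u > 0" using ip_nonneg[OF u] by simp
    have "q u u / ip u u \<in> S" unfolding S_def mem_Collect_eq using normalize[OF u p]
      by (intro exI[of _ "\<lambda>x. inverse (nrm u) * u x"]) simp
    then have "q u u / ip u u \<le> s" unfolding s_def using bS by (intro cSup_upper)
    then show ?thesis using p by (simp add: field_simps)
  qed
  have w0: "ip w0 w0 > 0"
    using qC[OF pos(1)] pos(2) ip_nonneg[OF pos(1)] by (cases "ip w0 w0 = 0") auto
  have "q w0 w0 \<le> s * ip w0 w0" using q_le pos by blast
  then have st: "s > t" using pos(2) w0 by (smt (verit) mult_right_less_imp_less)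
  have Sne: "S \<noteq> {}" unfolding S_def using normalize[OF pos(1) w0] by blast
  have "\<exists>u\<in>X. ip u u = 1 \<and> q u u > s - inverse (real (Suc k))" for k
  proof -
    have "\<exists>y\<in>S. s - inverse (real (Suc k)) < y"
      using less_cSup_iff[OF Sne bS, of "s - inverse (real (Suc k))"] unfolding s_def by simp
    then show ?thesis unfolding S_def by auto
  qed
  then obtain u0 where u0: "\<And>k. u0 k \<in> X" and iu0: "\<And>k. ip (u0 k) (u0 k) = 1"
    and qu0: "\<And>k. q (u0 k) (u0 k) > s - inverse (real (Suc k))" by metis
  obtain r where r: "strict_mono r" and QC: "Q.Cauchy_seq (\<lambda>k. u0 (r k))"
    using compact[of u0] u0 iu0 by (metis order_refl)
  define u where "u k = u0 (r k)" for k
  have u: "u k \<in> X" and iu: "ip (u k) (u k) = 1" for k unfolding u_def by (simp_all add: u0 iu0)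
  have qu: "q (u k) (u k) > s - inverse (real (Suc k))" for k
  proof -
    have "inverse (real (Suc (r k))) \<le> inverse (real (Suc k))"
      using seq_suble[OF r, of k] by (intro le_imp_inverse_le) auto
    then show ?thesis unfolding u_def using qu0[of "r k"] by linarith
  qed
  have "Cauchy_seq u" unfolding Cauchy_seq_def
  proof (intro allI impI)
    fix d :: real assume d: "d > 0"
    have spos: "s > 0" using st t by simp
    \<comment> \<open>Near-maximality costs at most \<open>4 * (s d\<^sup>2 / 8)\<close> below, the \<open>q\<close>-distance at most \<open>s d\<^sup>2 / 2\<close>;
      together they stay below \<open>s d\<^sup>2\<close>.\<close>
    define \<eta> where "\<eta> = d * sqrt (s / 2)"
    have eta: "\<eta> > 0" using d spos by (simp add: \<eta>_def)
    obtain N1 where N1: "\<And>k m. k \<ge> N1 \<Longrightarrow> m \<ge> N1 \<Longrightarrow> Q.nrm (\<lambda>x. u k x - u m x) < \<eta>"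
      using QC eta unfolding Q.Cauchy_seq_def u_def by metis
    have "s * d\<^sup>2 / 8 > 0" using spos d by simp
    from order_tendstoD(2)[OF LIMSEQ_inverse_real_of_nat this]
    obtain N2 where N2: "\<And>k. k \<ge> N2 \<Longrightarrow> inverse (real (Suc k)) < s * d\<^sup>2 / 8"
      unfolding eventually_sequentially by blast
    have "nrm (\<lambda>x. u k x - u m x) < d" if km: "k \<ge> max N1 N2" "m \<ge> max N1 N2" for k m
    proof -
      have "q (\<lambda>x. u k x + u m x) (\<lambda>x. u k x + u m x) \<le> s * ip (\<lambda>x. u k x + u m x) (\<lambda>x. u k x + u m x)"
        by (intro q_le add_in u)
      then have 1: "q (u k) (u k) + 2 * q (u k) (u m) + q (u m) (u m) \<le> s * (2 + 2 * ip (u k) (u m))"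
        by (simp add: ip_add_expand Q.ip_add_expand u iu)
      have "(Q.nrm (\<lambda>x. u k x - u m x))\<^sup>2 < \<eta>\<^sup>2"
        using N1[of k m] km Q.nrm_nonneg[OF diff_in[OF u u]] by (intro power_strict_mono) auto
      then have 2: "q (u k) (u k) - 2 * q (u k) (u m) + q (u m) (u m) < \<eta>\<^sup>2"
        by (simp add: Q.nrm_sq diff_in u Q.ip_diff_expand)
      have eta2: "\<eta>\<^sup>2 = s * d\<^sup>2 / 2" unfolding \<eta>_def using spos by (simp add: power_mult_distrib)
        \<comment> \<open>The parallelogram identity for \<open>ip\<close> and for \<open>q\<close>, linked by \<open>q \<le> s ip\<close> at the midpoint.\<close>
      have "s * (2 - 2 * ip (u k) (u m)) = 4 * s - s * (2 + 2 * ip (u k) (u m))"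
        by (simp add: algebra_simps)
      also have "\<dots> \<le> 4 * s - 2 * (q (u k) (u k) + q (u m) (u m)) + \<eta>\<^sup>2"
        using 1 2 by simp
      also have "\<dots> < s * d\<^sup>2"
        using qu[of k] qu[of m] N2[of k] N2[of m] km unfolding eta2 by simp
      finally have "2 - 2 * ip (u k) (u m) < d\<^sup>2" using spos by simp
      then have "ip (\<lambda>x. u k x - u m x) (\<lambda>x. u k x - u m x) < d\<^sup>2"
        by (simp add: ip_diff_expand u iu)
      then show ?thesis unfolding nrm_def using d real_less_lsqrt by (simp add: real_sqrt_less_iff)
    qed
    then show "\<exists>N. \<forall>k\<ge>N. \<forall>m\<ge>N. nrm (\<lambda>x. u k x - u m x) < d" by blast
  qed
  then obtain w where w: "w \<in> X" and lim: "(\<lambda>k. nrm (\<lambda>x. u k x - w x)) \<longlonglongrightarrow> 0"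
    using complete[of u] u by blast
  have "(\<lambda>k. ip (u k) (u k)) \<longlonglongrightarrow> ip w w"
    using tendsto_power[OF nrm_tendsto[OF u w lim], of 2] by (simp add: nrm_sq u w)
  then have iw: "ip w w = 1" unfolding iu by (rule LIMSEQ_unique[OF tendsto_const, symmetric])
  have "(\<lambda>k. Q.nrm (\<lambda>x. u k x - w x)) \<longlonglongrightarrow> 0"
  proof (rule Lim_null_comparison)
    show "\<forall>\<^sub>F k in sequentially. norm (Q.nrm (\<lambda>x. u k x - w x)) \<le> sqrt C * nrm (\<lambda>x. u k x - w x)"
      using qC[OF diff_in[OF u w]] Q.ip_nonneg[OF diff_in[OF u w]]
      unfolding nrm_def Q.nrm_def real_sqrt_mult[symmetric] by simp
    show "(\<lambda>k. sqrt C * nrm (\<lambda>x. u k x - w x)) \<longlonglongrightarrow> 0" using tendsto_mult_right_zero[OF lim] .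
  qed
  from Q.nrm_tendsto[OF u w this] have "(\<lambda>k. q (u k) (u k)) \<longlonglongrightarrow> q w w"
    using tendsto_power[of "\<lambda>k. Q.nrm (u k)" "Q.nrm w" sequentially 2] by (simp add: Q.nrm_sq u w)
  moreover have "(\<lambda>k. q (u k) (u k)) \<longlonglongrightarrow> s"
  proof (rule tendsto_sandwich[OF _ _ _ tendsto_const])
    show "(\<lambda>k. s - inverse (real (Suc k))) \<longlonglongrightarrow> s"
      using tendsto_diff[OF tendsto_const LIMSEQ_inverse_real_of_nat, of s] by simp
    show "\<forall>\<^sub>F k in sequentially. q (u k) (u k) \<le> s" using q_le[OF u] iu by simp
    show "\<forall>\<^sub>F k in sequentially. s - inverse (real (Suc k)) \<le> q (u k) (u k)"
      using less_imp_le[OF qu] by (intro always_eventually allI)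
  qed
  ultimately have qw: "q w w = s" by (rule LIMSEQ_unique)
  text \<open>The form \<open>s ip - q\<close> is nonnegative and vanishes at \<open>w\<close>, so that \<open>w\<close> is in its kernel.\<close>
  interpret R: semi_inner_space X "\<lambda>u v. s * ip u v - q u v"
  proof
    fix u v w' c assume h: "u \<in> X" "v \<in> X"
    show "s * ip u v - q u v = s * ip v u - q v u" using ip_sym[OF h] Q.ip_sym[OF h] by simp
    show "s * ip (\<lambda>x. u x + c * v x) w' - q (\<lambda>x. u x + c * v x) w' =
        s * ip u w' - q u w' + c * (s * ip v w' - q v w')" if "w' \<in> X"
      using ip_lin[OF h that] Q.ip_lin[OF h that] by (simp add: algebra_simps)
  qed (use q_le zero_in lin_in in auto)
  have "q w v = s * ip w v" if "v \<in> X" for v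
    using R.ip_null(1)[OF w that] iw qw by simp
  then show ?thesis using w st iw by blast
qed

text \<open>
  The upper half of the min-max principle: off the first \<open>i\<close> eigenvectors, \<open>q\<close> is bounded by
  the \<open>i\<close>-th eigenvalue, for otherwise its maximum there would be attained at an eigenvector
  that is orthogonal to all of the \<open>u j\<close>.
\<close>

lemma quotient_le_singular_value:
  fixes \<sigma> :: "nat \<Rightarrow> real"
  assumes anti: "antimono \<sigma>" and nn: "\<And>i. 0 \<le> \<sigma> i"
    and u: "\<And>i. \<sigma> i > 0 \<Longrightarrow> u i \<in> X" 
    and eig: "\<And>i v. \<sigma> i > 0 \<Longrightarrow> v \<in> X \<Longrightarrow> q (u i) v = (\<sigma> i)\<^sup>2 * ip (u i) v"
    and orth: "\<And>i j. \<sigma> i > 0 \<Longrightarrow> \<sigma> j > 0 \<Longrightarrow> ip (u i) (u j) = (if i = j then 1 else 0)"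
    and maxi: "\<And>\<mu> w. \<mu> > 0 \<Longrightarrow> w \<in> X \<Longrightarrow> (\<And>v. v \<in> X \<Longrightarrow> q w v = \<mu> * ip w v) \<Longrightarrow>
             (\<And>i. \<sigma> i > 0 \<Longrightarrow> ip w (u i) = 0) \<Longrightarrow> ip w w = 0"
    and w: "w \<in> X" and w_orth: "\<And>j. j < i \<Longrightarrow> \<sigma> j > 0 \<Longrightarrow> ip w (u j) = 0"
  shows "q w w \<le> (\<sigma> i)\<^sup>2 * ip w w"
proof (rule ccontr)
  assume "\<not> ?thesis"
  then have big: "q w w > (\<sigma> i)\<^sup>2 * ip w w" by simp
  define J where "J = {j. j < i \<and> \<sigma> j > 0}"
  have finJ: "finite J" unfolding J_def by simp
  define M where "M = {v \<in> X. \<forall>j\<in>J. ip v (u j) = 0}"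
  have MX: "M \<subseteq> X" unfolding M_def by blast
  have uJ: "u j \<in> X" if "j \<in> J" for j using that u unfolding J_def by blast
  have M0: "(\<lambda>_. 0) \<in> M" unfolding M_def using zero_in ip_zero uJ by auto
  have Ml: "(\<lambda>x. v x + c * v' x) \<in> M" if "v \<in> M" "v' \<in> M" for v v' c
    using that unfolding M_def by (auto simp: lin_in ip_lin uJ)
  have "semi_Hilbert_space M ip"
  proof (rule closed_subspace[OF MX M0 Ml])
    fix v :: "nat \<Rightarrow> 'x \<Rightarrow> real" and w assume v: "\<And>k. v k \<in> M"
      and w: "w \<in> X" "(\<lambda>k. nrm (\<lambda>x. v k x - w x)) \<longlonglongrightarrow> 0"
    have vX: "v k \<in> X" for k using v MX by blast
    have "ip w (u j) = 0" if j: "j \<in> J" for j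
    proof -
      have "(\<lambda>k. ip (v k) (u j)) \<longlonglongrightarrow> ip w (u j)" by (rule ip_tendsto[OF vX w(1) uJ[OF j] w(2)])
      moreover have "ip (v k) (u j) = 0" for k using v j unfolding M_def by blast
      ultimately show ?thesis by (simp add: LIMSEQ_const_iff)
    qed
    then show "w \<in> M" unfolding M_def using w by blast
  qed
  interpret M: semi_Hilbert_space M ip by fact
  interpret QM: semi_inner_space M q
    by (rule Q.subspace_semi_inner_space[OF MX M0]) (rule Ml)
  interpret M: compact_form M ip q
  proof
    fix v :: "nat \<Rightarrow> 'x \<Rightarrow> real" assume v: "\<And>k. v k \<in> M" and C: "\<exists>C. \<forall>k. ip (v k) (v k) \<le> C"
    then show "\<exists>r. strict_mono r \<and> QM.Cauchy_seq (\<lambda>k. v (r k))"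
      using compact[of v] MX by blast
  qed
  have "w \<in> M" unfolding M_def J_def using w w_orth by blast
  then obtain z s where z: "z \<in> M" and s: "s > (\<sigma> i)\<^sup>2" and iz: "ip z z = 1"
    and ez: "\<And>v. v \<in> M \<Longrightarrow> q z v = s * ip z v"
    using M.eigenvector_of_maximum[OF _ big] by auto
  have zX: "z \<in> X" using z MX by blast
  have z_orth: "ip z (u j) = 0" if "j \<in> J" for j using z that unfolding M_def by blast
  \<comment> \<open>The eigenvalue equation extends from \<open>M\<close> to \<open>X\<close>: both sides vanish on the span of the \<open>u j\<close>.\<close>
  have ezX: "q z v = s * ip z v" if v: "v \<in> X" for v
  proof -
    define p where "p = (\<lambda>x. \<Sum>j\<in>J. ip v (u j) * u j x)"
    have p: "p \<in> X" unfolding p_def by (intro sum_in finJ uJ)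
    have "ip p (u j) = ip v (u j)" if j: "j \<in> J" for j
    proof -
      have "ip p (u j) = (\<Sum>k\<in>J. ip v (u k) * ip (u k) (u j))"
        unfolding p_def by (intro ip_sum finJ uJ j)
      also have "\<dots> = (\<Sum>k\<in>J. if k = j then ip v (u k) else 0)"
        using j by (intro sum.cong) (auto simp: J_def orth)
      also have "\<dots> = ip v (u j)" using j finJ by simp
      finally show ?thesis .
    qed
    then have vp: "(\<lambda>x. v x - p x) \<in> M"
      unfolding M_def using diff_in[OF v p] ip_diff[OF v p] uJ by auto
    have "ip z p = 0"
    proof -
      have "ip p z = (\<Sum>k\<in>J. ip v (u k) * ip (u k) z)" unfolding p_def by (intro ip_sum finJ uJ zX)
      also have "\<dots> = 0" using z_orth ip_sym[OF zX uJ] by (intro sum.neutral) auto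
      finally show ?thesis using ip_sym[OF zX p] by simp
    qed
    moreover have "q z p = 0"
    proof -
      have "q p z = (\<Sum>k\<in>J. ip v (u k) * q (u k) z)" unfolding p_def by (intro Q.ip_sum finJ uJ zX)
      also have "\<dots> = 0" using z_orth ip_sym[OF zX uJ] eig[OF _ zX]
        by (intro sum.neutral) (auto simp: J_def)
      finally show ?thesis using Q.ip_sym[OF zX p] by simp
    qed
    ultimately show ?thesis using ez[OF vp] ip_diff_right[OF v p zX] Q.ip_diff_right[OF v p zX] by simp
  qed
  have "ip z (u j) = 0" if j: "\<sigma> j > 0" for j
  proof (cases "j < i")
    case True
    then show ?thesis using z_orth j unfolding J_def by blast
  next
    case False
    then have "\<sigma> j \<le> \<sigma> i" using anti by (simp add: antimono_def)
    then have "(\<sigma> j)\<^sup>2 \<le> (\<sigma> i)\<^sup>2" using nn by (intro power_mono)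
    then have ne: "(\<sigma> j)\<^sup>2 \<noteq> s" using s by simp
    have "s * ip z (u j) = q z (u j)" using ezX[OF u[OF j]] by simp
    also have "\<dots> = (\<sigma> j)\<^sup>2 * ip z (u j)"
      using eig[OF j zX] Q.ip_sym[OF zX u[OF j]] ip_sym[OF zX u[OF j]] by simp
    finally show ?thesis using ne by simp
  qed
  moreover have "s > 0" using s by (smt (verit) zero_le_power2)
  ultimately have "ip z z = 0" using maxi[OF _ zX ezX] by blast
  then show False using iz by simp
qed

end

text \<open>
  Gaussian elimination: one equation with a nonzero coefficient, whose unknown is permuted to the
  last place, removes one unknown from the others.
\<close>

lemma homogeneous_system_nontrivial:
  fixes A :: "nat \<Rightarrow> nat \<Rightarrow> real"
  shows "\<exists>c. (\<exists>j\<le>i. c j \<noteq> 0) \<and> (\<forall>k<i. (\<Sum>j\<le>i. c j * A j k) = 0)"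
proof (induction i arbitrary: A)
  case 0
  show ?case by (rule exI[of _ "\<lambda>_. 1"]) simp
next
  case (Suc i)
  show ?case
  proof (cases "\<forall>j\<le>Suc i. A j i = 0")
    case True
    obtain c where c: "\<exists>j\<le>i. c j \<noteq> 0" "\<forall>k<i. (\<Sum>j\<le>i. c j * A j k) = 0" using Suc[of A] by blast
    let ?c = "\<lambda>j. if j \<le> i then c j else 0"
    have nz: "\<exists>j\<le>Suc i. ?c j \<noteq> 0" using c(1) by (metis le_Suc_eq)
    have "(\<Sum>j\<le>Suc i. ?c j * A j k) = 0" if "k < Suc i" for k
    proof (cases "k = i")
      case True
      then show ?thesis using \<open>\<forall>j\<le>Suc i. A j i = 0\<close> by (intro sum.neutral) auto
    next
      case False
      then show ?thesis using that c(2) by simp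
    qed
    then show ?thesis using nz by (intro exI[of _ ?c]) auto
  next
    case False
    then obtain p where p: "p \<le> Suc i" "A p i \<noteq> 0" by blast
    define \<pi> where "\<pi> j = (if j = p then Suc i else if j = Suc i then p else j)" for j
    have inv: "\<pi> (\<pi> j) = j" for j unfolding \<pi>_def by auto
    have bij: "bij_betw \<pi> {..Suc i} {..Suc i}"
      by (rule bij_betw_byWitness[where f' = \<pi>]) (use p in \<open>auto simp: \<pi>_def\<close>)
    define B where "B j k = A (\<pi> j) k" for j k
    have Bp: "B (Suc i) i \<noteq> 0" unfolding B_def \<pi>_def using p by auto
    obtain c where c: "\<exists>j\<le>i. c j \<noteq> 0"
      "\<forall>k<i. (\<Sum>j\<le>i. c j * (B j k - B j i / B (Suc i) i * B (Suc i) k)) = 0"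
      using Suc[of "\<lambda>j k. B j k - B j i / B (Suc i) i * B (Suc i) k"] by blast
    define d where "d j = (if j \<le> i then c j else - (\<Sum>l\<le>i. c l * B l i) / B (Suc i) i)" for j
    have dB: "(\<Sum>j\<le>Suc i. d j * B j k) = 0" if "k < Suc i" for k
    proof -
      have 1: "(\<Sum>j\<le>Suc i. d j * B j k) = (\<Sum>j\<le>i. c j * B j k) - (\<Sum>l\<le>i. c l * B l i) / B (Suc i) i * B (Suc i) k"
        unfolding d_def by simp
      show ?thesis
      proof (cases "k = i")
        case True
        then show ?thesis using 1 Bp by simp
      next
        case False
        then have "(\<Sum>j\<le>i. c j * (B j k - B j i / B (Suc i) i * B (Suc i) k)) = 0" using c(2) that by simp
        then show ?thesis unfolding 1
          by (simp add: right_diff_distrib sum_subtractf sum_divide_distrib sum_distrib_right mult.assoc)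
      qed
    qed
    have "(\<Sum>j\<le>Suc i. d (\<pi> j) * A j k) = 0" if "k < Suc i" for k
    proof -
      have "(\<Sum>j\<le>Suc i. d (\<pi> j) * A j k) = (\<Sum>j\<le>Suc i. d (\<pi> (\<pi> j)) * A (\<pi> j) k)"
        using sum.reindex_bij_betw[OF bij, of "\<lambda>j. d (\<pi> j) * A j k"] by simp
      then show ?thesis using dB[OF that] unfolding inv B_def by simp
    qed
    then have "\<forall>k<Suc i. (\<Sum>j\<le>Suc i. d (\<pi> j) * A j k) = 0" by blast
    moreover obtain j where j: "j \<le> i" "c j \<noteq> 0" using c(1) by blast
    have "\<pi> j \<le> Suc i" "d (\<pi> (\<pi> j)) \<noteq> 0" using j p unfolding inv by (auto simp: \<pi>_def d_def)
    then have "\<exists>j\<le>Suc i. d (\<pi> j) \<noteq> 0" by blast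
    ultimately show ?thesis by (intro exI[of _ "\<lambda>j. d (\<pi> j)"]) blast
  qed
qed

text \<open>
  Counting dimensions, some nontrivial combination \<open>w\<close> of the first \<open>i + 1\<close> eigenvectors of
  \<open>q (T \<cdot>) (T \<cdot>)\<close> has \<open>T w\<close> orthogonal to the first \<open>i\<close> eigenvectors of \<open>q\<close>. For it,
  \<open>(\<tau> i)\<^sup>2 ip w w \<le> q (T w) (T w) \<le> (\<sigma> i)\<^sup>2 ip (T w) (T w) \<le> (\<sigma> i)\<^sup>2 ip w w\<close>.
\<close>

lemma (in compact_form) singular_values_contraction:
  fixes \<sigma> \<tau> :: "nat \<Rightarrow> real"
  assumes anti: "antimono \<sigma>" and nn: "\<And>i. 0 \<le> \<sigma> i"
    and u: "\<And>i. \<sigma> i > 0 \<Longrightarrow> u i \<in> X" 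
    and eig: "\<And>i v. \<sigma> i > 0 \<Longrightarrow> v \<in> X \<Longrightarrow> q (u i) v = (\<sigma> i)\<^sup>2 * ip (u i) v"
    and orth: "\<And>i j. \<sigma> i > 0 \<Longrightarrow> \<sigma> j > 0 \<Longrightarrow> ip (u i) (u j) = (if i = j then 1 else 0)"
    and maxi: "\<And>\<mu> w. \<mu> > 0 \<Longrightarrow> w \<in> X \<Longrightarrow> (\<And>v. v \<in> X \<Longrightarrow> q w v = \<mu> * ip w v) \<Longrightarrow>
             (\<And>i. \<sigma> i > 0 \<Longrightarrow> ip w (u i) = 0) \<Longrightarrow> ip w w = 0"
    and T_in: "\<And>v. v \<in> X \<Longrightarrow> T v \<in> X"
    and T_lin: "\<And>v w c. v \<in> X \<Longrightarrow> w \<in> X \<Longrightarrow> T (\<lambda>x. v x + c * w x) = (\<lambda>x. T v x + c * T w x)"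
    and T_contr: "\<And>v. v \<in> X \<Longrightarrow> ip (T v) (T v) \<le> ip v v"
    and anti': "antimono \<tau>"
    and u': "\<And>i. \<tau> i > 0 \<Longrightarrow> u' i \<in> X" 
    and eig': "\<And>i v. \<tau> i > 0 \<Longrightarrow> v \<in> X \<Longrightarrow> q (T (u' i)) (T v) = (\<tau> i)\<^sup>2 * ip (u' i) v"
    and orth': "\<And>i j. \<tau> i > 0 \<Longrightarrow> \<tau> j > 0 \<Longrightarrow> ip (u' i) (u' j) = (if i = j then 1 else 0)"
  shows "\<tau> i \<le> \<sigma> i"
proof (cases "\<tau> i > 0")
  case False
  then show ?thesis using nn[of i] by simp
next
  case True
  have pos: "\<tau> j > 0" if "j \<le> i" for j using True anti' that by (metis antimonoD less_le_trans)
  obtain c where c: "\<exists>j\<le>i. c j \<noteq> 0" 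
    and c0: "\<And>k. k < i \<Longrightarrow> (\<Sum>j\<le>i. c j * ip (T (u' j)) (u k)) = 0"
    using homogeneous_system_nontrivial[of i "\<lambda>j k. ip (T (u' j)) (u k)"] by blast
  define w where "w = (\<lambda>x. \<Sum>j\<in>{..i}. c j * u' j x)"
  have w: "w \<in> X" unfolding w_def using u' pos by (intro sum_in) auto
  have T0: "T (\<lambda>_. 0) = (\<lambda>_. 0)"
  proof -
    have "T (\<lambda>_. 0) = (\<lambda>x. T (\<lambda>_. 0) x + 1 * T (\<lambda>_. 0) x)" using T_lin[OF zero_in zero_in, of 1] by simp
    then show ?thesis by (auto simp: fun_eq_iff)
  qed
  have T_sum: "T (\<lambda>x. \<Sum>j\<in>J. c j * u' j x) = (\<lambda>x. \<Sum>j\<in>J. c j * T (u' j) x)"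
    if "finite J" "J \<subseteq> {..i}" for J
    using that
  proof (induction J rule: finite_induct)
    case empty
    then show ?case using T0 by simp
  next
    case (insert j J)
    have "(\<lambda>x. \<Sum>j\<in>J. c j * u' j x) \<in> X" using insert u' pos by (intro sum_in) auto
    then show ?case using insert T_lin[of "\<lambda>x. \<Sum>j\<in>J. c j * u' j x" "u' j" "c j"] u' pos
      by (simp add: add.commute)
  qed
  have Tw: "T w = (\<lambda>x. \<Sum>j\<in>{..i}. c j * T (u' j) x)" unfolding w_def by (intro T_sum) auto
  have "q (T w) (T w) \<le> (\<sigma> i)\<^sup>2 * ip (T w) (T w)"
  proof (rule quotient_le_singular_value[OF anti nn u eig orth maxi T_in[OF w]])
    fix j assume j: "j < i" "\<sigma> j > 0"
    have "ip (T w) (u j) = (\<Sum>k\<in>{..i}. c k * ip (T (u' k)) (u j))"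
      unfolding Tw using u' pos u[OF j(2)] T_in by (intro ip_sum) auto
    then show "ip (T w) (u j) = 0" using c0[OF j(1)] by simp
  qed
  also have "\<dots> \<le> (\<sigma> i)\<^sup>2 * ip w w" using T_contr[OF w] by (simp add: mult_left_mono)
  finally have upper: "q (T w) (T w) \<le> (\<sigma> i)\<^sup>2 * ip w w" .
  have iu: "ip (u' j) w = c j" if j: "j \<le> i" for j
  proof -
    have "ip w (u' j) = (\<Sum>k\<in>{..i}. c k * ip (u' k) (u' j))"
      unfolding w_def using u' pos j by (intro ip_sum) auto
    also have "\<dots> = (\<Sum>k\<in>{..i}. if k = j then c k else 0)"
      using j pos by (intro sum.cong) (auto simp: orth')
    also have "\<dots> = c j" using j by simp
    finally show ?thesis using ip_sym[OF w u'[OF pos[OF j]]] by simp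
  qed
  have iw: "ip w w = (\<Sum>j\<in>{..i}. (c j)\<^sup>2)"
  proof -
    have "ip w w = (\<Sum>j\<in>{..i}. c j * ip (u' j) w)"
      using ip_sum[of "{..i}" u' w c] u' pos w unfolding w_def[symmetric] by auto
    then show ?thesis using iu by (simp add: power2_eq_square)
  qed
  have "q (T w) (T w) = (\<Sum>j\<in>{..i}. c j * q (T (u' j)) (T w))"
    using Q.ip_sum[of "{..i}" "\<lambda>j. T (u' j)" "T w" c] u' pos T_in w unfolding Tw[symmetric] by auto
  also have "\<dots> = (\<Sum>j\<in>{..i}. (\<tau> j)\<^sup>2 * (c j)\<^sup>2)"
    using eig'[OF pos w] iu by (intro sum.cong) (auto simp: power2_eq_square)
  also have "\<dots> \<ge> (\<Sum>j\<in>{..i}. (\<tau> i)\<^sup>2 * (c j)\<^sup>2)"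
  proof (intro sum_mono mult_right_mono power_mono)
    fix j assume "j \<in> {..i}"
    then show "\<tau> i \<le> \<tau> j" using anti' by (simp add: antimono_def)
  qed (use True in auto)
  finally have "(\<tau> i)\<^sup>2 * ip w w \<le> (\<sigma> i)\<^sup>2 * ip w w"
    using upper unfolding iw sum_distrib_left by simp
  moreover have "ip w w > 0" unfolding iw using c by (auto intro!: sum_pos2)
  ultimately have "(\<tau> i)\<^sup>2 \<le> (\<sigma> i)\<^sup>2" by simp
  then show ?thesis by (rule power2_le_imp_le) (rule nn)
qed

section \<open>Completeness of \<open>L\<^sup>2\<close>\<close>

lemma L2_inner_integrable:
  fixes f g :: "'a \<Rightarrow> 'b::euclidean_space"
  assumes [measurable]: "f \<in> borel_measurable M" "g \<in> borel_measurable M"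
    and "integrable M (\<lambda>x. (norm (f x))\<^sup>2)" "integrable M (\<lambda>x. (norm (g x))\<^sup>2)"
  shows "integrable M (\<lambda>x. f x \<bullet> g x)"
proof (rule Bochner_Integration.integrable_bound)
  show "integrable M (\<lambda>x. (norm (f x))\<^sup>2 + (norm (g x))\<^sup>2)" using assms by auto
  show "AE x in M. norm (f x \<bullet> g x) \<le> norm ((norm (f x))\<^sup>2 + (norm (g x))\<^sup>2)"
  proof (rule AE_I2)
    fix x
    have "\<bar>f x \<bullet> g x\<bar> \<le> norm (f x) * norm (g x)" by (rule Cauchy_Schwarz_ineq2)
    also have "\<dots> \<le> (norm (f x))\<^sup>2 + (norm (g x))\<^sup>2"
      using sum_squares_bound[of "norm (f x)" "norm (g x)"]
        mult_nonneg_nonneg[OF norm_ge_zero[of "f x"] norm_ge_zero[of "g x"]] by linarith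
    finally show "norm (f x \<bullet> g x) \<le> norm ((norm (f x))\<^sup>2 + (norm (g x))\<^sup>2)" by simp
  qed
qed simp

lemma L2_lin_integrable:
  fixes f g :: "'a \<Rightarrow> 'b::euclidean_space"
  assumes [measurable]: "f \<in> borel_measurable M" "g \<in> borel_measurable M"
    and "integrable M (\<lambda>x. (norm (f x))\<^sup>2)" "integrable M (\<lambda>x. (norm (g x))\<^sup>2)"
  shows "integrable M (\<lambda>x. (norm (f x + c *\<^sub>R g x))\<^sup>2)"
proof -
  have "integrable M (\<lambda>x. (norm (f x))\<^sup>2 + 2 * c * (f x \<bullet> g x) + c\<^sup>2 * (norm (g x))\<^sup>2)"
    using assms L2_inner_integrable[OF assms] by auto
  moreover have "(norm (f x + c *\<^sub>R g x))\<^sup>2 = (norm (f x))\<^sup>2 + 2 * c * (f x \<bullet> g x) + c\<^sup>2 * (norm (g x))\<^sup>2" for x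
    unfolding power2_norm_eq_inner by (simp add: algebra_simps inner_commute power2_eq_square)
  ultimately show ?thesis by simp
qed

text \<open>
  A subsequence with \<open>\<parallel>f\<^sub>k\<^sub>+\<^sub>1 - f\<^sub>k\<parallel>\<^sup>2 \<le> 4\<^sup>-\<^sup>k\<close> converges almost everywhere, because the integral of
  \<open>\<Sum>k. 2\<^sup>k |f\<^sub>k\<^sub>+\<^sub>1 - f\<^sub>k|\<^sup>2\<close> is finite; Fatou's lemma turns this into convergence in \<open>L\<^sup>2\<close>.
\<close>

lemma L2_complete:
  fixes f :: "nat \<Rightarrow> 'a \<Rightarrow> 'b::euclidean_space"
  assumes f_meas[measurable]: "\<And>k. f k \<in> borel_measurable M"
    and f_int: "\<And>k. integrable M (\<lambda>x. (norm (f k x))\<^sup>2)"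
    and Cau: "\<And>d. d > 0 \<Longrightarrow> \<exists>N. \<forall>k\<ge>N. \<forall>m\<ge>N. (LINT x|M. (norm (f k x - f m x))\<^sup>2) < d"
  shows "\<exists>g. g \<in> borel_measurable M \<and> integrable M (\<lambda>x. (norm (g x))\<^sup>2) \<and>
             (\<lambda>k. LINT x|M. (norm (f k x - g x))\<^sup>2) \<longlonglongrightarrow> 0"
proof -
  have diff_int: "integrable M (\<lambda>x. (norm (f k x - f m x))\<^sup>2)" for k m
    using L2_lin_integrable[OF f_meas f_meas f_int f_int, where c = "-1"] by simp
  have nn_diff: "(\<integral>\<^sup>+x. ennreal ((norm (f k x - f m x))\<^sup>2) \<partial>M) = ennreal (LINT x|M. (norm (f k x - f m x))\<^sup>2)"
    for k m by (rule nn_integral_eq_integral[OF diff_int]) simp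
  have "\<exists>N. \<forall>k\<ge>N. \<forall>m\<ge>N. (LINT x|M. (norm (f k x - f m x))\<^sup>2) < (1/4)^j" for j :: nat
    by (rule Cau) simp
  then obtain N where N: "\<And>j k m. k \<ge> N j \<Longrightarrow> m \<ge> N j \<Longrightarrow> (LINT x|M. (norm (f k x - f m x))\<^sup>2) < (1/4)^j"
    by metis
  \<comment> \<open>Partial sums dominate every earlier \<open>N i\<close>, so that the indices need not be strictly increasing.\<close>
  define r where "r j = (\<Sum>i\<le>j. N i)" for j
  have rN: "N i \<le> r j" if "i \<le> j" for i j
    unfolding r_def using that by (intro member_le_sum) auto
  define g where "g j = f (r j)" for j
  have [measurable]: "g j \<in> borel_measurable M" for j unfolding g_def by simp
  define h where "h x = (\<Sum>j. ennreal (2 ^ j * (norm (g (Suc j) x - g j x))\<^sup>2))" for x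
  have "(\<integral>\<^sup>+x. h x \<partial>M) = (\<Sum>j. \<integral>\<^sup>+x. ennreal (2 ^ j * (norm (g (Suc j) x - g j x))\<^sup>2) \<partial>M)"
    unfolding h_def by (intro nn_integral_suminf) simp
  also have "\<dots> \<le> (\<Sum>j. ennreal ((1/2) ^ j))"
  proof (rule suminf_le)
    fix j :: nat
    have "(\<integral>\<^sup>+x. ennreal (2 ^ j * (norm (g (Suc j) x - g j x))\<^sup>2) \<partial>M)
        = ennreal (2 ^ j) * (\<integral>\<^sup>+x. ennreal ((norm (g (Suc j) x - g j x))\<^sup>2) \<partial>M)"
      by (simp add: ennreal_mult nn_integral_cmult)
    also have "\<dots> = ennreal (2 ^ j) * ennreal (LINT x|M. (norm (g (Suc j) x - g j x))\<^sup>2)"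
      unfolding g_def nn_diff ..
    also have "\<dots> \<le> ennreal (2 ^ j) * ennreal ((1/4) ^ j)"
      unfolding g_def using N[of j "r (Suc j)" "r j"] rN by (intro mult_left_mono ennreal_leI) (auto simp: less_imp_le)
    also have "\<dots> = ennreal ((1/2) ^ j)"
      by (subst ennreal_mult[symmetric]) (simp_all add: power_mult_distrib[symmetric])
    finally show "(\<integral>\<^sup>+x. ennreal (2 ^ j * (norm (g (Suc j) x - g j x))\<^sup>2) \<partial>M) \<le> ennreal ((1/2) ^ j)" .
  qed auto
  also have "\<dots> = ennreal (\<Sum>j. (1/2) ^ j)" by (rule suminf_ennreal2) (auto intro: summable_geometric)
  also have "\<dots> < \<infinity>" by simp
  finally have "AE x in M. h x \<noteq> \<infinity>"
    by (intro nn_integral_PInf_AE) (auto simp: h_def)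
  then have conv: "AE x in M. convergent (\<lambda>j. g j x)"
  proof (rule AE_mp[OF _ AE_I2], intro impI)
    fix x assume hx: "h x \<noteq> \<infinity>"
    then obtain c where c: "c \<ge> 0" "h x = ennreal c" by (cases "h x") auto
    have le: "norm (g (Suc j) x - g j x) \<le> sqrt c * (sqrt (1/2)) ^ j" for j
    proof -
      define t where "t j = ennreal (2 ^ j * (norm (g (Suc j) x - g j x))\<^sup>2)" for j
      have "sum t {j} \<le> suminf t" by (rule sum_le_suminf) auto
      then have "ennreal (2 ^ j * (norm (g (Suc j) x - g j x))\<^sup>2) \<le> h x"
        unfolding h_def t_def by simp
      then have "2 ^ j * (norm (g (Suc j) x - g j x))\<^sup>2 \<le> c" unfolding c(2) using c(1) by (subst (asm) ennreal_le_iff) auto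
      then have "(norm (g (Suc j) x - g j x))\<^sup>2 \<le> c * (1/2) ^ j"
        by (simp add: field_simps power_divide)
      then have "norm (g (Suc j) x - g j x) \<le> sqrt (c * (1/2) ^ j)"
        by (rule real_le_rsqrt)
      then show ?thesis by (simp only: real_sqrt_mult real_sqrt_power)
    qed
    have "summable (\<lambda>j. g (Suc j) x - g j x)"
      by (rule summable_comparison_test'[where N = 0 and g = "\<lambda>j. sqrt c * (sqrt (1/2)) ^ j"])
        (auto intro!: le summable_mult summable_geometric)
    then obtain l where "(\<lambda>j. g j x - g 0 x) \<longlonglongrightarrow> l"
      unfolding summable_iff_convergent sum_lessThan_telescope[where f = "\<lambda>j. g j x"] convergent_def by blast
    from tendsto_add[OF this tendsto_const[of "g 0 x"]] show "convergent (\<lambda>j. g j x)"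
      unfolding convergent_def by auto
  qed
  define g' where "g' x = lim (\<lambda>j. g j x)" for x
  have [measurable]: "g' \<in> borel_measurable M" unfolding g'_def by (rule borel_measurable_lim_metric) simp
  have fatou: "(\<integral>\<^sup>+x. ennreal ((norm (f k x - g' x))\<^sup>2) \<partial>M) \<le> ennreal ((1/4) ^ i)" if k: "k \<ge> N i" for k i
  proof -
    have "(\<integral>\<^sup>+x. ennreal ((norm (f k x - g' x))\<^sup>2) \<partial>M)
        = (\<integral>\<^sup>+x. liminf (\<lambda>j. ennreal ((norm (f k x - g j x))\<^sup>2)) \<partial>M)"
    proof (rule nn_integral_cong_AE, rule AE_mp[OF conv AE_I2], intro impI)
      fix x assume "convergent (\<lambda>j. g j x)"
      then have "(\<lambda>j. g j x) \<longlonglongrightarrow> g' x" unfolding g'_def convergent_LIMSEQ_iff .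
      then have "(\<lambda>j. ennreal ((norm (f k x - g j x))\<^sup>2)) \<longlonglongrightarrow> ennreal ((norm (f k x - g' x))\<^sup>2)"
        by (intro tendsto_intros)
      then show "ennreal ((norm (f k x - g' x))\<^sup>2) = liminf (\<lambda>j. ennreal ((norm (f k x - g j x))\<^sup>2))"
        by (intro lim_imp_Liminf[symmetric]) auto
    qed
    also have "\<dots> \<le> liminf (\<lambda>j. \<integral>\<^sup>+x. ennreal ((norm (f k x - g j x))\<^sup>2) \<partial>M)"
      by (rule nn_integral_liminf) simp
    also have "\<dots> \<le> ennreal ((1/4) ^ i)"
    proof (rule Liminf_le)
      show "\<forall>\<^sub>F j in sequentially. (\<integral>\<^sup>+x. ennreal ((norm (f k x - g j x))\<^sup>2) \<partial>M) \<le> ennreal ((1/4) ^ i)"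
        unfolding eventually_sequentially g_def nn_diff
        using N[OF k rN] less_imp_le by (intro exI[of _ i] allI impI ennreal_leI) blast
    qed simp
    finally show ?thesis .
  qed
  have int_diff: "integrable M (\<lambda>x. (norm (f k x - g' x))\<^sup>2)" if "k \<ge> N i" for k i
    using fatou[OF that] by (intro integrableI_bounded) (auto simp: le_less_trans)
  have "integrable M (\<lambda>x. (norm (f (N 0) x + (-1) *\<^sub>R (f (N 0) x - g' x)))\<^sup>2)"
    by (rule L2_lin_integrable[OF _ _ f_int int_diff[OF order_refl]]) auto
  then have g'_int: "integrable M (\<lambda>x. (norm (g' x))\<^sup>2)"
    by (simp add: algebra_simps)
  have le: "(LINT x|M. (norm (f k x - g' x))\<^sup>2) \<le> (1/4) ^ i" if "k \<ge> N i" for k i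
  proof -
    have "ennreal (LINT x|M. (norm (f k x - g' x))\<^sup>2) \<le> ennreal ((1/4) ^ i)"
      using fatou[OF that] nn_integral_eq_integral[OF int_diff[OF that]] by simp
    then show ?thesis by (rule ennreal_le_iff[THEN iffD1, rotated]) simp
  qed
  have "(\<lambda>k. LINT x|M. (norm (f k x - g' x))\<^sup>2) \<longlonglongrightarrow> 0"
  proof (rule LIMSEQ_I)
    fix d :: real assume "d > 0"
    then obtain i where i: "(1/4 :: real) ^ i < d" using real_arch_pow_inv[of d "1/4"] by auto
    have "norm ((LINT x|M. (norm (f k x - g' x))\<^sup>2) - 0) < d" if "k \<ge> N i" for k
      using le[OF that] i by simp
    then show "\<exists>no. \<forall>k\<ge>no. norm ((LINT x|M. (norm (f k x - g' x))\<^sup>2) - 0) < d"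
      by (intro exI[of _ "N i"] allI impI)
  qed
  then show ?thesis using g'_int \<open>g' \<in> borel_measurable M\<close> by blast
qed

lemma L2_Cauchy_Schwarz:
  fixes f g :: "'a \<Rightarrow> 'b::euclidean_space"
  assumes m[measurable]: "f \<in> borel_measurable M" "g \<in> borel_measurable M"
    and i: "integrable M (\<lambda>x. (norm (f x))\<^sup>2)" "integrable M (\<lambda>x. (norm (g x))\<^sup>2)"
  shows "(LINT x|M. f x \<bullet> g x)\<^sup>2 \<le> (LINT x|M. (norm (f x))\<^sup>2) * (LINT x|M. (norm (g x))\<^sup>2)"
proof -
  define A B C where "A = (LINT x|M. (norm (f x))\<^sup>2)" and "B = (LINT x|M. f x \<bullet> g x)"
    and "C = (LINT x|M. (norm (g x))\<^sup>2)"
  have poly: "0 \<le> A + 2 * c * B + c\<^sup>2 * C" for c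
  proof -
    have "0 \<le> (LINT x|M. (norm (f x + c *\<^sub>R g x))\<^sup>2)" by simp
    also have "\<dots> = (LINT x|M. (norm (f x))\<^sup>2 + 2 * c * (f x \<bullet> g x) + c\<^sup>2 * (norm (g x))\<^sup>2)"
      unfolding power2_norm_eq_inner by (simp add: algebra_simps inner_commute power2_eq_square)
    also have "\<dots> = A + 2 * c * B + c\<^sup>2 * C"
      unfolding A_def B_def C_def using i L2_inner_integrable[OF m i] by simp
    finally show ?thesis .
  qed
  have "C \<ge> 0" unfolding C_def by simp
  from discriminant_nonneg_quadratic[OF poly this] show ?thesis unfolding A_def B_def C_def .
qed

text \<open>The limit theorem by which weak derivatives and energies pass to \<open>L\<^sup>2\<close>-limits.\<close>

lemma L2_inner_tendsto:
  fixes f :: "nat \<Rightarrow> 'a \<Rightarrow> 'b::euclidean_space"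
  assumes m[measurable]: "\<And>k. f k \<in> borel_measurable M" "g \<in> borel_measurable M" "h \<in> borel_measurable M"
    and i: "\<And>k. integrable M (\<lambda>x. (norm (f k x))\<^sup>2)" "integrable M (\<lambda>x. (norm (g x))\<^sup>2)"
           "integrable M (\<lambda>x. (norm (h x))\<^sup>2)"
    and lim: "(\<lambda>k. LINT x|M. (norm (f k x - g x))\<^sup>2) \<longlonglongrightarrow> 0"
  shows "(\<lambda>k. LINT x|M. f k x \<bullet> h x) \<longlonglongrightarrow> (LINT x|M. g x \<bullet> h x)"
proof -
  have "(\<lambda>k. (LINT x|M. f k x \<bullet> h x) - (LINT x|M. g x \<bullet> h x)) \<longlonglongrightarrow> 0"
  proof (rule Lim_null_comparison)
    have *: "norm ((LINT x|M. f k x \<bullet> h x) - (LINT x|M. g x \<bullet> h x))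
        \<le> sqrt ((LINT x|M. (norm (f k x - g x))\<^sup>2) * (LINT x|M. (norm (h x))\<^sup>2))" for k
    proof -
      have "(LINT x|M. f k x \<bullet> h x) - (LINT x|M. g x \<bullet> h x) = (LINT x|M. (f k x - g x) \<bullet> h x)"
        by (simp add: inner_diff_left L2_inner_integrable m i)
      moreover have "integrable M (\<lambda>x. (norm (f k x - g x))\<^sup>2)"
        using L2_lin_integrable[OF m(1,2) i(1,2), where c = "-1"] by simp
      ultimately have "((LINT x|M. f k x \<bullet> h x) - (LINT x|M. g x \<bullet> h x))\<^sup>2 
         \<le> (LINT x|M. (norm (f k x - g x))\<^sup>2) * (LINT x|M. (norm (h x))\<^sup>2)"
        using L2_Cauchy_Schwarz[of "\<lambda>x. f k x - g x" M h] m i by simp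
      then show ?thesis unfolding real_norm_def by (intro real_le_rsqrt) (simp only: power2_abs)
    qed
    then show "\<forall>\<^sub>F k in sequentially. norm ((LINT x|M. f k x \<bullet> h x) - (LINT x|M. g x \<bullet> h x))
        \<le> sqrt ((LINT x|M. (norm (f k x - g x))\<^sup>2) * (LINT x|M. (norm (h x))\<^sup>2))"
      by (intro always_eventually allI)
    have "(\<lambda>k. sqrt ((LINT x|M. (norm (f k x - g x))\<^sup>2) * (LINT x|M. (norm (h x))\<^sup>2))) \<longlonglongrightarrow> sqrt (0 * (LINT x|M. (norm (h x))\<^sup>2))"
      by (intro tendsto_real_sqrt tendsto_mult lim tendsto_const)
    then show "(\<lambda>k. sqrt ((LINT x|M. (norm (f k x - g x))\<^sup>2) * (LINT x|M. (norm (h x))\<^sup>2))) \<longlonglongrightarrow> 0"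
      by (simp only: mult_zero_left real_sqrt_zero)
  qed
  then show ?thesis by (rule LIM_zero_cancel)
qed

section \<open>Smooth functions\<close>

lemma frechet_derivative_eqI: "(f has_derivative f') (at x) \<Longrightarrow> frechet_derivative f (at x) = f'"
  using frechet_derivative_at by metis

lemma times_differentiable_SucI:
  assumes "\<And>x. (f has_derivative f' x) (at x)" "\<And>b. b \<in> Basis \<Longrightarrow> times_differentiable k (\<lambda>x. f' x b)"
  shows "times_differentiable (Suc k) f"
  using assms frechet_derivative_eqI[OF assms(1)] by (auto simp: differentiable_def)

lemma times_differentiable_SucD:
  assumes "times_differentiable (Suc k) f"
  shows "(f has_derivative frechet_derivative f (at x)) (at x)"
    and "b \<in> Basis \<Longrightarrow> times_differentiable k (\<lambda>x. frechet_derivative f (at x) b)"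
  using assms frechet_derivative_works by auto

lemma times_differentiable_Suc_imp: "times_differentiable (Suc k) f \<Longrightarrow> times_differentiable k f"
proof (induction k arbitrary: f)
  case 0
  then show ?case by (auto intro!: differentiable_imp_continuous_on simp: differentiable_on_def)
next
  case (Suc k)
  show ?case
  proof (rule times_differentiable_SucI)
    show "(f has_derivative frechet_derivative f (at x)) (at x)" for x
      by (rule times_differentiable_SucD(1)[OF Suc.prems])
    show "times_differentiable k (\<lambda>x. frechet_derivative f (at x) b)" if "b \<in> Basis" for b
      by (rule Suc.IH) (rule times_differentiable_SucD(2)[OF Suc.prems that])
  qed
qed

lemma times_differentiable_const: "times_differentiable k (\<lambda>_. c)"
proof (induction k arbitrary: c)
  case (Suc k)
  show ?case by (rule times_differentiable_SucI[where f' = "\<lambda>_ _. 0"]) (auto intro: Suc)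
qed simp

lemma times_differentiable_lin:
  "times_differentiable k f \<Longrightarrow> times_differentiable k g \<Longrightarrow> times_differentiable k (\<lambda>x. f x + c * g x)"
proof (induction k arbitrary: f g)
  case 0
  then show ?case by (auto intro!: continuous_intros)
next
  case (Suc k)
  show ?case
  proof (rule times_differentiable_SucI)
    show "((\<lambda>x. f x + c * g x) has_derivative
        (\<lambda>v. frechet_derivative f (at x) v + c * frechet_derivative g (at x) v)) (at x)" for x
      by (intro derivative_intros has_derivative_mult_right times_differentiable_SucD(1)[OF Suc.prems(1)]
          times_differentiable_SucD(1)[OF Suc.prems(2)])
    show "times_differentiable k (\<lambda>x. frechet_derivative f (at x) b + c * frechet_derivative g (at x) b)"
      if "b \<in> Basis" for b
      by (intro Suc.IH times_differentiable_SucD(2)[OF Suc.prems(1) that] times_differentiable_SucD(2)[OF Suc.prems(2) that])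
  qed
qed

lemma times_differentiable_mult:
  "times_differentiable k f \<Longrightarrow> times_differentiable k g \<Longrightarrow> times_differentiable k (\<lambda>x. f x * g x)"
proof (induction k arbitrary: f g)
  case 0
  then show ?case by (auto intro!: continuous_intros)
next
  case (Suc k)
  show ?case
  proof (rule times_differentiable_SucI)
    show "((\<lambda>x. f x * g x) has_derivative
        (\<lambda>v. f x * frechet_derivative g (at x) v + 1 * (frechet_derivative f (at x) v * g x))) (at x)" for x
      using has_derivative_mult[OF times_differentiable_SucD(1)[OF Suc.prems(1)]
          times_differentiable_SucD(1)[OF Suc.prems(2)], of x] by simp
    show "times_differentiable k (\<lambda>x. f x * frechet_derivative g (at x) b + 1 * (frechet_derivative f (at x) b * g x))"
      if "b \<in> Basis" for b
      by (intro times_differentiable_lin Suc.IH times_differentiable_Suc_imp[OF Suc.prems(1)]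
        times_differentiable_Suc_imp[OF Suc.prems(2)]
        times_differentiable_SucD(2)[OF Suc.prems(1) that] times_differentiable_SucD(2)[OF Suc.prems(2) that])
  qed
qed

lemma smooth_const: "smooth (\<lambda>_. c)"
  unfolding smooth_def using times_differentiable_const by blast

lemma smooth_lin: "smooth f \<Longrightarrow> smooth g \<Longrightarrow> smooth (\<lambda>x. f x + c * g x)"
  unfolding smooth_def using times_differentiable_lin by blast

lemma smooth_mult: "smooth f \<Longrightarrow> smooth g \<Longrightarrow> smooth (\<lambda>x. f x * g x)"
  unfolding smooth_def using times_differentiable_mult by blast

lemma smooth_prod: "finite I \<Longrightarrow> (\<And>i. i \<in> I \<Longrightarrow> smooth (f i)) \<Longrightarrow> smooth (\<lambda>x. \<Prod>i\<in>I. f i x)"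
  by (induction I rule: finite_induct) (auto simp: smooth_const smooth_mult)

lemma smooth_has_derivative: "smooth f \<Longrightarrow> (f has_derivative frechet_derivative f (at x)) (at x)"
  unfolding smooth_def using times_differentiable_SucD(1)[of 0 f] by blast

lemma smooth_continuous: "smooth f \<Longrightarrow> continuous_on UNIV f"
  unfolding smooth_def using times_differentiable.simps(1) by blast

lemma smooth_derivative_continuous:
  "smooth f \<Longrightarrow> b \<in> Basis \<Longrightarrow> continuous_on UNIV (\<lambda>x. frechet_derivative f (at x) b)"
  unfolding smooth_def using times_differentiable_SucD(2)[of 0 f b] times_differentiable.simps(1) by blast

text \<open>
  The derivatives of the flat function \<open>exp (- 1 / t)\<close> are combinations of the functions
  \<open>exp (- 1 / t) / t\<^sup>n\<close>, all of which extend continuously by zero.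
\<close>

definition flat :: "nat \<Rightarrow> real \<Rightarrow> real" where
  "flat n t = (if t > 0 then exp (- (1 / t)) / t ^ n else 0)"

lemma flat_tendsto_0: "(flat n \<longlongrightarrow> 0) (at 0)"
proof -
  have "((\<lambda>t::real. (inverse t) ^ n / exp (inverse t)) \<longlongrightarrow> 0) (at_right 0)"
    by (rule filterlim_compose[OF tendsto_power_div_exp_0 filterlim_inverse_at_top_right])
  moreover have "\<forall>\<^sub>F t in at_right 0. (inverse t) ^ n / exp (inverse t) = flat n t"
    unfolding eventually_at_filter
    by (intro always_eventually) (auto simp: flat_def exp_minus divide_inverse power_inverse mult.commute)
  ultimately have "(flat n \<longlongrightarrow> 0) (at_right 0)" by (rule Lim_transform_eventually)
  moreover have "(flat n \<longlongrightarrow> 0) (at_left 0)"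
  proof (rule Lim_transform_eventually[OF tendsto_const])
    show "\<forall>\<^sub>F t in at_left 0. 0 = flat n t"
      unfolding eventually_at_filter by (intro always_eventually) (auto simp: flat_def)
  qed
  ultimately show ?thesis by (simp add: filterlim_split_at)
qed

lemma DERIV_flat: "(flat n has_real_derivative (flat (n + 2) t - real n * flat (n + 1) t)) (at t)"
proof (cases t "0::real" rule: linorder_cases)
  case less
  have "((\<lambda>_. 0) has_real_derivative 0) (at t)" by simp
  then have "(flat n has_real_derivative 0) (at t)"
    by (rule has_field_derivative_transform_within_open[where S = "{..<0}"]) (use less in \<open>auto simp: flat_def\<close>)
  then show ?thesis using less by (simp add: flat_def)
next
  case greater
  have "((\<lambda>t. exp (- (1 / t)) / t ^ n) has_real_derivative
      (exp (- (1 / t)) * (1 / t\<^sup>2) * t ^ n - exp (- (1 / t)) * (real n * t ^ (n - 1))) / (t ^ n * t ^ n)) (at t)"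
    using greater by (auto intro!: derivative_eq_intros simp: power2_eq_square)
  moreover have "(exp (- (1 / t)) * (1 / t\<^sup>2) * t ^ n - exp (- (1 / t)) * (real n * t ^ (n - 1))) / (t ^ n * t ^ n)
      = exp (- (1 / t)) / t ^ (n + 2) - real n * (exp (- (1 / t)) / t ^ (n + 1))"
    using greater by (cases n) (simp_all add: field_simps power2_eq_square)
  ultimately have "((\<lambda>t. exp (- (1 / t)) / t ^ n) has_real_derivative (flat (n + 2) t - real n * flat (n + 1) t)) (at t)"
    using greater by (simp add: flat_def)
  then show ?thesis
    by (rule has_field_derivative_transform_within_open[where S = "{0<..}"]) (use greater in \<open>auto simp: flat_def\<close>)
next
  case equal
  have "((\<lambda>h. (flat n (0 + h) - flat n 0) / h) \<longlongrightarrow> 0) (at 0)"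
  proof (rule Lim_transform_eventually[OF flat_tendsto_0[of "Suc n"]])
    show "\<forall>\<^sub>F h in at 0. flat (Suc n) h = (flat n (0 + h) - flat n 0) / h"
      unfolding eventually_at_filter by (intro always_eventually) (auto simp: flat_def)
  qed
  then show ?thesis unfolding equal by (simp add: DERIV_def flat_def)
qed

lemma flat_has_derivative_affine:
  "((\<lambda>x. flat n (x \<bullet> w + \<beta>)) has_derivative
     (\<lambda>v. (flat (n + 2) (x \<bullet> w + \<beta>) - real n * flat (n + 1) (x \<bullet> w + \<beta>)) * (v \<bullet> w))) (at x)"
proof -
  have "((\<lambda>x. x \<bullet> w + \<beta>) has_derivative (\<lambda>v. v \<bullet> w)) (at x)"
    by (auto intro!: derivative_eq_intros)
  from has_derivative_compose[OF this DERIV_flat[unfolded has_field_derivative_def]] show ?thesis by simp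
qed

lemma smooth_flat_affine: "smooth (\<lambda>x. flat n (x \<bullet> w + \<beta>))"
proof -
  have "times_differentiable k (\<lambda>x. flat n (x \<bullet> w + \<beta>))" for k
  proof (induction k arbitrary: n)
    case 0
    have "continuous (at x) (\<lambda>x. flat n (x \<bullet> w + \<beta>))" for x
      using has_derivative_continuous[OF flat_has_derivative_affine] .
    then show ?case by (simp add: continuous_at_imp_continuous_on)
  next
    case (Suc k)
    show ?case
    proof (rule times_differentiable_SucI[OF flat_has_derivative_affine])
      fix b
      have "times_differentiable k (\<lambda>x. (flat (n + 2) (x \<bullet> w + \<beta>) + (- real n) * flat (n + 1) (x \<bullet> w + \<beta>)) * (b \<bullet> w))"
        by (intro times_differentiable_mult times_differentiable_lin Suc times_differentiable_const)
      then show "times_differentiable k (\<lambda>x. (flat (n + 2) (x \<bullet> w + \<beta>) - real n * flat (n + 1) (x \<bullet> w + \<beta>)) * (b \<bullet> w))"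
        by simp
    qed
  qed
  then show ?thesis unfolding smooth_def by blast
qed

text \<open>
  Since \<open>flat 0 (m t) = (flat 0 t)\<^sup>1\<^sup>/\<^sup>m\<close> for positive \<open>t\<close>, these products are the \<open>m\<close>-th roots of a
  single smooth bump. They are positive exactly inside the box and converge to its indicator
  function as \<open>m\<close> grows.
\<close>

definition bump :: "'a::euclidean_space \<Rightarrow> 'a \<Rightarrow> real \<Rightarrow> 'a \<Rightarrow> real" where
  "bump c d m x = (\<Prod>b\<in>Basis. flat 0 (m * (x \<bullet> b - c \<bullet> b)) * flat 0 (m * (d \<bullet> b - x \<bullet> b)))"

lemma smooth_bump: "smooth (bump c d m)"
proof -
  have *: "bump c d m = (\<lambda>x. \<Prod>b\<in>Basis. flat 0 (x \<bullet> (m *\<^sub>R b) + - m * (c \<bullet> b)) * flat 0 (x \<bullet> (- m *\<^sub>R b) + m * (d \<bullet> b)))"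
    by (auto simp: bump_def fun_eq_iff algebra_simps intro!: prod.cong)
  show ?thesis unfolding * by (intro smooth_prod smooth_mult smooth_flat_affine) auto
qed

lemma flat_0_bounds: "0 \<le> flat 0 t" "flat 0 t \<le> 1"
  by (auto simp: flat_def)

lemma bump_nonneg: "0 \<le> bump c d m x"
  unfolding bump_def by (intro prod_nonneg) (auto simp: flat_0_bounds)

lemma bump_le_1: "bump c d m x \<le> 1"
  unfolding bump_def by (intro prod_le_1) (auto simp: flat_0_bounds intro!: mult_le_one)

lemma bump_outside: "m > 0 \<Longrightarrow> x \<notin> box c d \<Longrightarrow> bump c d m x = 0"
proof -
  assume "m > 0" "x \<notin> box c d"
  then obtain b where "b \<in> Basis" "m * (x \<bullet> b - c \<bullet> b) \<le> 0 \<or> m * (d \<bullet> b - x \<bullet> b) \<le> 0"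
    by (auto simp: box_def not_less mult_le_0_iff)
  then show "bump c d m x = 0"
    unfolding bump_def by (intro prod_zero bexI[of _ b]) (auto simp: flat_def)
qed

lemma bump_tendsto: "(\<lambda>k. bump c d (real (Suc k)) x) \<longlonglongrightarrow> indicator (box c d) x"
proof (cases "x \<in> box c d")
  case True
  have flat1: "(\<lambda>k. flat 0 (real (Suc k) * s)) \<longlonglongrightarrow> 1" if "s > 0" for s :: real
  proof -
    have "(\<lambda>k. exp (- (inverse (real (Suc k)) * (1 / s)))) \<longlonglongrightarrow> exp (- (0 * (1 / s)))"
      by (intro tendsto_intros LIMSEQ_inverse_real_of_nat)
    moreover have "flat 0 (real (Suc k) * s) = exp (- (inverse (real (Suc k)) * (1 / s)))" for k
    proof -
      have "real (Suc k) * s > 0" using that by simp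
      then show ?thesis unfolding flat_def by (simp add: divide_inverse)
    qed
    ultimately show ?thesis by simp
  qed
  have "(\<lambda>k. bump c d (real (Suc k)) x) \<longlonglongrightarrow> (\<Prod>b\<in>(Basis::'a set). 1 * 1)"
    unfolding bump_def using True by (intro tendsto_prod tendsto_mult flat1) (auto simp: box_def)
  then show ?thesis using True by simp
next
  case False
  then show ?thesis by (simp add: bump_outside)
qed

lemma test_function_bump:
  assumes "m > 0" "cbox c d \<subseteq> U"
  shows "test_function U (bump c d m)"
proof -
  have "{x. bump c d m x \<noteq> 0} \<subseteq> cbox c d"
    using bump_outside[OF assms(1)] box_subset_cbox by blast
  then have sub: "closure {x. bump c d m x \<noteq> 0} \<subseteq> cbox c d" by (intro closure_minimal) auto
  then have "compact (closure {x. bump c d m x \<noteq> 0})"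
    by (meson bounded_cbox bounded_subset closed_closure compact_eq_bounded_closed)
  then show ?thesis unfolding test_function_def using smooth_bump sub assms(2) by blast
qed

section \<open>The fundamental lemma of the calculus of variations\<close>

text \<open>
  The boxes are an intersection-stable generator of the Borel sets, so the integral vanishes over
  every Borel set.
\<close>

lemma lborel_AE_zero_if_box_integrals_zero:
  fixes f :: "'a::euclidean_space \<Rightarrow> real"
  assumes f: "integrable lborel f"
    and box0: "\<And>l u. (LINT x:box l u|lborel. f x) = 0"
  shows "AE x in lborel. f x = 0"
proof -
  have si: "set_integrable lborel A f" if "A \<in> sets borel" for A
    unfolding set_integrable_def using that f by (intro integrable_mult_indicator) auto
  have UNIV0: "(LINT x:UNIV|lborel. f x) = 0"
  proof -
    let ?B = "\<lambda>i::nat. box (- (real i *\<^sub>R One)) (real i *\<^sub>R One) :: 'a set"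
    have inc: "incseq ?B"
      by (intro incseq_SucI subset_box_imp) (auto simp: inner_simps)
    have U: "(\<Union>i. ?B i) = UNIV" by (rule UN_box_eq_UNIV)
    have "(\<lambda>i. LINT x:?B i|lborel. f x) \<longlonglongrightarrow> (LINT x:(\<Union>i. ?B i)|lborel. f x)"
      by (rule set_integral_cont_up) (use inc si in \<open>auto simp: U\<close>)
    then show ?thesis unfolding box0 U using LIMSEQ_const_iff by metis
  qed
  have "(LINT x:A|lborel. f x) = 0" if "A \<in> sets lborel" for A
  proof -
    let ?E = "range (\<lambda>(a, b). box a b :: 'a set)"
    have A: "A \<in> sigma_sets UNIV ?E" using that by (simp add: borel_eq_box)
    have sub: "sigma_sets UNIV ?E \<subseteq> sets borel" by (simp add: borel_eq_box)
    show ?thesis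
    proof (rule sigma_sets_induct_disjoint[OF _ _ A, where P = "\<lambda>A. (LINT x:A|lborel. f x) = 0"])
      show "Int_stable ?E" by (auto simp: Int_stable_def box_Int_box)
      show "?E \<subseteq> Pow UNIV" by simp
      show "(LINT x:A|lborel. f x) = 0" if "A \<in> ?E" for A using that box0 by auto
      show "(LINT x:{}|lborel. f x) = 0" by (simp add: set_lebesgue_integral_def)
      show "(LINT x:UNIV - A|lborel. f x) = 0" if "A \<in> sigma_sets UNIV ?E" "(LINT x:A|lborel. f x) = 0" for A
      proof -
        have "A \<in> sets borel" using that sub by blast
        then have "(LINT x:A \<union> (UNIV - A)|lborel. f x) = (LINT x:A|lborel. f x) + (LINT x:UNIV - A|lborel. f x)"
          by (intro set_integral_Un si) auto
        then show ?thesis using that UNIV0 by simp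
      qed
      show "(LINT x:(\<Union>i. A i)|lborel. f x) = 0"
        if "disjoint_family A" "range A \<subseteq> sigma_sets UNIV ?E" "\<And>i. (LINT x:A i|lborel. f x) = 0" for A :: "nat \<Rightarrow> 'a set"
      proof -
        have AB: "A i \<in> sets borel" for i using that(2) sub by blast
        have "(LINT x:(\<Union>i. A i)|lborel. f x) = (\<Sum>i. LINT x:A i|lborel. f x)"
          by (rule lebesgue_integral_countable_add)
            (use AB that(1) si in \<open>auto simp: disjoint_family_on_def\<close>)
        then show ?thesis using that(3) by simp
      qed
    qed
  qed
  then have "AE x in lborel. f x = (\<lambda>_. 0) x"
    by (intro density_unique_real f) (auto simp: set_lebesgue_integral_def)
  then show ?thesis by simp
qed

lemma lebesgue_AE_zero_if_box_integrals_zero: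
  fixes f :: "'a::euclidean_space \<Rightarrow> real"
  assumes f: "integrable lebesgue f"
    and box0: "\<And>l u. (LINT x|lebesgue. indicator (box l u) x * f x) = 0"
  shows "AE x in lebesgue. f x = 0"
proof -
  obtain g where g[measurable]: "g \<in> borel_measurable lborel" and fg: "AE x in lborel. f x = g x"
    using completion_ex_borel_measurable_real[OF borel_measurable_integrable[OF f]] by blast
  have fg': "AE x in lebesgue. f x = g x" by (rule AE_completion[OF fg])
  have gm: "g \<in> borel_measurable lebesgue" by (rule measurable_completion[OF g])
  have "integrable lebesgue g"
    using integrable_cong_AE_imp[OF f gm] fg' by (simp add: eq_commute)
  then have "integrable lborel g" using integrable_completion[OF g] by simp
  moreover have "(LINT x:box l u|lborel. g x) = 0" for l u
  proof -
    have "(LINT x:box l u|lborel. g x) = (LINT x|lebesgue. indicator (box l u) x * g x)"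
      unfolding set_lebesgue_integral_def by (subst integral_completion) auto
    also have "\<dots> = (LINT x|lebesgue. indicator (box l u) x * f x)"
    proof (rule integral_cong_AE)
      show "(\<lambda>x. indicator (box l u) x * g x) \<in> borel_measurable lebesgue"
        using gm by (intro borel_measurable_times borel_measurable_indicator) auto
      show "(\<lambda>x. indicator (box l u) x * f x) \<in> borel_measurable lebesgue"
        using borel_measurable_integrable[OF f] by (intro borel_measurable_times borel_measurable_indicator) auto
    qed (use fg' in auto)
    finally show ?thesis using box0 by simp
  qed
  ultimately have "AE x in lborel. g x = 0" by (rule lborel_AE_zero_if_box_integrals_zero)
  from AE_completion[OF this] fg' show ?thesis by auto
qed

text \<open>
  Testing with bumps and letting them tend to indicator functions, the integral of \<open>f\<close> vanishes over
  every box whose closure lies in \<open>U\<close>; countably many such boxes exhaust \<open>U\<close>.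
\<close>

lemma fundamental_lemma:
  fixes f :: "'a::euclidean_space \<Rightarrow> real"
  assumes U: "open U" and f: "integrable (lebesgue_on U) f"
    and test: "\<And>\<phi>. test_function U \<phi> \<Longrightarrow> (LINT x|lebesgue_on U. f x * \<phi> x) = 0"
  shows "AE x in lebesgue_on U. f x = 0"
proof -
  have Us: "U \<inter> space lebesgue \<in> sets lebesgue" using U by auto
  have fU: "integrable lebesgue (\<lambda>x. indicator U x * f x)"
    using f integrable_restrict_space[OF Us, of f] by simp
  note fUm = borel_measurable_integrable[OF fU]
  have box0: "(LINT x|lebesgue. indicator (box c d) x * (indicator U x * f x)) = 0" if cd: "cbox c d \<subseteq> U" for c d
  proof -
    have "(\<lambda>k. LINT x|lebesgue. bump c d (real (Suc k)) x * (indicator U x * f x)) \<longlonglongrightarrow>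
        (LINT x|lebesgue. indicator (box c d) x * (indicator U x * f x))"
    proof (rule integral_dominated_convergence[where w = "\<lambda>x. norm (indicator U x * f x)"])
      show "integrable lebesgue (\<lambda>x. norm (indicator U x * f x))" using fU by (rule integrable_norm)
      show "AE x in lebesgue. (\<lambda>k. bump c d (real (Suc k)) x * (indicator U x * f x)) \<longlonglongrightarrow>
          indicator (box c d) x * (indicator U x * f x)"
        by (intro AE_I2 tendsto_mult bump_tendsto tendsto_const)
      show "AE x in lebesgue. norm (bump c d (real (Suc k)) x * (indicator U x * f x)) \<le> norm (indicator U x * f x)" for k
      proof (intro AE_I2)
        fix x
        have "\<bar>bump c d (real (Suc k)) x\<bar> \<le> 1" using bump_nonneg[of c d _ x] bump_le_1[of c d _ x] by (simp only: abs_of_nonneg)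
        then show "norm (bump c d (real (Suc k)) x * (indicator U x * f x)) \<le> norm (indicator U x * f x)"
          unfolding norm_mult by (intro mult_left_le_one_le) auto
      qed
      have "bump c d m \<in> borel_measurable lebesgue" for m
        using borel_measurable_continuous_onI[OF smooth_continuous[OF smooth_bump]]
        by (intro measurable_completion) simp
      then show "(\<lambda>x. bump c d (real (Suc k)) x * (indicator U x * f x)) \<in> borel_measurable lebesgue" for k
        by (intro borel_measurable_times[OF _ fUm])
      show "(\<lambda>x. indicator (box c d) x * (indicator U x * f x)) \<in> borel_measurable lebesgue"
        by (intro borel_measurable_times[OF _ fUm] borel_measurable_indicator) auto
    qed
    moreover have "(LINT x|lebesgue. bump c d (real (Suc k)) x * (indicator U x * f x)) = 0" for k
      using test[OF test_function_bump[OF _ cd, of "real (Suc k)"]] integral_restrict_space[OF Us, of "\<lambda>x. f x * bump c d (real (Suc k)) x"]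
      by (simp add: mult_ac)
    ultimately show ?thesis using LIMSEQ_const_iff[of 0] by (simp add: LIMSEQ_const_iff)
  qed
  have AE_box: "AE x in lebesgue. x \<in> cbox c d \<longrightarrow> f x = 0" if cd: "cbox c d \<subseteq> U" for c d
  proof -
    have "AE x in lebesgue. indicator (box c d) x * f x = 0"
    proof (rule lebesgue_AE_zero_if_box_integrals_zero)
      have "integrable lebesgue (\<lambda>x. indicator (box c d) x *\<^sub>R (indicator U x * f x))"
        by (intro integrable_mult_indicator fU) auto
      moreover have eq: "indicator (box c d) x *\<^sub>R (indicator U x * f x) = indicator (box c d) x * f x" for x
        using cd box_subset_cbox[of c d] by (auto simp: indicator_def)
      ultimately show "integrable lebesgue (\<lambda>x. indicator (box c d) x * f x)" by (simp only: eq)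
      fix l u :: 'a
      obtain l' u' where lu: "box l u \<inter> box c d = box l' u'" "cbox l u \<inter> cbox c d = cbox l' u'"
        using that[OF box_Int_box Int_interval] .
      have "(LINT x|lebesgue. indicator (box l u) x * (indicator (box c d) x * f x)) =
          (LINT x|lebesgue. indicator (box l' u') x * (indicator U x * f x))"
        unfolding lu(1)[symmetric] using eq[unfolded real_scaleR_def] by (intro Bochner_Integration.integral_cong) (auto simp: indicator_inter_arith)
      also have "\<dots> = 0" using lu(2) cd by (intro box0) auto
      finally show "(LINT x|lebesgue. indicator (box l u) x * (indicator (box c d) x * f x)) = 0" .
    qed
    moreover have "AE x in lebesgue. x \<notin> cbox c d - box c d"
      using negligible_frontier_interval[of c d] by (intro AE_not_in) (simp add: negligible_iff_null_sets)
    ultimately show ?thesis by eventually_elim (auto simp: indicator_def split: if_splits)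
  qed
  obtain \<D> where D: "countable \<D>" "\<D> \<subseteq> Pow U" "\<And>X. X \<in> \<D> \<Longrightarrow> \<exists>a b. X = cbox a b" "\<Union>\<D> = U"
    by (rule open_countable_Union_open_cbox[OF U], rule that)
  have "AE x in lebesgue. \<forall>X\<in>\<D>. x \<in> X \<longrightarrow> f x = 0"
  proof (rule AE_ball_countable'[OF _ D(1)])
    fix X assume X: "X \<in> \<D>"
    then obtain c d where "X = cbox c d" using D(3) by blast
    then show "AE x in lebesgue. x \<in> X \<longrightarrow> f x = 0" using AE_box D(2) X by blast
  qed
  then have "AE x in lebesgue. x \<in> U \<longrightarrow> f x = 0" by eventually_elim (use D(4) in blast)
  then show ?thesis using AE_restrict_space_iff[OF Us] by blast
qed

section \<open>Integration by parts\<close>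

text \<open>
  The difference quotients of a compactly supported function have integral zero by translation
  invariance of the Lebesgue measure, and they converge boundedly to the derivative.
\<close>

lemma integral_derivative_zero:
  fixes F :: "'a::euclidean_space \<Rightarrow> real"
  assumes F: "smooth F" and b: "b \<in> Basis" and supp: "\<And>x. x \<notin> cball 0 R \<Longrightarrow> F x = 0"
  shows "(LINT x|lborel. frechet_derivative F (at x) b) = 0"
proof -
  let ?D = "\<lambda>x. frechet_derivative F (at x) b"
  have Fc: "continuous_on UNIV F" by (rule smooth_continuous[OF F])
  have Dc: "continuous_on UNIV ?D" by (rule smooth_derivative_continuous[OF F b])
  have Fm[measurable]: "F \<in> borel_measurable borel" using Fc by (rule borel_measurable_continuous_onI)
  have Dm[measurable]: "?D \<in> borel_measurable borel" using Dc by (rule borel_measurable_continuous_onI)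
  have D0: "?D x = 0" if "x \<notin> cball 0 R" for x
  proof -
    have "((\<lambda>_. 0) has_derivative (\<lambda>_. 0)) (at x)" by simp
    then have "(F has_derivative (\<lambda>_. 0)) (at x)"
      by (rule has_derivative_transform_within_open[of _ _ _ _ "- cball 0 R"]) (use that supp in auto)
    then show ?thesis using frechet_derivative_eqI by metis
  qed
  have "bounded (?D ` cball 0 R)"
    by (intro compact_imp_bounded compact_continuous_image continuous_on_subset[OF Dc]) auto
  then obtain K0 where "\<forall>y\<in>?D ` cball 0 R. norm y \<le> K0" unfolding bounded_iff by blast
  then have K0: "\<bar>?D x\<bar> \<le> K0" if "x \<in> cball 0 R" for x using that by (metis imageI real_norm_def)
  have K: "\<bar>?D x\<bar> \<le> max K0 0" for x
    using D0[of x] K0[of x] by (cases "x \<in> cball 0 R") (auto simp del: mem_cball)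
  have line: "((\<lambda>s. F (x + s *\<^sub>R b)) has_real_derivative ?D (x + s *\<^sub>R b)) (at s)" for x s
  proof -
    have "((\<lambda>s. x + s *\<^sub>R b) has_derivative (\<lambda>h. h *\<^sub>R b)) (at s)" by (auto intro!: derivative_eq_intros)
    from has_derivative_compose[OF this smooth_has_derivative[OF F]]
    have "((\<lambda>s. F (x + s *\<^sub>R b)) has_derivative (\<lambda>h. frechet_derivative F (at (x + s *\<^sub>R b)) (h *\<^sub>R b))) (at s)" .
    moreover have "frechet_derivative F (at (x + s *\<^sub>R b)) (h *\<^sub>R b) = ?D (x + s *\<^sub>R b) * h" for h
      using linear_cmul[OF has_derivative_linear[OF smooth_has_derivative[OF F]]] by simp
    ultimately show ?thesis unfolding has_field_derivative_def by simp
  qed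
  define h where "h k = inverse (real (Suc k))" for k
  have h: "0 < h k" "h k \<le> 1" for k unfolding h_def by (auto simp: field_simps)
  define G where "G k x = (F (h k *\<^sub>R b + x) - F x) / h k" for k x
  have Gbound: "norm (G k x) \<le> max K0 0 * indicator (cball 0 (R + 1)) x" for k x
  proof (cases "x \<in> cball 0 (R + 1)")
    case True
    obtain z where "F (x + h k *\<^sub>R b) - F (x + 0 *\<^sub>R b) = (h k - 0) * ?D (x + z *\<^sub>R b)"
      using MVT2[of 0 "h k" "\<lambda>s. F (x + s *\<^sub>R b)" "\<lambda>s. ?D (x + s *\<^sub>R b)"] h(1) line by blast
    then have "G k x = ?D (x + z *\<^sub>R b)" unfolding G_def using h(1)[of k] by (simp add: add.commute)
    then show ?thesis using K True by simp
  next
    case False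
    have "norm x \<le> norm (h k *\<^sub>R b + x) + norm (h k *\<^sub>R b)"
      using norm_triangle_ineq4[of "h k *\<^sub>R b + x" "h k *\<^sub>R b"] by simp
    moreover have "norm (h k *\<^sub>R b) \<le> 1" using h[of k] b by simp
    ultimately have "h k *\<^sub>R b + x \<notin> cball 0 R" "x \<notin> cball 0 R" using False by auto
    then show ?thesis unfolding G_def using supp by simp
  qed
  have dom: "integrable lborel (\<lambda>x. max K0 0 * indicator (cball 0 (R + 1)) x :: real)"
    by (intro integrable_mult_right) (auto intro!: integrable_real_indicator emeasure_bounded_finite)
  have "(\<lambda>k. LINT x|lborel. G k x) \<longlonglongrightarrow> (LINT x|lborel. ?D x)"
  proof (rule integral_dominated_convergence[OF _ _ dom])
    show "G k \<in> borel_measurable lborel" for k unfolding G_def by measurable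
    show "AE x in lborel. norm (G k x) \<le> max K0 0 * indicator (cball 0 (R + 1)) x" for k
      using Gbound by (intro AE_I2)
    show "AE x in lborel. (\<lambda>k. G k x) \<longlonglongrightarrow> ?D x"
    proof (intro AE_I2)
      fix x
      have "((\<lambda>t. (F (x + (0 + t) *\<^sub>R b) - F (x + 0 *\<^sub>R b)) / t) \<longlongrightarrow> ?D (x + 0 *\<^sub>R b)) (at 0)"
        using line[of x 0] unfolding DERIV_def .
      moreover have "filterlim h (at 0) sequentially"
        unfolding filterlim_at h_def using LIMSEQ_inverse_real_of_nat by auto
      ultimately have "(\<lambda>k. (F (x + (0 + h k) *\<^sub>R b) - F (x + 0 *\<^sub>R b)) / h k) \<longlonglongrightarrow> ?D (x + 0 *\<^sub>R b)"
        by (rule filterlim_compose)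
      then show "(\<lambda>k. G k x) \<longlonglongrightarrow> ?D x" unfolding G_def by (simp add: add.commute)
    qed
  qed simp
  moreover have "(LINT x|lborel. G k x) = 0" for k
  proof -
    have Fint: "integrable lborel F"
    proof -
      have "integrable lborel (\<lambda>x. indicator (cball 0 R) x *\<^sub>R F x)"
        by (rule borel_integrable_compact) (auto intro: continuous_on_subset[OF Fc])
      moreover have "(\<lambda>x. indicator (cball 0 R) x *\<^sub>R F x) = F" using supp by (auto simp: fun_eq_iff indicator_def)
      ultimately show ?thesis by simp
    qed
    have "integrable (distr lborel borel ((+) (h k *\<^sub>R b))) F" using Fint by (simp add: lborel_distr_plus)
    then have int': "integrable lborel (\<lambda>x. F (h k *\<^sub>R b + x))" by (subst (asm) integrable_distr_eq) auto
    have "(LINT x|lborel. F (h k *\<^sub>R b + x)) = (LINT x|distr lborel borel ((+) (h k *\<^sub>R b)). F x)"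
      by (subst integral_distr) auto
    also have "\<dots> = (LINT x|lborel. F x)" by (simp add: lborel_distr_plus)
    finally show ?thesis unfolding G_def using int' Fint by simp
  qed
  ultimately show ?thesis by (simp add: LIMSEQ_const_iff)
qed

definition classical_gradient :: "('a::euclidean_space \<Rightarrow> real) \<Rightarrow> 'a \<Rightarrow> 'a" where
  "classical_gradient f x = (\<Sum>b\<in>Basis. frechet_derivative f (at x) b *\<^sub>R b)"

lemma classical_gradient_inner_Basis: "b \<in> Basis \<Longrightarrow> classical_gradient f x \<bullet> b = frechet_derivative f (at x) b"
  by (simp add: classical_gradient_def)

lemma continuous_classical_gradient: "smooth f \<Longrightarrow> continuous_on UNIV (classical_gradient f)"
  unfolding classical_gradient_def[abs_def]
  by (intro continuous_intros smooth_derivative_continuous) auto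

lemma test_function_props:
  assumes "test_function U \<psi>"
  shows "smooth \<psi>" "\<And>x. x \<notin> U \<Longrightarrow> \<psi> x = 0" "\<And>x v. x \<notin> U \<Longrightarrow> frechet_derivative \<psi> (at x) v = 0"
    "\<exists>R. \<forall>x. x \<notin> cball 0 R \<longrightarrow> \<psi> x = 0"
    "\<exists>R. \<forall>x. x \<notin> cball 0 R \<longrightarrow> (\<forall>v. frechet_derivative \<psi> (at x) v = 0)"
proof -
  show "smooth \<psi>" using assms unfolding test_function_def by blast
  obtain S where S: "compact S" "S \<subseteq> U" and S0: "\<And>x. x \<notin> S \<Longrightarrow> \<psi> x = 0"
  proof
    show "compact (closure {x. \<psi> x \<noteq> 0})" "closure {x. \<psi> x \<noteq> 0} \<subseteq> U"
      using assms unfolding test_function_def by auto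
    show "\<psi> x = 0" if "x \<notin> closure {x. \<psi> x \<noteq> 0}" for x
      using that closure_subset[of "{x. \<psi> x \<noteq> 0}"] by blast
  qed
  have D0: "frechet_derivative \<psi> (at x) v = 0" if "x \<notin> S" for x v
  proof -
    have "((\<lambda>_. 0) has_derivative (\<lambda>_. 0)) (at x)" by simp
    then have "(\<psi> has_derivative (\<lambda>_. 0)) (at x)"
      by (rule has_derivative_transform_within_open[of _ _ _ _ "- S"])
        (use that S0 compact_imp_closed[OF S(1)] in auto)
    then show ?thesis by (simp add: frechet_derivative_eqI)
  qed
  show "\<psi> x = 0" if "x \<notin> U" for x using that S S0 by blast
  show "frechet_derivative \<psi> (at x) v = 0" if "x \<notin> U" for x v using that S D0 by blast
  obtain R where R: "S \<subseteq> cball 0 R"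
    using compact_imp_bounded[OF S(1)] unfolding bounded_iff by (metis mem_cball_0 subsetI)
  show "\<exists>R. \<forall>x. x \<notin> cball 0 R \<longrightarrow> \<psi> x = 0" using R S0 by (intro exI[of _ R]) blast
  show "\<exists>R. \<forall>x. x \<notin> cball 0 R \<longrightarrow> (\<forall>v. frechet_derivative \<psi> (at x) v = 0)"
    using R D0 by (intro exI[of _ R]) blast
qed

lemma integrable_continuous_compact_support:
  fixes f :: "'a::euclidean_space \<Rightarrow> real"
  assumes c: "continuous_on UNIV f" and s: "\<And>x. x \<notin> cball 0 R \<Longrightarrow> f x = 0"
  shows "integrable lborel f"
proof -
  have "integrable lborel (\<lambda>x. indicator (cball 0 R) x *\<^sub>R f x)"
    by (rule borel_integrable_compact) (auto intro: continuous_on_subset[OF c])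
  moreover have "(\<lambda>x. indicator (cball 0 R) x *\<^sub>R f x) = f" using s by (auto simp: fun_eq_iff indicator_def)
  ultimately show ?thesis by simp
qed

text \<open>
  Apply \<open>integral_derivative_zero\<close> to the product of \<open>f\<close> with a test function, which has compact
  support inside \<open>U\<close>, so that there is no boundary term.
\<close>

lemma weak_gradient_smooth:
  fixes f :: "'a::euclidean_space \<Rightarrow> real"
  assumes U: "open U" and f: "smooth f"
  shows "weak_gradient U f (classical_gradient f)"
  unfolding weak_gradient_def
proof (intro allI impI)
  fix \<psi> :: "'a \<Rightarrow> real" and b :: 'a assume \<psi>: "test_function U \<psi>" and b: "b \<in> Basis"
  note tf = test_function_props[OF \<psi>]
  have Us: "U \<inter> space lebesgue \<in> sets lebesgue" using U by auto
  obtain R where R: "\<And>x. x \<notin> cball 0 R \<Longrightarrow> \<psi> x = 0" using tf(4) by blast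
  obtain R' where R': "\<And>x v. x \<notin> cball 0 R' \<Longrightarrow> frechet_derivative \<psi> (at x) v = 0" using tf(5) by blast
  have c1: "continuous_on UNIV (\<lambda>x. f x * frechet_derivative \<psi> (at x) b)"
    by (intro continuous_intros smooth_continuous f smooth_derivative_continuous tf(1) b)
  have c2: "continuous_on UNIV (\<lambda>x. frechet_derivative f (at x) b * \<psi> x)"
    by (intro continuous_intros smooth_continuous f smooth_derivative_continuous tf(1) b)
  have i1: "integrable lborel (\<lambda>x. f x * frechet_derivative \<psi> (at x) b)"
    by (rule integrable_continuous_compact_support[OF c1, of R']) (simp add: R')
  have i2: "integrable lborel (\<lambda>x. frechet_derivative f (at x) b * \<psi> x)"
    by (rule integrable_continuous_compact_support[OF c2, of R]) (simp add: R)
  have deriv: "frechet_derivative (\<lambda>x. f x * \<psi> x) (at x) b = f x * frechet_derivative \<psi> (at x) b + frechet_derivative f (at x) b * \<psi> x" for x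
    using frechet_derivative_eqI[OF has_derivative_mult[OF smooth_has_derivative[OF f] smooth_has_derivative[OF tf(1)]], of x] by simp
  have "(LINT x|lborel. frechet_derivative (\<lambda>x. f x * \<psi> x) (at x) b) = 0"
    by (rule integral_derivative_zero[OF smooth_mult[OF f tf(1)] b, of R]) (simp add: R)
  then have sum0: "(LINT x|lborel. f x * frechet_derivative \<psi> (at x) b) + (LINT x|lborel. frechet_derivative f (at x) b * \<psi> x) = 0"
    unfolding deriv using i1 i2 by simp
  have "(LINT x|lebesgue_on U. f x * frechet_derivative \<psi> (at x) b) = (LINT x|lborel. f x * frechet_derivative \<psi> (at x) b)"
  proof -
    have "(LINT x|lebesgue_on U. f x * frechet_derivative \<psi> (at x) b) = (LINT x|lebesgue. f x * frechet_derivative \<psi> (at x) b)"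
      unfolding integral_restrict_space[OF Us] using tf(3) by (intro Bochner_Integration.integral_cong) (auto simp: indicator_def)
    then show ?thesis using i1 by (simp add: integral_completion)
  qed
  moreover have "(LINT x|lebesgue_on U. (classical_gradient f x \<bullet> b) * \<psi> x) = (LINT x|lborel. frechet_derivative f (at x) b * \<psi> x)"
  proof -
    have "(LINT x|lebesgue_on U. (classical_gradient f x \<bullet> b) * \<psi> x) = (LINT x|lebesgue. frechet_derivative f (at x) b * \<psi> x)"
      unfolding integral_restrict_space[OF Us] classical_gradient_inner_Basis[OF b]
      using tf(2) by (intro Bochner_Integration.integral_cong) (auto simp: indicator_def)
    then show ?thesis using i2 by (simp add: integral_completion)
  qed
  ultimately show "(LINT x|lebesgue_on U. f x * frechet_derivative \<psi> (at x) b) = - (LINT x|lebesgue_on U. (classical_gradient f x \<bullet> b) * \<psi> x)"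
    using sum0 by simp
qed

section \<open>The space \<open>H\<^sup>1\<close> on a bounded open set\<close>

lemma square_integrableD:
  assumes "square_integrable U f"
  shows "f \<in> borel_measurable (lebesgue_on U)" "integrable (lebesgue_on U) (\<lambda>x. (norm (f x))\<^sup>2)"
  using assms unfolding square_integrable_def by auto

lemma square_integrable_lin:
  assumes "square_integrable U f" "square_integrable U g"
  shows "square_integrable U (\<lambda>x. f x + c *\<^sub>R g x)"
  unfolding square_integrable_def
  using L2_lin_integrable[OF square_integrableD(1)[OF assms(1)] square_integrableD(1)[OF assms(2)]
    square_integrableD(2)[OF assms(1)] square_integrableD(2)[OF assms(2)]] square_integrableD(1)[OF assms(1)] square_integrableD(1)[OF assms(2)]
  by auto

lemma square_integrable_lin_real:
  fixes f g :: "'a::euclidean_space \<Rightarrow> real"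
  shows "square_integrable U f \<Longrightarrow> square_integrable U g \<Longrightarrow> square_integrable U (\<lambda>x. f x + c * g x)"
  using square_integrable_lin[of U f g c] by simp

lemma square_integrable_inner:
  assumes "square_integrable U f" "square_integrable U g"
  shows "integrable (lebesgue_on U) (\<lambda>x. f x \<bullet> g x)"
  using assms by (intro L2_inner_integrable square_integrableD)

lemma square_integrable_times:
  fixes f g :: "'a::euclidean_space \<Rightarrow> real"
  shows "square_integrable U f \<Longrightarrow> square_integrable U g \<Longrightarrow> integrable (lebesgue_on U) (\<lambda>x. f x * g x)"
  using square_integrable_inner[of U f g] by simp

lemma square_integrable_zero: "square_integrable U (\<lambda>_. 0)"
  unfolding square_integrable_def by simp

text \<open>
  Used for smooth functions on bounded open sets and for their restrictions to segments.
\<close>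

lemma square_integrable_continuous:
  fixes f :: "'a::euclidean_space \<Rightarrow> 'b::euclidean_space"
  assumes c: "continuous_on UNIV f" and U: "bounded U" "U \<in> sets lebesgue"
  shows "square_integrable U f"
proof -
  have "f \<in> borel_measurable lebesgue"
    using borel_measurable_continuous_onI[OF c] by (intro measurable_completion) simp
  then have m[measurable]: "f \<in> borel_measurable (lebesgue_on U)" by (rule measurable_restrict_space1)
  have "bounded (f ` closure U)"
    by (intro compact_imp_bounded compact_continuous_image continuous_on_subset[OF c])
      (use U in \<open>auto simp: compact_closure\<close>)
  then obtain K where K: "\<And>x. x \<in> U \<Longrightarrow> norm (f x) \<le> K"
    unfolding bounded_iff using closure_subset by (metis image_eqI subsetD)
  have "emeasure lebesgue U < \<infinity>"
    using bounded_set_imp_lmeasurable[OF U] unfolding fmeasurable_def infinity_ennreal_def by blast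
  then interpret finite_measure "lebesgue_on U"
    using U(2) by (intro finite_measureI) (auto simp: emeasure_restrict_space space_restrict_space)
  have "integrable (lebesgue_on U) (\<lambda>x. (norm (f x))\<^sup>2)"
  proof (rule integrable_const_bound[where B = "K\<^sup>2"])
    show "AE x in lebesgue_on U. norm ((norm (f x))\<^sup>2) \<le> K\<^sup>2"
      using K by (intro AE_I2) (auto simp: space_restrict_space intro!: power_mono)
  qed simp
  then show ?thesis unfolding square_integrable_def using m by blast
qed

lemma square_integrable_imp_integrable:
  fixes f :: "'a::euclidean_space \<Rightarrow> 'b::euclidean_space"
  assumes "square_integrable U f" and U: "bounded U" "U \<in> sets lebesgue"
  shows "integrable (lebesgue_on U) (\<lambda>x. f x \<bullet> b)"
  using square_integrable_inner[OF assms(1) square_integrable_continuous[OF continuous_on_const U]] .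

lemma test_function_square_integrable:
  assumes "test_function U \<phi>" and U: "bounded U" "U \<in> sets lebesgue"
  shows "square_integrable U \<phi>" and "b \<in> Basis \<Longrightarrow> square_integrable U (\<lambda>x. frechet_derivative \<phi> (at x) b)"
  by (rule square_integrable_continuous[OF smooth_continuous[OF test_function_props(1)[OF assms(1)]] U])
    (rule square_integrable_continuous[OF smooth_derivative_continuous[OF test_function_props(1)[OF assms(1)]] U])

lemma weak_gradient_unique:
  fixes u :: "'a::euclidean_space \<Rightarrow> real"
  assumes U: "open U" "bounded U"
    and g: "square_integrable U g" "weak_gradient U u g"
    and h: "square_integrable U h" "weak_gradient U u h"
  shows "AE x in lebesgue_on U. g x = h x"
proof -
  have Us: "U \<in> sets lebesgue" using U by auto
  have "AE x in lebesgue_on U. \<forall>b\<in>Basis. (g x - h x) \<bullet> b = 0"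
  proof (rule AE_ball_countable')
    fix b :: 'a assume b: "b \<in> Basis"
    note sgh = square_integrable_lin[OF g(1) h(1), of "-1"]
    have gh: "integrable (lebesgue_on U) (\<lambda>x. (g x - h x) \<bullet> b)"
      using square_integrable_imp_integrable[OF sgh U(2) Us, of b] by simp
    show "AE x in lebesgue_on U. (g x - h x) \<bullet> b = 0"
    proof (rule fundamental_lemma[OF U(1) gh])
      fix \<phi> :: "'a \<Rightarrow> real" assume \<phi>: "test_function U \<phi>"
      note s\<phi> = test_function_square_integrable(1)[OF \<phi> U(2) Us]
      have comp: "integrable (lebesgue_on U) (\<lambda>x. (f x \<bullet> b) * \<phi> x)" if f: "square_integrable U f" for f :: "'a \<Rightarrow> 'a"
      proof -
        have "square_integrable U (\<lambda>x. \<phi> x *\<^sub>R b)"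
          using s\<phi> b unfolding square_integrable_def by (auto simp: power_mult_distrib)
        from square_integrable_inner[OF f this] show ?thesis by (simp add: mult.commute)
      qed
      have "(LINT x|lebesgue_on U. (g x \<bullet> b) * \<phi> x) = (LINT x|lebesgue_on U. (h x \<bullet> b) * \<phi> x)"
        using g(2)[unfolded weak_gradient_def, rule_format, OF \<phi> b] h(2)[unfolded weak_gradient_def, rule_format, OF \<phi> b]
        by simp
      then show "(LINT x|lebesgue_on U. (g x - h x) \<bullet> b * \<phi> x) = 0"
        using comp[OF g(1)] comp[OF h(1)] by (simp add: inner_diff_left left_diff_distrib)
    qed
  qed (simp add: countable_finite)
  then show ?thesis
  proof eventually_elim
    case (elim x)
    show ?case by (rule euclidean_eqI) (use elim in \<open>simp add: inner_diff_left\<close>)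
  qed
qed

lemma square_integrable_component:
  fixes g :: "'a::euclidean_space \<Rightarrow> 'a"
  assumes g: "square_integrable U g" and \<phi>: "square_integrable U \<phi>" and b: "b \<in> Basis"
  shows "integrable (lebesgue_on U) (\<lambda>x. (g x \<bullet> b) * \<phi> x)"
proof -
  have "square_integrable U (\<lambda>x. \<phi> x *\<^sub>R b)"
    using \<phi> b unfolding square_integrable_def by (auto simp: power_mult_distrib)
  from square_integrable_inner[OF g this] show ?thesis by (simp add: mult.commute)
qed

lemma weak_gradient_lin:
  fixes u v :: "'a::euclidean_space \<Rightarrow> real"
  assumes U: "open U" "bounded U"
    and s: "square_integrable U u" "square_integrable U v" "square_integrable U g" "square_integrable U h"
    and w: "weak_gradient U u g" "weak_gradient U v h"
  shows "weak_gradient U (\<lambda>x. u x + c * v x) (\<lambda>x. g x + c *\<^sub>R h x)"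
  unfolding weak_gradient_def
proof (intro allI impI)
  fix \<phi> :: "'a \<Rightarrow> real" and b :: 'a assume \<phi>: "test_function U \<phi>" and b: "b \<in> Basis"
  have Us: "U \<in> sets lebesgue" using U by auto
  note t = test_function_square_integrable[OF \<phi> U(2) Us]
  note i = square_integrable_times[OF s(1) t(2)[OF b]] square_integrable_times[OF s(2) t(2)[OF b]]
    square_integrable_component[OF s(3) t(1) b] square_integrable_component[OF s(4) t(1) b]
  have "(LINT x|lebesgue_on U. (u x + c * v x) * frechet_derivative \<phi> (at x) b)
      = (LINT x|lebesgue_on U. u x * frechet_derivative \<phi> (at x) b) + c * (LINT x|lebesgue_on U. v x * frechet_derivative \<phi> (at x) b)"
    using i by (simp add: distrib_right mult.assoc)
  also have "\<dots> = - (LINT x|lebesgue_on U. (g x \<bullet> b) * \<phi> x) + c * (- (LINT x|lebesgue_on U. (h x \<bullet> b) * \<phi> x))"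
    using w \<phi> b unfolding weak_gradient_def by simp
  also have "\<dots> = - (LINT x|lebesgue_on U. ((g x + c *\<^sub>R h x) \<bullet> b) * \<phi> x)"
    using i by (simp add: inner_add_left distrib_right mult.assoc)
  finally show "(LINT x|lebesgue_on U. (u x + c * v x) * frechet_derivative \<phi> (at x) b) =
      - (LINT x|lebesgue_on U. ((g x + c *\<^sub>R h x) \<bullet> b) * \<phi> x)" .
qed

lemma grad_H1:
  assumes "u \<in> H1 U"
  shows "square_integrable U u" "square_integrable U (grad U u)" "weak_gradient U u (grad U u)"
  using assms someI_ex[of "\<lambda>g. square_integrable U g \<and> weak_gradient U u g"]
  unfolding H1_def grad_def by auto

lemma H1I: "square_integrable U u \<Longrightarrow> square_integrable U g \<Longrightarrow> weak_gradient U u g \<Longrightarrow> u \<in> H1 U"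
  unfolding H1_def by blast

lemma grad_eq_AE:
  assumes "open U" "bounded U" "square_integrable U u" "square_integrable U g" "weak_gradient U u g"
  shows "AE x in lebesgue_on U. grad U u x = g x"
  using grad_H1[OF H1I[OF assms(3-5)]] assms by (intro weak_gradient_unique) auto

lemma H1_lin:
  assumes U: "open U" "bounded U" and uv: "u \<in> H1 U" "v \<in> H1 U"
  shows "(\<lambda>x. u x + c * v x) \<in> H1 U"
    and "AE x in lebesgue_on U. grad U (\<lambda>x. u x + c * v x) x = grad U u x + c *\<^sub>R grad U v x"
proof -
  note u = grad_H1[OF uv(1)] and v = grad_H1[OF uv(2)]
  have *: "square_integrable U (\<lambda>x. u x + c * v x)" "square_integrable U (\<lambda>x. grad U u x + c *\<^sub>R grad U v x)"
    "weak_gradient U (\<lambda>x. u x + c * v x) (\<lambda>x. grad U u x + c *\<^sub>R grad U v x)"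
    by (rule square_integrable_lin_real[OF u(1) v(1)], rule square_integrable_lin[OF u(2) v(2)],
        rule weak_gradient_lin[OF U u(1) v(1) u(2) v(2) u(3) v(3)])
  from H1I[OF *] show "(\<lambda>x. u x + c * v x) \<in> H1 U" .
  from grad_eq_AE[OF U *] show "AE x in lebesgue_on U. grad U (\<lambda>x. u x + c * v x) x = grad U u x + c *\<^sub>R grad U v x" .
qed

lemma weak_gradient_zero: "weak_gradient U (\<lambda>_. 0) (\<lambda>_. 0)"
  unfolding weak_gradient_def by simp

lemma H1_zero: "(\<lambda>_. 0) \<in> H1 U"
  by (rule H1I[OF square_integrable_zero square_integrable_zero weak_gradient_zero])

lemma smooth_H1:
  assumes U: "open U" "bounded U" and f: "smooth f"
  shows "f \<in> H1 U" "AE x in lebesgue_on U. grad U f x = classical_gradient f x"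
proof -
  have *: "square_integrable U f" "square_integrable U (classical_gradient f)" "weak_gradient U f (classical_gradient f)"
    using U square_integrable_continuous[OF smooth_continuous[OF f] U(2)]
      square_integrable_continuous[OF continuous_classical_gradient[OF f] U(2)] weak_gradient_smooth[OF U(1) f]
    by auto
  from H1I[OF *] show "f \<in> H1 U" .
  from grad_eq_AE[OF U *] show "AE x in lebesgue_on U. grad U f x = classical_gradient f x" .
qed

text \<open>
  The norms of \<open>H\<^sup>1\<close> and the energy are built from these forms, each of which is a semi-inner product
  by itself; the weight will be \<open>1\<close> or the coefficient \<open>a\<close>.
\<close>

definition L2_inner :: "'a::euclidean_space set \<Rightarrow> ('a \<Rightarrow> real) \<Rightarrow> ('a \<Rightarrow> real) \<Rightarrow> real" where
  "L2_inner U u v = (LINT x|lebesgue_on U. u x * v x)"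

definition weighted_grad_inner ::
    "('a::euclidean_space \<Rightarrow> real) \<Rightarrow> 'a set \<Rightarrow> ('a \<Rightarrow> real) \<Rightarrow> ('a \<Rightarrow> real) \<Rightarrow> real" where
  "weighted_grad_inner a U u v = (LINT x|lebesgue_on U. a x * (grad U u x \<bullet> grad U v x))"

abbreviation grad_inner :: "'a::euclidean_space set \<Rightarrow> ('a \<Rightarrow> real) \<Rightarrow> ('a \<Rightarrow> real) \<Rightarrow> real" where
  "grad_inner \<equiv> weighted_grad_inner (\<lambda>_. 1)"

definition H1_inner :: "'a::euclidean_space set \<Rightarrow> ('a \<Rightarrow> real) \<Rightarrow> ('a \<Rightarrow> real) \<Rightarrow> real" where
  "H1_inner U u v = L2_inner U u v + grad_inner U u v"

lemma L2_semi_inner_space: "semi_inner_space {u. square_integrable U u} (L2_inner U)"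
proof
  fix u v w :: "'a \<Rightarrow> real" and c :: real
  assume "u \<in> {u. square_integrable U u}" "v \<in> {u. square_integrable U u}" "w \<in> {u. square_integrable U u}"
  then have s: "square_integrable U u" "square_integrable U v" "square_integrable U w" by auto
  show "L2_inner U (\<lambda>x. u x + c * v x) w = L2_inner U u w + c * L2_inner U v w"
    unfolding L2_inner_def using square_integrable_times[OF s(1,3)] square_integrable_times[OF s(2,3)]
    by (simp add: distrib_right mult.assoc)
qed (auto simp: square_integrable_zero square_integrable_lin_real L2_inner_def mult.commute)

lemma integrable_weighted_grad:
  assumes a: "a \<in> borel_measurable (lebesgue_on U)" "AE x in lebesgue_on U. \<bar>a x\<bar> \<le> K"
    and g: "square_integrable U g" "square_integrable U h"
  shows "integrable (lebesgue_on U) (\<lambda>x. a x * (g x \<bullet> h x))"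
proof (rule Bochner_Integration.integrable_bound)
  show "integrable (lebesgue_on U) (\<lambda>x. K * norm (g x \<bullet> h x))"
    using square_integrable_inner[OF g] by (intro integrable_mult_right integrable_norm)
  show "(\<lambda>x. a x * (g x \<bullet> h x)) \<in> borel_measurable (lebesgue_on U)"
    using a(1) borel_measurable_integrable[OF square_integrable_inner[OF g]] by simp
  show "AE x in lebesgue_on U. norm (a x * (g x \<bullet> h x)) \<le> norm (K * norm (g x \<bullet> h x))"
    using a(2)
  proof eventually_elim
    case (elim x)
    have "\<bar>a x\<bar> * \<bar>g x \<bullet> h x\<bar> \<le> \<bar>K\<bar> * \<bar>g x \<bullet> h x\<bar>" using elim by (intro mult_right_mono) auto
    then show ?case by (simp add: abs_mult)
  qed
qed

lemma weighted_grad_semi_inner_space: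
  assumes U: "open U" "bounded U"
    and a: "a \<in> borel_measurable (lebesgue_on U)" "AE x in lebesgue_on U. 0 \<le> a x \<and> a x \<le> K"
  shows "semi_inner_space (H1 U) (weighted_grad_inner a U)"
proof
  have aK: "AE x in lebesgue_on U. \<bar>a x\<bar> \<le> K" using a(2) by eventually_elim auto
  note int = integrable_weighted_grad[OF a(1) aK grad_H1(2) grad_H1(2)]
  fix u v w :: "'a \<Rightarrow> real" and c :: real
  show "(\<lambda>_. 0) \<in> H1 U" by (rule H1_zero)
  show "weighted_grad_inner a U u v = weighted_grad_inner a U v u"
    unfolding weighted_grad_inner_def by (simp add: inner_commute)
  show "0 \<le> weighted_grad_inner a U u u"
    unfolding weighted_grad_inner_def
  proof (rule integral_nonneg_AE)
    show "AE x in lebesgue_on U. 0 \<le> a x * (grad U u x \<bullet> grad U u x)"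
      using a(2) by eventually_elim simp
  qed
  assume u: "u \<in> H1 U" and v: "v \<in> H1 U"
  show "(\<lambda>x. u x + c * v x) \<in> H1 U" by (rule H1_lin(1)[OF U u v])
  assume w: "w \<in> H1 U"
  have "weighted_grad_inner a U (\<lambda>x. u x + c * v x) w = (LINT x|lebesgue_on U. a x * (grad U u x \<bullet> grad U w x) + c * (a x * (grad U v x \<bullet> grad U w x)))"
    unfolding weighted_grad_inner_def
  proof (rule integral_cong_AE)
    show "(\<lambda>x. a x * (grad U (\<lambda>x. u x + c * v x) x \<bullet> grad U w x)) \<in> borel_measurable (lebesgue_on U)"
      by (rule borel_measurable_integrable[OF int[OF H1_lin(1)[OF U u v] w]])
    show "(\<lambda>x. a x * (grad U u x \<bullet> grad U w x) + c * (a x * (grad U v x \<bullet> grad U w x))) \<in> borel_measurable (lebesgue_on U)"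
      by (rule borel_measurable_integrable) (intro Bochner_Integration.integrable_add integrable_mult_right int u v w)
    show "AE x in lebesgue_on U. a x * (grad U (\<lambda>x. u x + c * v x) x \<bullet> grad U w x) =
        a x * (grad U u x \<bullet> grad U w x) + c * (a x * (grad U v x \<bullet> grad U w x))"
      using H1_lin(2)[OF U u v, of c] by eventually_elim (simp add: inner_add_left algebra_simps)
  qed
  also have "\<dots> = weighted_grad_inner a U u w + c * weighted_grad_inner a U v w"
    unfolding weighted_grad_inner_def using int[OF u w] int[OF v w] by simp
  finally show "weighted_grad_inner a U (\<lambda>x. u x + c * v x) w = weighted_grad_inner a U u w + c * weighted_grad_inner a U v w" .
qed

lemma semi_inner_space_add:
  assumes "semi_inner_space X p" "semi_inner_space X q"
  shows "semi_inner_space X (\<lambda>u v. p u v + q u v)"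
proof -
  interpret P: semi_inner_space X p by fact
  interpret Q: semi_inner_space X q by fact
  show ?thesis
  proof
    fix u v assume h: "u \<in> X" "v \<in> X"
    show "p u v + q u v = p v u + q v u" using P.ip_sym[OF h] Q.ip_sym[OF h] by simp
    fix w c assume "w \<in> X"
    then show "p (\<lambda>x. u x + c * v x) w + q (\<lambda>x. u x + c * v x) w = p u w + q u w + c * (p v w + q v w)"
      by (simp add: P.ip_lin Q.ip_lin h algebra_simps)
  qed (auto simp: P.zero_in P.lin_in P.ip_nonneg Q.ip_nonneg)
qed

lemma grad_semi_inner_space:
  "open U \<Longrightarrow> bounded U \<Longrightarrow> semi_inner_space (H1 U) (grad_inner U)"
  by (rule weighted_grad_semi_inner_space[where K = 1]) auto

lemma L2_semi_inner_space_H1: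
  assumes "open U" "bounded U"
  shows "semi_inner_space (H1 U) (L2_inner U)"
  by (rule semi_inner_space.subspace_semi_inner_space[OF L2_semi_inner_space])
    (auto simp: grad_H1 H1_zero H1_lin assms)

lemma H1_semi_inner_space: "open U \<Longrightarrow> bounded U \<Longrightarrow> semi_inner_space (H1 U) (H1_inner U)"
  unfolding H1_inner_def[abs_def] by (intro semi_inner_space_add L2_semi_inner_space_H1 grad_semi_inner_space)

lemma H1_norm_eq: "H1_norm U u = sqrt (H1_inner U u u)"
  unfolding H1_norm_def H1_inner_def L2_inner_def weighted_grad_inner_def
  by (simp add: power2_eq_square power2_norm_eq_inner[symmetric])

lemma weighted_grad_inner_1: "grad_inner U u u = (LINT x|lebesgue_on U. (norm (grad U u x))\<^sup>2)"
  unfolding weighted_grad_inner_def by (simp add: power2_norm_eq_inner)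

lemma L2_inner_self: "L2_inner U u u = (LINT x|lebesgue_on U. (norm (u x))\<^sup>2)"
  unfolding L2_inner_def by (simp add: power2_eq_square)

text \<open>Closedness of the weak gradient: both sides of its definition pass to \<open>L\<^sup>2\<close>-limits.\<close>

lemma H1_complete:
  assumes U: "open U" "bounded U"
  shows "semi_Hilbert_space (H1 U) (H1_inner U)"
proof -
  interpret semi_inner_space "H1 U" "H1_inner U" by (rule H1_semi_inner_space[OF U])
  interpret L: semi_inner_space "H1 U" "L2_inner U" by (rule L2_semi_inner_space_H1[OF U])
  interpret G: semi_inner_space "H1 U" "grad_inner U" by (rule grad_semi_inner_space[OF U])
  have Us: "U \<in> sets lebesgue" using U by auto
  show ?thesis
  proof
    fix u :: "nat \<Rightarrow> 'a \<Rightarrow> real" assume u: "\<And>k. u k \<in> H1 U" and Cau: "Cauchy_seq u"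
    note gu = grad_H1[OF u]
    have grad_diff: "(LINT x|lebesgue_on U. (norm (grad U (u k) x - grad U (u m) x))\<^sup>2)
        = grad_inner U (\<lambda>x. u k x - u m x) (\<lambda>x. u k x - u m x)" for k m
      unfolding weighted_grad_inner_1
    proof (rule integral_cong_AE)
      show "(\<lambda>x. (norm (grad U (u k) x - grad U (u m) x))\<^sup>2) \<in> borel_measurable (lebesgue_on U)"
        using square_integrableD(1)[OF gu(2)] by simp
      show "(\<lambda>x. (norm (grad U (\<lambda>x. u k x - u m x) x))\<^sup>2) \<in> borel_measurable (lebesgue_on U)"
        using square_integrableD(1)[OF grad_H1(2)[OF diff_in[OF u u]]] by simp
      show "AE x in lebesgue_on U. (norm (grad U (u k) x - grad U (u m) x))\<^sup>2 = (norm (grad U (\<lambda>x. u k x - u m x) x))\<^sup>2"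
        using H1_lin(2)[OF U u u, of k "-1" m] by eventually_elim simp
    qed
    have le: "L2_inner U w w \<le> H1_inner U w w" "grad_inner U w w \<le> H1_inner U w w" if "w \<in> H1 U" for w
      unfolding H1_inner_def using L.ip_nonneg[OF that] G.ip_nonneg[OF that] by auto
    have small: "\<exists>N. \<forall>k\<ge>N. \<forall>m\<ge>N. H1_inner U (\<lambda>x. u k x - u m x) (\<lambda>x. u k x - u m x) < d" if d: "d > 0" for d
    proof -
      obtain N where "\<And>k m. k \<ge> N \<Longrightarrow> m \<ge> N \<Longrightarrow> nrm (\<lambda>x. u k x - u m x) < sqrt d"
        using Cau d unfolding Cauchy_seq_def by (metis real_sqrt_gt_zero)
      then show ?thesis unfolding nrm_def by (metis real_sqrt_less_iff)
    qed
    have "\<exists>g. g \<in> borel_measurable (lebesgue_on U) \<and> integrable (lebesgue_on U) (\<lambda>x. (norm (g x))\<^sup>2) \<and>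
             (\<lambda>k. LINT x|lebesgue_on U. (norm (u k x - g x))\<^sup>2) \<longlonglongrightarrow> 0"
    proof (rule L2_complete)
      fix d :: real assume "d > 0"
      from small[OF this] show "\<exists>N. \<forall>k\<ge>N. \<forall>m\<ge>N. (LINT x|lebesgue_on U. (norm (u k x - u m x))\<^sup>2) < d"
        using le(1)[OF diff_in[OF u u]] unfolding L2_inner_self by (meson le_less_trans)
    qed (use square_integrableD[OF gu(1)] in auto)
    then obtain w where w: "square_integrable U w" and wl: "(\<lambda>k. LINT x|lebesgue_on U. (norm (u k x - w x))\<^sup>2) \<longlonglongrightarrow> 0"
      unfolding square_integrable_def by blast
    have "\<exists>g. g \<in> borel_measurable (lebesgue_on U) \<and> integrable (lebesgue_on U) (\<lambda>x. (norm (g x))\<^sup>2) \<and>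
             (\<lambda>k. LINT x|lebesgue_on U. (norm (grad U (u k) x - g x))\<^sup>2) \<longlonglongrightarrow> 0"
    proof (rule L2_complete)
      fix d :: real assume "d > 0"
      from small[OF this] show "\<exists>N. \<forall>k\<ge>N. \<forall>m\<ge>N. (LINT x|lebesgue_on U. (norm (grad U (u k) x - grad U (u m) x))\<^sup>2) < d"
        using le(2)[OF diff_in[OF u u]] unfolding grad_diff by (meson le_less_trans)
    qed (use square_integrableD[OF gu(2)] in auto)
    then obtain g where g: "square_integrable U g" and gl: "(\<lambda>k. LINT x|lebesgue_on U. (norm (grad U (u k) x - g x))\<^sup>2) \<longlonglongrightarrow> 0"
      unfolding square_integrable_def by blast
    have wg: "weak_gradient U w g"
      unfolding weak_gradient_def
    proof (intro allI impI)
      fix \<phi> :: "'a \<Rightarrow> real" and b :: 'a assume \<phi>: "test_function U \<phi>" and b: "b \<in> Basis"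
      note t = test_function_square_integrable[OF \<phi> U(2) Us]
      have sb: "square_integrable U (\<lambda>x. \<phi> x *\<^sub>R b)"
        using t(1) b unfolding square_integrable_def by (auto simp: power_mult_distrib)
      have "(\<lambda>k. LINT x|lebesgue_on U. u k x \<bullet> frechet_derivative \<phi> (at x) b) \<longlonglongrightarrow> (LINT x|lebesgue_on U. w x \<bullet> frechet_derivative \<phi> (at x) b)"
        by (intro L2_inner_tendsto square_integrableD gu(1) w t(2) b wl)
      moreover have "(\<lambda>k. - (LINT x|lebesgue_on U. grad U (u k) x \<bullet> (\<phi> x *\<^sub>R b))) \<longlonglongrightarrow> - (LINT x|lebesgue_on U. g x \<bullet> (\<phi> x *\<^sub>R b))"
        by (intro tendsto_minus L2_inner_tendsto square_integrableD gu(2) g sb gl)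
      moreover have "(LINT x|lebesgue_on U. u k x \<bullet> frechet_derivative \<phi> (at x) b) = - (LINT x|lebesgue_on U. grad U (u k) x \<bullet> (\<phi> x *\<^sub>R b))" for k
        using gu(3)[of k] \<phi> b unfolding weak_gradient_def by (simp add: mult.commute)
      ultimately have "(LINT x|lebesgue_on U. w x \<bullet> frechet_derivative \<phi> (at x) b) = - (LINT x|lebesgue_on U. g x \<bullet> (\<phi> x *\<^sub>R b))"
        by (simp only: LIMSEQ_unique)
      then show "(LINT x|lebesgue_on U. w x * frechet_derivative \<phi> (at x) b) = - (LINT x|lebesgue_on U. (g x \<bullet> b) * \<phi> x)"
        by (simp add: mult.commute)
    qed
    have wH: "w \<in> H1 U" by (rule H1I[OF w g wg])
    have H1_diff: "H1_inner U (\<lambda>x. u k x - w x) (\<lambda>x. u k x - w x) =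
        (LINT x|lebesgue_on U. (norm (u k x - w x))\<^sup>2) + (LINT x|lebesgue_on U. (norm (grad U (u k) x - g x))\<^sup>2)" for k
    proof -
      have "(LINT x|lebesgue_on U. (norm (grad U (\<lambda>x. u k x - w x) x))\<^sup>2) = (LINT x|lebesgue_on U. (norm (grad U (u k) x - g x))\<^sup>2)"
      proof (rule integral_cong_AE)
        show "(\<lambda>x. (norm (grad U (\<lambda>x. u k x - w x) x))\<^sup>2) \<in> borel_measurable (lebesgue_on U)"
          using square_integrableD(1)[OF grad_H1(2)[OF diff_in[OF u wH]]] by simp
        show "(\<lambda>x. (norm (grad U (u k) x - g x))\<^sup>2) \<in> borel_measurable (lebesgue_on U)"
          using square_integrableD(1)[OF gu(2)] square_integrableD(1)[OF g] by simp
        show "AE x in lebesgue_on U. (norm (grad U (\<lambda>x. u k x - w x) x))\<^sup>2 = (norm (grad U (u k) x - g x))\<^sup>2"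
          using H1_lin(2)[OF U u wH, of k "-1"] grad_eq_AE[OF U w g wg] by eventually_elim simp
      qed
      then show ?thesis unfolding H1_inner_def L2_inner_self weighted_grad_inner_1 by simp
    qed
    have "(\<lambda>k. H1_inner U (\<lambda>x. u k x - w x) (\<lambda>x. u k x - w x)) \<longlonglongrightarrow> 0"
      unfolding H1_diff using tendsto_add[OF wl gl] by simp
    then have "(\<lambda>k. nrm (\<lambda>x. u k x - w x)) \<longlonglongrightarrow> 0"
      using ip_tendsto_0_iff[of "\<lambda>k x. u k x - w x"] diff_in[OF u wH] by blast
    then show "\<exists>w\<in>H1 U. (\<lambda>k. nrm (\<lambda>x. u k x - w x)) \<longlonglongrightarrow> 0" using wH by blast
  qed
qed

section \<open>Traces\<close>

abbreviation seg_fun :: "'a::euclidean_space \<Rightarrow> 'a \<Rightarrow> ('a \<Rightarrow> real) \<Rightarrow> real \<Rightarrow> real" where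
  "seg_fun p q g \<equiv> \<lambda>t. g (linepath p q t)"

text \<open>
  The norm in which the restrictions to a segment, parametrized over the unit interval, converge.
\<close>

definition unit_L2_norm :: "(real \<Rightarrow> real) \<Rightarrow> real" where
  "unit_L2_norm = semi_inner_space.nrm (L2_inner {0..1})"

interpretation unit_L2: semi_inner_space "{u. square_integrable {0..1::real} u}" "L2_inner {0..1}"
  rewrites "semi_inner_space.nrm (L2_inner {0..1}) \<equiv> unit_L2_norm"
  by (rule L2_semi_inner_space) (simp add: unit_L2_norm_def)

lemma square_integrable_segment:
  "smooth \<phi> \<Longrightarrow> square_integrable {0..1} (seg_fun p q \<phi>)"
  by (rule square_integrable_continuous[OF continuous_on_compose2[OF smooth_continuous continuous_on_linepath]]) auto

text \<open>
  Smooth functions witnessing a trace, with both convergences expressed by norms so that the triangle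
  inequality applies.
\<close>

definition trace_approximation ::
    "'a::euclidean_space set \<Rightarrow> 'a \<Rightarrow> 'a \<Rightarrow> ('a \<Rightarrow> real) \<Rightarrow> ('a \<Rightarrow> real) \<Rightarrow> (nat \<Rightarrow> 'a \<Rightarrow> real) \<Rightarrow> bool" where
  "trace_approximation U p q u g \<phi> \<longleftrightarrow>
     square_integrable {0..1} (seg_fun p q g) \<and> (\<forall>k. smooth (\<phi> k)) \<and>
     (\<lambda>k. H1_norm U (\<lambda>x. \<phi> k x - u x)) \<longlonglongrightarrow> 0 \<and>
     (\<lambda>k. unit_L2_norm (\<lambda>t. \<phi> k (linepath p q t) - g (linepath p q t))) \<longlonglongrightarrow> 0"

lemma trace_approximationD:
  assumes "trace_approximation U p q u g \<phi>"
  shows "square_integrable {0..1} (seg_fun p q g)" "\<And>k. smooth (\<phi> k)"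
    "(\<lambda>k. H1_norm U (\<lambda>x. \<phi> k x - u x)) \<longlonglongrightarrow> 0"
    "(\<lambda>k. unit_L2_norm (\<lambda>t. \<phi> k (linepath p q t) - g (linepath p q t))) \<longlonglongrightarrow> 0"
  by (rule assms[unfolded trace_approximation_def, THEN conjunct1],
      rule assms[unfolded trace_approximation_def, THEN conjunct2, THEN conjunct1, rule_format],
      rule assms[unfolded trace_approximation_def, THEN conjunct2, THEN conjunct2, THEN conjunct1],
      rule assms[unfolded trace_approximation_def, THEN conjunct2, THEN conjunct2, THEN conjunct2])

lemma trace_on_segment_iff: "trace_on_segment U p q u g \<longleftrightarrow> (\<exists>\<phi>. trace_approximation U p q u g \<phi>)"
proof -
  have *: "(\<lambda>k. LINT t|lebesgue_on {0..1::real}. (\<phi> k (linepath p q t) - g (linepath p q t))\<^sup>2) \<longlonglongrightarrow> 0 \<longleftrightarrow>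
      (\<lambda>k. unit_L2_norm (\<lambda>t. \<phi> k (linepath p q t) - g (linepath p q t))) \<longlonglongrightarrow> 0"
    if g: "square_integrable {0..1} (seg_fun p q g)" and \<phi>: "\<forall>k. smooth (\<phi> k)" for \<phi> :: "nat \<Rightarrow> 'a \<Rightarrow> real"
  proof -
    have "(\<lambda>t. \<phi> k (linepath p q t) - g (linepath p q t)) \<in> {u. square_integrable {0..1::real} u}" for k
      by (rule unit_L2.diff_in) (simp_all add: square_integrable_segment \<phi> g)
    from unit_L2.ip_tendsto_0_iff[of "\<lambda>k t. \<phi> k (linepath p q t) - g (linepath p q t)", OF this]
    show ?thesis by (simp add: L2_inner_def power2_eq_square)
  qed
  have "trace_approximation U p q u g \<phi> \<longleftrightarrow> square_integrable {0..1} (seg_fun p q g) \<and> (\<forall>k. smooth (\<phi> k)) \<and>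
     (\<lambda>k. H1_norm U (\<lambda>x. \<phi> k x - u x)) \<longlonglongrightarrow> 0 \<and>
     (\<lambda>k. LINT t|lebesgue_on {0..1::real}. (\<phi> k (linepath p q t) - g (linepath p q t))\<^sup>2) \<longlonglongrightarrow> 0" for \<phi>
    unfolding trace_approximation_def by (intro conj_cong refl *[symmetric]) 
  then show ?thesis unfolding trace_on_segment_def by (simp only: ex_simps)
qed

context
  fixes U :: "'a::euclidean_space set"
  assumes U: "open U" "bounded U"
begin

interpretation H1: semi_Hilbert_space "H1 U" "H1_inner U" by (rule H1_complete[OF U])

lemma H1_norm_nrm: "H1_norm U = semi_inner_space.nrm (H1_inner U)"
  by (simp add: fun_eq_iff H1.nrm_def H1_norm_eq)

lemma trace_on_segment_lin:
  assumes u: "u \<in> H1 U" and v: "v \<in> H1 U"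
    and tu: "trace_on_segment U p q u g" and tv: "trace_on_segment U p q v h"
  shows "trace_on_segment U p q (\<lambda>x. u x + c * v x) (\<lambda>x. g x + c * h x)"
proof -
  obtain \<phi> where "trace_approximation U p q u g \<phi>" using tu unfolding trace_on_segment_iff ..
  note g = trace_approximationD(1)[OF this] and \<phi> = trace_approximationD(2)[OF this]
    and \<phi>u = trace_approximationD(3)[OF this, unfolded H1_norm_nrm] and \<phi>g = trace_approximationD(4)[OF this]
  obtain \<psi> where "trace_approximation U p q v h \<psi>" using tv unfolding trace_on_segment_iff ..
  note h = trace_approximationD(1)[OF this] and \<psi> = trace_approximationD(2)[OF this]
    and \<psi>v = trace_approximationD(3)[OF this, unfolded H1_norm_nrm] and \<psi>h = trace_approximationD(4)[OF this]
  note \<phi>H = smooth_H1(1)[OF U \<phi>] and \<psi>H = smooth_H1(1)[OF U \<psi>]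
  have 1: "H1.nrm (\<lambda>x. (\<phi> k x + c * \<psi> k x) - (u x + c * v x)) \<le> H1.nrm (\<lambda>x. \<phi> k x - u x) + \<bar>c\<bar> * H1.nrm (\<lambda>x. \<psi> k x - v x)" for k
    using H1.nrm_triangle[OF H1.diff_in[OF \<phi>H[of k] u] H1.scale_in[OF H1.diff_in[OF \<psi>H[of k] v], of c]]
      H1.nrm_scale[OF H1.diff_in[OF \<psi>H[of k] v], of c] by (simp add: algebra_simps)
  have L1: "(\<lambda>k. H1.nrm (\<lambda>x. (\<phi> k x + c * \<psi> k x) - (u x + c * v x))) \<longlonglongrightarrow> 0"
  proof (rule Lim_null_comparison)
    show "\<forall>\<^sub>F k in sequentially. norm (H1.nrm (\<lambda>x. (\<phi> k x + c * \<psi> k x) - (u x + c * v x)))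
        \<le> H1.nrm (\<lambda>x. \<phi> k x - u x) + \<bar>c\<bar> * H1.nrm (\<lambda>x. \<psi> k x - v x)"
      using 1 H1.nrm_nonneg[OF H1.diff_in[OF H1.lin_in[OF \<phi>H \<psi>H] H1.lin_in[OF u v]]] by (intro always_eventually) simp
    show "(\<lambda>k. H1.nrm (\<lambda>x. \<phi> k x - u x) + \<bar>c\<bar> * H1.nrm (\<lambda>x. \<psi> k x - v x)) \<longlonglongrightarrow> 0"
      using tendsto_add[OF \<phi>u tendsto_mult_right_zero[OF \<psi>v]] by simp
  qed
  have S: "seg_fun p q (\<phi> k) \<in> {u. square_integrable {0..1::real} u}" "seg_fun p q (\<psi> k) \<in> {u. square_integrable {0..1::real} u}"
    "seg_fun p q g \<in> {u. square_integrable {0..1::real} u}" "seg_fun p q h \<in> {u. square_integrable {0..1::real} u}" for k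
    using square_integrable_segment[OF \<phi>] square_integrable_segment[OF \<psi>] g h by auto
  have 2: "unit_L2_norm (\<lambda>t. (\<phi> k (linepath p q t) + c * \<psi> k (linepath p q t)) - (g (linepath p q t) + c * h (linepath p q t)))
     \<le> unit_L2_norm (\<lambda>t. \<phi> k (linepath p q t) - g (linepath p q t)) + \<bar>c\<bar> * unit_L2_norm (\<lambda>t. \<psi> k (linepath p q t) - h (linepath p q t))" for k
    using unit_L2.nrm_triangle[OF unit_L2.diff_in[OF S(1)[of k] S(3)] unit_L2.scale_in[OF unit_L2.diff_in[OF S(2)[of k] S(4)], of c]]
      unit_L2.nrm_scale[OF unit_L2.diff_in[OF S(2)[of k] S(4)], of c] by (simp add: algebra_simps)
  have L2: "(\<lambda>k. unit_L2_norm (\<lambda>t. (\<phi> k (linepath p q t) + c * \<psi> k (linepath p q t)) - (g (linepath p q t) + c * h (linepath p q t)))) \<longlonglongrightarrow> 0"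
  proof (rule Lim_null_comparison)
    show "\<forall>\<^sub>F k in sequentially. norm (unit_L2_norm (\<lambda>t. (\<phi> k (linepath p q t) + c * \<psi> k (linepath p q t)) - (g (linepath p q t) + c * h (linepath p q t))))
        \<le> unit_L2_norm (\<lambda>t. \<phi> k (linepath p q t) - g (linepath p q t)) + \<bar>c\<bar> * unit_L2_norm (\<lambda>t. \<psi> k (linepath p q t) - h (linepath p q t))"
      using 2 unit_L2.nrm_nonneg[OF unit_L2.diff_in[OF unit_L2.lin_in[OF S(1,2)] unit_L2.lin_in[OF S(3,4)]]]
      by (intro always_eventually) simp
    show "(\<lambda>k. unit_L2_norm (\<lambda>t. \<phi> k (linepath p q t) - g (linepath p q t)) + \<bar>c\<bar> * unit_L2_norm (\<lambda>t. \<psi> k (linepath p q t) - h (linepath p q t))) \<longlonglongrightarrow> 0"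
      using tendsto_add[OF \<phi>g tendsto_mult_right_zero[OF \<psi>h]] by simp
  qed
  have "trace_approximation U p q (\<lambda>x. u x + c * v x) (\<lambda>x. g x + c * h x) (\<lambda>k x. \<phi> k x + c * \<psi> k x)"
    unfolding trace_approximation_def H1_norm_nrm
    using unit_L2.lin_in[OF S(3,4), of c] smooth_lin[OF \<phi> \<psi>] by (intro conjI L1 L2) simp_all
  then show ?thesis unfolding trace_on_segment_iff by blast
qed

text \<open>
  A diagonal argument: for each \<open>m\<close> one smooth function close to \<open>u m\<close> in \<open>H\<^sup>1\<close> and to \<open>g\<close> on the
  segment.
\<close>

lemma trace_on_segment_closed:
  assumes u: "\<And>m::nat. u m \<in> H1 U" and w: "w \<in> H1 U"
    and lim: "(\<lambda>m. H1_norm U (\<lambda>x. u m x - w x)) \<longlonglongrightarrow> 0"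
    and tr: "\<And>m. trace_on_segment U p q (u m) g"
  shows "trace_on_segment U p q w g"
proof -
  define good where "good m \<phi> \<longleftrightarrow> smooth \<phi> \<and> H1.nrm (\<lambda>x. \<phi> x - u m x) < inverse (real (Suc m)) \<and>
      unit_L2_norm (\<lambda>t. \<phi> (linepath p q t) - g (linepath p q t)) < inverse (real (Suc m))" for m \<phi>
  have "\<exists>\<phi>. good m \<phi>" for m
  proof -
    obtain \<phi> where "trace_approximation U p q (u m) g \<phi>" using tr[of m] unfolding trace_on_segment_iff ..
    note \<phi> = trace_approximationD(2)[OF this]
      and \<phi>u = trace_approximationD(3)[OF this, unfolded H1_norm_nrm] and \<phi>g = trace_approximationD(4)[OF this]
    have pos: "0 < inverse (real (Suc m))" by simp
    have "\<forall>\<^sub>F k in sequentially. good m (\<phi> k)"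
      using eventually_conj[OF order_tendstoD(2)[OF \<phi>u pos] order_tendstoD(2)[OF \<phi>g pos]]
      by (rule eventually_mono) (unfold good_def, intro conjI \<phi>, simp_all only:)
    from eventually_happens'[OF sequentially_bot this] show ?thesis by blast
  qed
  then obtain \<phi> where good: "\<And>m. good m (\<phi> m)" using choice[of good] by blast
  have \<phi>: "smooth (\<phi> m)" and \<phi>u: "H1.nrm (\<lambda>x. \<phi> m x - u m x) < inverse (real (Suc m))"
    and \<phi>g: "unit_L2_norm (\<lambda>t. \<phi> m (linepath p q t) - g (linepath p q t)) < inverse (real (Suc m))" for m
    by (rule good[of m, unfolded good_def, THEN conjunct1], (rule good[of m, unfolded good_def, THEN conjunct2, THEN conjunct1]),
      (rule good[of m, unfolded good_def, THEN conjunct2, THEN conjunct2]))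
  note \<phi>H = smooth_H1(1)[OF U \<phi>]
  have g: "square_integrable {0..1} (seg_fun p q g)" using tr[of 0] unfolding trace_on_segment_def by blast
  have "(\<lambda>m. H1.nrm (\<lambda>x. \<phi> m x - w x)) \<longlonglongrightarrow> 0"
  proof (rule Lim_null_comparison)
    have "norm (H1.nrm (\<lambda>x. \<phi> m x - w x)) \<le> inverse (real (Suc m)) + H1.nrm (\<lambda>x. u m x - w x)" for m
      using H1.nrm_triangle_diff[OF \<phi>H u w, of m m] \<phi>u[of m] H1.nrm_nonneg[OF H1.diff_in[OF \<phi>H w], of m] unfolding real_norm_def by linarith
    then show "\<forall>\<^sub>F m in sequentially. norm (H1.nrm (\<lambda>x. \<phi> m x - w x)) \<le> inverse (real (Suc m)) + H1.nrm (\<lambda>x. u m x - w x)"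
      by (intro always_eventually allI)
    show "(\<lambda>m. inverse (real (Suc m)) + H1.nrm (\<lambda>x. u m x - w x)) \<longlonglongrightarrow> 0"
      using tendsto_add[OF LIMSEQ_inverse_real_of_nat lim[unfolded H1_norm_nrm]] by simp
  qed
  moreover have "(\<lambda>m. unit_L2_norm (\<lambda>t. \<phi> m (linepath p q t) - g (linepath p q t))) \<longlonglongrightarrow> 0"
  proof (rule Lim_null_comparison[OF _ LIMSEQ_inverse_real_of_nat])
    have "norm (unit_L2_norm (\<lambda>t. \<phi> m (linepath p q t) - g (linepath p q t))) \<le> inverse (real (Suc m))" for m
    proof -
      have "(\<lambda>t. \<phi> m (linepath p q t) - g (linepath p q t)) \<in> {u. square_integrable {0..1::real} u}"
        by (rule unit_L2.diff_in) (simp_all add: square_integrable_segment \<phi> g)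
      from unit_L2.nrm_nonneg[OF this] \<phi>g[of m] show ?thesis unfolding real_norm_def by linarith
    qed
    then show "\<forall>\<^sub>F m in sequentially. norm (unit_L2_norm (\<lambda>t. \<phi> m (linepath p q t) - g (linepath p q t))) \<le> inverse (real (Suc m))"
      by (intro always_eventually allI)
  qed
  ultimately have "trace_approximation U p q w g \<phi>"
    unfolding trace_approximation_def H1_norm_nrm using g \<phi> by (intro conjI allI)
  then show ?thesis unfolding trace_on_segment_iff by blast
qed

end

section \<open>The Poincare inequality\<close>

text \<open>
  The weight \<open>r - x\<close> removes the boundary term at \<open>r\<close>: integrating the derivative of
  \<open>(f x)\<^sup>2 * (r - x)\<close> bounds \<open>\<integral> f\<^sup>2\<close> by \<open>(r - l) (f l)\<^sup>2 + \<integral> 2 f f' (r - x)\<close>, and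
  \<open>2 f f' (r - x) \<le> f\<^sup>2 / 2 + 2 (r - x)\<^sup>2 f'\<^sup>2\<close> lets half of the left-hand side absorb the mixed term.
\<close>

lemma Poincare_interval:
  fixes f f' :: "real \<Rightarrow> real"
  assumes lr: "l \<le> r" and D: "\<And>x. (f has_real_derivative f' x) (at x)" and c': "continuous_on UNIV f'"
  shows "(\<integral>\<^sup>+x. ennreal ((f x)\<^sup>2) * indicator {l..r} x \<partial>lborel)
     \<le> ennreal (2 * (r - l) * (f l)\<^sup>2) + ennreal (4 * (r - l)\<^sup>2) * (\<integral>\<^sup>+x. ennreal ((f' x)\<^sup>2) * indicator {l..r} x \<partial>lborel)"
proof -
  have c: "continuous_on UNIV f" using DERIV_isCont[OF D] by (simp add: continuous_at_imp_continuous_on)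
  have ind: "integrable lborel (\<lambda>x. g x * indicator {l..r} x)" if "continuous_on UNIV g" for g :: "real \<Rightarrow> real"
    using borel_integrable_compact[of "{l..r}" g] continuous_on_subset[OF that] by (simp add: mult.commute)
  define A B where "A = (LINT x|lborel. (f x)\<^sup>2 * indicator {l..r} x)" and "B = (LINT x|lborel. (f' x)\<^sup>2 * indicator {l..r} x)"
  have iA: "integrable lborel (\<lambda>x. (f x)\<^sup>2 * indicator {l..r} x)" by (intro ind continuous_intros c)
  have iB: "integrable lborel (\<lambda>x. (f' x)\<^sup>2 * indicator {l..r} x)" by (intro ind continuous_intros c')
  let ?w = "\<lambda>x. 2 * f x * f' x * (r - x) - (f x)\<^sup>2"
  have cw: "continuous_on UNIV ?w" by (intro continuous_intros c c')
  have FTC: "(LINT x|lborel. ?w x * indicator {l..r} x) = (f r)\<^sup>2 * (r - r) - (f l)\<^sup>2 * (r - l)"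
  proof (rule integral_FTC_Icc_real[OF lr])
    fix x
    show "((\<lambda>x. (f x)\<^sup>2 * (r - x)) has_real_derivative ?w x) (at x)"
      by (auto intro!: derivative_eq_intros D simp: algebra_simps)
    show "isCont ?w x" using cw by (simp add: continuous_on_eq_continuous_at)
  qed
  have "(LINT x|lborel. ?w x * indicator {l..r} x)
      \<le> (LINT x|lborel. - (1/2) * ((f x)\<^sup>2 * indicator {l..r} x) + 2 * (r - l)\<^sup>2 * ((f' x)\<^sup>2 * indicator {l..r} x))"
  proof (rule integral_mono)
    show "integrable lborel (\<lambda>x. ?w x * indicator {l..r} x)" by (rule ind[OF cw])
    show "integrable lborel (\<lambda>x. - (1/2) * ((f x)\<^sup>2 * indicator {l..r} x) + 2 * (r - l)\<^sup>2 * ((f' x)\<^sup>2 * indicator {l..r} x))"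
      using iA iB by (intro Bochner_Integration.integrable_add integrable_mult_right)
    fix x
    show "?w x * indicator {l..r} x \<le> - (1/2) * ((f x)\<^sup>2 * indicator {l..r} x) + 2 * (r - l)\<^sup>2 * ((f' x)\<^sup>2 * indicator {l..r} x)"
    proof (cases "x \<in> {l..r}")
      case True
      have "0 \<le> (f x - 2 * (r - x) * f' x)\<^sup>2" by simp
      then have "4 * f x * f' x * (r - x) \<le> (f x)\<^sup>2 + 4 * ((r - x)\<^sup>2 * (f' x)\<^sup>2)"
        by (simp add: power2_eq_square algebra_simps)
      moreover have "(r - x)\<^sup>2 * (f' x)\<^sup>2 \<le> (r - l)\<^sup>2 * (f' x)\<^sup>2"
        using True by (intro mult_right_mono power_mono) auto
      ultimately have "2 * f x * f' x * (r - x) \<le> (1/2) * (f x)\<^sup>2 + 2 * ((r - l)\<^sup>2 * (f' x)\<^sup>2)" by linarith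
      then show ?thesis using True by simp
    qed simp
  qed
  also have "\<dots> = - (1/2) * A + 2 * (r - l)\<^sup>2 * B"
    unfolding A_def B_def using iA iB by (subst Bochner_Integration.integral_add) auto
  finally have AB: "A \<le> 2 * (r - l) * (f l)\<^sup>2 + 4 * (r - l)\<^sup>2 * B"
    unfolding FTC by (simp add: algebra_simps)
  have nn: "(\<integral>\<^sup>+x. ennreal ((g x)\<^sup>2) * indicator {l..r} x \<partial>lborel) = ennreal (LINT x|lborel. (g x)\<^sup>2 * indicator {l..r} x)"
    if "integrable lborel (\<lambda>x. (g x)\<^sup>2 * indicator {l..r} x)" for g :: "real \<Rightarrow> real"
    by (subst nn_integral_eq_integral[OF that, symmetric]) (auto intro!: nn_integral_cong simp: ennreal_mult' indicator_def)
  have B0: "B \<ge> 0" unfolding B_def by simp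
  have "ennreal A \<le> ennreal (2 * (r - l) * (f l)\<^sup>2 + 4 * (r - l)\<^sup>2 * B)" using AB by (rule ennreal_leI)
  also have "\<dots> = ennreal (2 * (r - l) * (f l)\<^sup>2) + ennreal (4 * (r - l)\<^sup>2) * ennreal B"
    using lr B0 by (subst ennreal_plus) (auto simp: ennreal_mult)
  finally show ?thesis unfolding nn[OF iA] nn[OF iB] A_def B_def .
qed

text \<open>
  The identification of \<open>real^2\<close> with a product, along which Tonelli's theorem is applied.
\<close>

definition point2 :: "real \<Rightarrow> real \<Rightarrow> real^2" where "point2 s t = vector [s, t]"

lemma point2_nth [simp]: "point2 s t $ 1 = s" "point2 s t $ 2 = t"
  by (simp_all add: point2_def)

lemma point2_eq: "point2 s t = s *\<^sub>R axis 1 1 + t *\<^sub>R axis 2 1"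
  by (simp add: vec_eq_iff forall_2 axis_def)

lemma continuous_point2: "continuous_on UNIV (\<lambda>z. point2 (fst z) (snd z))"
  unfolding point2_eq by (intro continuous_intros)

lemma measurable_point2 [measurable]: "(\<lambda>z. point2 (fst z) (snd z)) \<in> borel_measurable (borel \<Otimes>\<^sub>M borel)"
  unfolding borel_prod by (rule borel_measurable_continuous_onI[OF continuous_point2])

lemma lborel_point2: "distr (lborel \<Otimes>\<^sub>M lborel) borel (\<lambda>z. point2 (fst z) (snd z)) = lborel"
proof (rule lborel_eqI[symmetric])
  fix l u :: "real^2"
  assume le: "\<And>b. b \<in> Basis \<Longrightarrow> l \<bullet> b \<le> u \<bullet> b"
  have le': "l $ i \<le> u $ i" for i
    using le[of "axis i 1"] by (simp add: inner_axis)
  have vim: "(\<lambda>z. point2 (fst z) (snd z)) -` box l u \<inter> space (lborel \<Otimes>\<^sub>M lborel) = {l$1<..<u$1} \<times> {l$2<..<u$2}"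
    by (auto simp: mem_box_cart forall_2 space_pair_measure)
  have "emeasure (distr (lborel \<Otimes>\<^sub>M lborel) borel (\<lambda>z. point2 (fst z) (snd z))) (box l u) =
      emeasure (lborel \<Otimes>\<^sub>M lborel) ({l$1<..<u$1} \<times> {l$2<..<u$2})"
    unfolding vim[symmetric] by (rule emeasure_distr) auto
  also have "\<dots> = ennreal ((u$1 - l$1) * (u$2 - l$2))"
    using le' by (subst lborel.emeasure_pair_measure_Times) (auto simp: ennreal_mult)
  also have "(u$1 - l$1) * (u$2 - l$2) = (\<Prod>b\<in>Basis. (u - l) \<bullet> b)"
  proof -
    have B: "(Basis :: (real^2) set) = (\<lambda>i. axis i 1) ` UNIV" by (auto simp: Basis_vec_def)
    have inj: "inj (\<lambda>i::2. axis i (1::real))" by (auto simp: inj_on_def axis_eq_axis)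
    show ?thesis unfolding B by (subst prod.reindex[OF inj]) (simp add: UNIV_2 inner_axis)
  qed
  finally show "emeasure (distr (lborel \<Otimes>\<^sub>M lborel) borel (\<lambda>z. point2 (fst z) (snd z))) (box l u) = (\<Prod>b\<in>Basis. (u - l) \<bullet> b)" .
qed simp

lemma nn_integral_point2:
  assumes [measurable]: "f \<in> borel_measurable borel"
  shows "(\<integral>\<^sup>+x. f x \<partial>lborel) = (\<integral>\<^sup>+t. \<integral>\<^sup>+s. f (point2 s t) \<partial>lborel \<partial>lborel)"
proof -
  have "(\<integral>\<^sup>+x. f x \<partial>lborel) = (\<integral>\<^sup>+z. f (point2 (fst z) (snd z)) \<partial>(lborel \<Otimes>\<^sub>M lborel))"
    by (subst lborel_point2[symmetric], subst nn_integral_distr) auto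
  also have "\<dots> = (\<integral>\<^sup>+t. \<integral>\<^sup>+s. f (point2 s t) \<partial>lborel \<partial>lborel)"
    by (subst lborel_pair.nn_integral_snd[symmetric]) auto
  finally show ?thesis .
qed

lemma nn_integral_lebesgue_on_box:
  fixes f :: "'a::euclidean_space \<Rightarrow> ennreal"
  assumes [measurable]: "f \<in> borel_measurable borel"
  shows "(\<integral>\<^sup>+x. f x \<partial>lebesgue_on (box l r)) = (\<integral>\<^sup>+x. f x * indicator (cbox l r) x \<partial>lborel)"
proof -
  have "(\<integral>\<^sup>+x. f x \<partial>lebesgue_on (box l r)) = (\<integral>\<^sup>+x. f x * indicator (box l r) x \<partial>lebesgue)"
    by (rule nn_integral_restrict_space) auto
  also have "\<dots> = (\<integral>\<^sup>+x. f x * indicator (box l r) x \<partial>lborel)" by (rule nn_integral_completion)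
  also have "\<dots> = (\<integral>\<^sup>+x. f x * indicator (cbox l r) x \<partial>lborel)"
  proof (rule nn_integral_cong_AE)
    have "AE x in lebesgue. x \<notin> cbox l r - box l r"
      using negligible_frontier_interval[of l r] by (intro AE_not_in) (simp add: negligible_iff_null_sets)
    then have "AE x in lborel. x \<notin> cbox l r - box l r" by (simp add: AE_completion_iff)
    then show "AE x in lborel. f x * indicator (box l r) x = f x * indicator (cbox l r) x"
      by eventually_elim (use box_subset_cbox[of l r] in \<open>auto simp: indicator_def\<close>)
  qed
  finally show ?thesis .
qed

text \<open>
  The one-dimensional inequality on every horizontal line, integrated over the height. The segment
  is the left side of the rectangle.
\<close>

lemma Poincare_smooth:
  fixes l r :: "real^2" and \<phi> :: "real^2 \<Rightarrow> real"
  assumes lr: "l$1 \<le> r$1" "l$2 < r$2" and \<phi>: "smooth \<phi>"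
  defines "L \<equiv> r$1 - l$1"
  shows "(LINT x|lebesgue_on (box l r). (norm (\<phi> x))\<^sup>2)
     \<le> 2 * L * (r$2 - l$2) * (LINT t|lebesgue_on {0..1}. (norm (\<phi> (linepath (point2 (l$1) (l$2)) (point2 (l$1) (r$2)) t)))\<^sup>2)
       + 4 * L\<^sup>2 * (LINT x|lebesgue_on (box l r). (norm (classical_gradient \<phi> x))\<^sup>2)"
proof -
  let ?d = "\<lambda>x. frechet_derivative \<phi> (at x) (axis 1 1)"
  have ax: "axis 1 1 \<in> (Basis :: (real^2) set)" by simp
  have L: "L \<ge> 0" using lr by (simp add: L_def)
  have cd: "continuous_on UNIV ?d" by (rule smooth_derivative_continuous[OF \<phi> ax])
  have [measurable]: "\<phi> \<in> borel_measurable borel" using smooth_continuous[OF \<phi>] by (rule borel_measurable_continuous_onI)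
  have [measurable]: "?d \<in> borel_measurable borel" using cd by (rule borel_measurable_continuous_onI)
  have [measurable]: "classical_gradient \<phi> \<in> borel_measurable borel"
    using continuous_classical_gradient[OF \<phi>] by (rule borel_measurable_continuous_onI)
  have pm[measurable]: "(\<lambda>s. point2 s t) \<in> borel_measurable borel" "(\<lambda>t. point2 s t) \<in> borel_measurable borel" for s t
    unfolding point2_eq by (auto intro!: borel_measurable_continuous_onI continuous_intros)
  have ind: "indicator (cbox l r) (point2 s t) = (indicator {l$1..r$1} s * indicator {l$2..r$2} t :: ennreal)" for s t
    by (auto simp: indicator_def mem_box_cart forall_2)
  have Dx: "((\<lambda>s. \<phi> (point2 s t)) has_real_derivative ?d (point2 s t)) (at s)" for s t
  proof -
    have "((\<lambda>s. point2 s t) has_derivative (\<lambda>h. h *\<^sub>R axis 1 1)) (at s)"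
      unfolding point2_eq by (auto intro!: derivative_eq_intros)
    from has_derivative_compose[OF this smooth_has_derivative[OF \<phi>]]
    have "((\<lambda>s. \<phi> (point2 s t)) has_derivative (\<lambda>h. frechet_derivative \<phi> (at (point2 s t)) (h *\<^sub>R axis 1 1))) (at s)" .
    moreover have "frechet_derivative \<phi> (at x) (h *\<^sub>R axis 1 1) = ?d x * h" for x h
      using linear_cmul[OF has_derivative_linear[OF smooth_has_derivative[OF \<phi>]]] by simp
    ultimately show ?thesis unfolding has_field_derivative_def by simp
  qed
  have row: "(\<integral>\<^sup>+s. ennreal ((\<phi> (point2 s t))\<^sup>2) * indicator {l$1..r$1} s \<partial>lborel)
     \<le> ennreal (2 * L * (\<phi> (point2 (l$1) t))\<^sup>2) + ennreal (4 * L\<^sup>2) * (\<integral>\<^sup>+s. ennreal ((?d (point2 s t))\<^sup>2) * indicator {l$1..r$1} s \<partial>lborel)" for t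
    unfolding L_def
  proof (rule Poincare_interval[OF lr(1) Dx])
    have "continuous_on UNIV (\<lambda>s. point2 s t)" unfolding point2_eq by (intro continuous_intros)
    then show "continuous_on UNIV (\<lambda>s. ?d (point2 s t))" by (rule continuous_on_compose2[OF cd]) auto
  qed
  have "(\<integral>\<^sup>+x. ennreal ((\<phi> x)\<^sup>2) \<partial>lebesgue_on (box l r)) = (\<integral>\<^sup>+x. ennreal ((\<phi> x)\<^sup>2) * indicator (cbox l r) x \<partial>lborel)"
    by (rule nn_integral_lebesgue_on_box) simp
  also have "\<dots> = (\<integral>\<^sup>+t. \<integral>\<^sup>+s. ennreal ((\<phi> (point2 s t))\<^sup>2) * indicator (cbox l r) (point2 s t) \<partial>lborel \<partial>lborel)"
    by (rule nn_integral_point2) simp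
  also have "\<dots> = (\<integral>\<^sup>+t. (\<integral>\<^sup>+s. ennreal ((\<phi> (point2 s t))\<^sup>2) * indicator {l$1..r$1} s \<partial>lborel) * indicator {l$2..r$2} t \<partial>lborel)"
    unfolding ind mult.assoc[symmetric] by (intro nn_integral_cong nn_integral_multc) simp
  also have "\<dots> \<le> (\<integral>\<^sup>+t. (ennreal (2 * L * (\<phi> (point2 (l$1) t))\<^sup>2) + ennreal (4 * L\<^sup>2) * (\<integral>\<^sup>+s. ennreal ((?d (point2 s t))\<^sup>2) * indicator {l$1..r$1} s \<partial>lborel)) * indicator {l$2..r$2} t \<partial>lborel)"
    by (intro nn_integral_mono mult_right_mono row) auto
  also have "\<dots> = (\<integral>\<^sup>+t. ennreal (2 * L) * (ennreal ((\<phi> (point2 (l$1) t))\<^sup>2) * indicator {l$2..r$2} t) + 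
      ennreal (4 * L\<^sup>2) * (\<integral>\<^sup>+s. ennreal ((?d (point2 s t))\<^sup>2) * indicator (cbox l r) (point2 s t) \<partial>lborel) \<partial>lborel)"
  proof (rule nn_integral_cong)
    fix t
    have "(\<integral>\<^sup>+s. ennreal ((?d (point2 s t))\<^sup>2) * indicator (cbox l r) (point2 s t) \<partial>lborel) =
       (\<integral>\<^sup>+s. ennreal ((?d (point2 s t))\<^sup>2) * indicator {l$1..r$1} s \<partial>lborel) * indicator {l$2..r$2} t"
      unfolding ind mult.assoc[symmetric] by (intro nn_integral_multc) simp
    then show "(ennreal (2 * L * (\<phi> (point2 (l$1) t))\<^sup>2) + ennreal (4 * L\<^sup>2) * (\<integral>\<^sup>+s. ennreal ((?d (point2 s t))\<^sup>2) * indicator {l$1..r$1} s \<partial>lborel)) * indicator {l$2..r$2} t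
       = ennreal (2 * L) * (ennreal ((\<phi> (point2 (l$1) t))\<^sup>2) * indicator {l$2..r$2} t) + 
      ennreal (4 * L\<^sup>2) * (\<integral>\<^sup>+s. ennreal ((?d (point2 s t))\<^sup>2) * indicator (cbox l r) (point2 s t) \<partial>lborel)"
      using L by (simp add: ennreal_mult distrib_right mult.assoc)
  qed
  also have "\<dots> = ennreal (2 * L) * (\<integral>\<^sup>+t. ennreal ((\<phi> (point2 (l$1) t))\<^sup>2) * indicator {l$2..r$2} t \<partial>lborel)
      + ennreal (4 * L\<^sup>2) * (\<integral>\<^sup>+t. \<integral>\<^sup>+s. ennreal ((?d (point2 s t))\<^sup>2) * indicator (cbox l r) (point2 s t) \<partial>lborel \<partial>lborel)"
  proof -
    have [measurable]: "(\<lambda>z. ennreal ((?d (point2 (snd z) (fst z)))\<^sup>2) * indicator (cbox l r) (point2 (snd z) (fst z))) \<in> borel_measurable (lborel \<Otimes>\<^sub>M lborel)"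
    proof -
      have [measurable]: "(\<lambda>z. point2 (snd z) (fst z)) \<in> borel_measurable (lborel \<Otimes>\<^sub>M lborel)"
        using measurable_compose[OF measurable_pair_swap' measurable_point2] by (simp add: case_prod_beta)
      show ?thesis by measurable
    qed
    have m2: "(\<lambda>t. \<integral>\<^sup>+s. ennreal ((?d (point2 s t))\<^sup>2) * indicator (cbox l r) (point2 s t) \<partial>lborel) \<in> borel_measurable lborel"
      by (rule lborel.borel_measurable_nn_integral) (simp add: case_prod_beta)
    show ?thesis
      by (subst nn_integral_add) (use m2 in \<open>auto simp: nn_integral_cmult\<close>)
  qed
  also have "(\<integral>\<^sup>+t. \<integral>\<^sup>+s. ennreal ((?d (point2 s t))\<^sup>2) * indicator (cbox l r) (point2 s t) \<partial>lborel \<partial>lborel)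
      = (\<integral>\<^sup>+x. ennreal ((?d x)\<^sup>2) * indicator (cbox l r) x \<partial>lborel)"
    by (rule nn_integral_point2[symmetric]) simp
  also have "\<dots> = (\<integral>\<^sup>+x. ennreal ((?d x)\<^sup>2) \<partial>lebesgue_on (box l r))"
    by (rule nn_integral_lebesgue_on_box[symmetric]) simp
  also have "(\<integral>\<^sup>+t. ennreal ((\<phi> (point2 (l$1) t))\<^sup>2) * indicator {l$2..r$2} t \<partial>lborel)
      = ennreal (r$2 - l$2) * (\<integral>\<^sup>+t. ennreal ((\<phi> (linepath (point2 (l$1) (l$2)) (point2 (l$1) (r$2)) t))\<^sup>2) \<partial>lebesgue_on {0..1})"
  proof -
    have lp: "linepath (point2 (l$1) (l$2)) (point2 (l$1) (r$2)) t = point2 (l$1) (l$2 + (r$2 - l$2) * t)" for t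
      by (simp add: linepath_def vec_eq_iff forall_2 algebra_simps)
    have in01: "indicator {l$2..r$2} (l$2 + (r$2 - l$2) * t) = (indicator {0..1} t :: ennreal)" for t
    proof -
      have "l$2 + (r$2 - l$2) * t \<le> r$2 \<longleftrightarrow> (r$2 - l$2) * t \<le> (r$2 - l$2) * 1"
        by (auto simp: algebra_simps)
      also have "\<dots> \<longleftrightarrow> t \<le> 1" using lr(2) by (subst mult_le_cancel_left_pos) auto
      finally show ?thesis using lr(2) by (auto simp: indicator_def zero_le_mult_iff)
    qed
    have "(\<integral>\<^sup>+t. ennreal ((\<phi> (point2 (l$1) t))\<^sup>2) * indicator {l$2..r$2} t \<partial>lborel)
        = ennreal \<bar>r$2 - l$2\<bar> * (\<integral>\<^sup>+t. ennreal ((\<phi> (point2 (l$1) (l$2 + (r$2 - l$2) * t)))\<^sup>2) * indicator {l$2..r$2} (l$2 + (r$2 - l$2) * t) \<partial>lborel)"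
      using lr(2) by (intro nn_integral_real_affine) auto
    also have "\<dots> = ennreal (r$2 - l$2) * (\<integral>\<^sup>+t. ennreal ((\<phi> (linepath (point2 (l$1) (l$2)) (point2 (l$1) (r$2)) t))\<^sup>2) * indicator {0..1} t \<partial>lebesgue)"
      unfolding in01 lp nn_integral_completion using lr(2) by simp
    also have "\<dots> = ennreal (r$2 - l$2) * (\<integral>\<^sup>+t. ennreal ((\<phi> (linepath (point2 (l$1) (l$2)) (point2 (l$1) (r$2)) t))\<^sup>2) \<partial>lebesgue_on {0..1})"
      by (subst nn_integral_restrict_space) auto
    finally show ?thesis .
  qed
  also have "(\<integral>\<^sup>+x. ennreal ((?d x)\<^sup>2) \<partial>lebesgue_on (box l r)) \<le> (\<integral>\<^sup>+x. ennreal ((norm (classical_gradient \<phi> x))\<^sup>2) \<partial>lebesgue_on (box l r))"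
  proof (intro nn_integral_mono ennreal_leI)
    fix x
    have "\<bar>?d x\<bar> \<le> norm (classical_gradient \<phi> x)"
      unfolding classical_gradient_inner_Basis[OF ax, symmetric] by (rule Basis_le_norm[OF ax])
    then show "(?d x)\<^sup>2 \<le> (norm (classical_gradient \<phi> x))\<^sup>2" by (metis abs_ge_zero power2_abs power_mono)
  qed
  finally have nn: "(\<integral>\<^sup>+x. ennreal ((\<phi> x)\<^sup>2) \<partial>lebesgue_on (box l r)) \<le>
      ennreal (2 * L) * (ennreal (r$2 - l$2) * (\<integral>\<^sup>+t. ennreal ((\<phi> (linepath (point2 (l$1) (l$2)) (point2 (l$1) (r$2)) t))\<^sup>2) \<partial>lebesgue_on {0..1}))
      + ennreal (4 * L\<^sup>2) * (\<integral>\<^sup>+x. ennreal ((norm (classical_gradient \<phi> x))\<^sup>2) \<partial>lebesgue_on (box l r))"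
    by (simp add: add_left_mono mult_left_mono)
  have s1: "square_integrable (box l r) \<phi>" by (intro square_integrable_continuous smooth_continuous \<phi>) auto
  have s2: "square_integrable (box l r) (classical_gradient \<phi>)" by (intro square_integrable_continuous continuous_classical_gradient \<phi>) auto
  note s3 = square_integrable_segment[OF \<phi>, of "point2 (l$1) (l$2)" "point2 (l$1) (r$2)"]
  define I1 I2 I3 where "I1 = (LINT x|lebesgue_on (box l r). (norm (\<phi> x))\<^sup>2)"
    and "I2 = (LINT t|lebesgue_on {0..1}. (norm (\<phi> (linepath (point2 (l$1) (l$2)) (point2 (l$1) (r$2)) t)))\<^sup>2)"
    and "I3 = (LINT x|lebesgue_on (box l r). (norm (classical_gradient \<phi> x))\<^sup>2)"
  have pos: "I2 \<ge> 0" "I3 \<ge> 0" unfolding I2_def I3_def by auto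
  have "ennreal I1 \<le> ennreal (2 * L) * (ennreal (r$2 - l$2) * ennreal I2) + ennreal (4 * L\<^sup>2) * ennreal I3"
    using nn nn_integral_eq_integral[OF square_integrableD(2)[OF s1]] nn_integral_eq_integral[OF square_integrableD(2)[OF s2]]
      nn_integral_eq_integral[OF square_integrableD(2)[OF s3]]
    unfolding I1_def I2_def I3_def by simp
  also have "\<dots> = ennreal (2 * L * (r$2 - l$2) * I2 + 4 * L\<^sup>2 * I3)"
    using L lr(2) pos by (simp add: ennreal_mult[symmetric] ennreal_plus[symmetric] mult.assoc del: ennreal_plus)
  finally have "I1 \<le> 2 * L * (r$2 - l$2) * I2 + 4 * L\<^sup>2 * I3"
    using L lr(2) pos by (subst (asm) ennreal_le_iff) auto
  then show ?thesis unfolding I1_def I2_def I3_def .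
qed

section \<open>Hilbert spaces for the Dirichlet problem\<close>

text \<open>
  Transfers completeness from the \<open>H\<^sup>1\<close> norm to the energy norm on functions with zero trace, and to
  the norm of the harmonic part.
\<close>

lemma (in semi_Hilbert_space) equivalent_inner_product:
  assumes q: "semi_inner_space X q"
    and le: "\<And>u. u \<in> X \<Longrightarrow> ip u u \<le> C * q u u" "\<And>u. u \<in> X \<Longrightarrow> q u u \<le> K * ip u u"
    and nn: "C \<ge> 0" "K \<ge> 0"
  shows "semi_Hilbert_space X q"
proof -
  interpret Q: semi_inner_space X q by fact
  have nle: "nrm u \<le> sqrt C * Q.nrm u" "Q.nrm u \<le> sqrt K * nrm u" if "u \<in> X" for u
    unfolding nrm_def Q.nrm_def real_sqrt_mult[symmetric] using le[OF that] by simp_all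
  show ?thesis
  proof
    fix u :: "nat \<Rightarrow> 'a \<Rightarrow> real" assume u: "\<And>k. u k \<in> X" and QC: "Q.Cauchy_seq u"
    have "Cauchy_seq u" unfolding Cauchy_seq_def
    proof (intro allI impI)
      fix d :: real assume d: "d > 0"
      have pos: "sqrt C + 1 > 0" using nn by (simp add: add_nonneg_pos)
      then have "d / (sqrt C + 1) > 0" using d by simp
      then obtain N where N: "\<And>k m. k \<ge> N \<Longrightarrow> m \<ge> N \<Longrightarrow> Q.nrm (\<lambda>x. u k x - u m x) < d / (sqrt C + 1)"
        using QC unfolding Q.Cauchy_seq_def by blast
      have "nrm (\<lambda>x. u k x - u m x) < d" if "k \<ge> N" "m \<ge> N" for k m
      proof -
        have "nrm (\<lambda>x. u k x - u m x) \<le> sqrt C * Q.nrm (\<lambda>x. u k x - u m x)" by (rule nle(1)[OF diff_in[OF u u]])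
        also have "\<dots> \<le> (sqrt C + 1) * Q.nrm (\<lambda>x. u k x - u m x)"
          using Q.nrm_nonneg[OF diff_in[OF u u]] by (intro mult_right_mono) auto
        also have "\<dots> < (sqrt C + 1) * (d / (sqrt C + 1))" using N[OF that] pos by (intro mult_strict_left_mono)
        also have "\<dots> = d" using pos by simp
        finally show ?thesis .
      qed
      then show "\<exists>N. \<forall>k\<ge>N. \<forall>m\<ge>N. nrm (\<lambda>x. u k x - u m x) < d" by blast
    qed
    from complete[OF u this] obtain w where w: "w \<in> X" "(\<lambda>k. nrm (\<lambda>x. u k x - w x)) \<longlonglongrightarrow> 0" by blast
    have "(\<lambda>k. Q.nrm (\<lambda>x. u k x - w x)) \<longlonglongrightarrow> 0"
    proof (rule Lim_null_comparison)
      show "\<forall>\<^sub>F k in sequentially. norm (Q.nrm (\<lambda>x. u k x - w x)) \<le> sqrt K * nrm (\<lambda>x. u k x - w x)"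
        using nle(2)[OF diff_in[OF u w(1)]] Q.nrm_nonneg[OF diff_in[OF u w(1)]] by (intro always_eventually) simp
      show "(\<lambda>k. sqrt K * nrm (\<lambda>x. u k x - w x)) \<longlonglongrightarrow> 0" by (rule tendsto_mult_right_zero[OF w(2)])
    qed
    then show "\<exists>w\<in>X. (\<lambda>k. Q.nrm (\<lambda>x. u k x - w x)) \<longlonglongrightarrow> 0" using w(1) by blast
  qed
qed

lemma trace_on_lin:
  assumes D: "bounded D" and u: "u \<in> H1 (interior D)" and v: "v \<in> H1 (interior D)"
    and tu: "trace_on D \<Gamma> u g" and tv: "trace_on D \<Gamma> v h"
  shows "trace_on D \<Gamma> (\<lambda>x. u x + c * v x) (\<lambda>x. g x + c * h x)"
  unfolding trace_on_def
proof (intro allI impI)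
  fix p q :: "real^2" assume pq: "p \<noteq> q" "closed_segment p q \<subseteq> \<Gamma>"
  show "trace_on_segment (interior D) p q (\<lambda>x. u x + c * v x) (\<lambda>x. g x + c * h x)"
    using tu tv pq unfolding trace_on_def
    by (intro trace_on_segment_lin[OF open_interior bounded_interior[OF D] u v]) auto
qed

lemma trace_on_closed:
  assumes D: "bounded D" and u: "\<And>m::nat. u m \<in> H1 (interior D)" and w: "w \<in> H1 (interior D)"
    and lim: "(\<lambda>m. H1_norm (interior D) (\<lambda>x. u m x - w x)) \<longlonglongrightarrow> 0"
    and tr: "\<And>m. trace_on D \<Gamma> (u m) g"
  shows "trace_on D \<Gamma> w g"
  unfolding trace_on_def
proof (intro allI impI)
  fix p q :: "real^2" assume pq: "p \<noteq> q" "closed_segment p q \<subseteq> \<Gamma>"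
  show "trace_on_segment (interior D) p q w g"
    using tr pq unfolding trace_on_def
    by (intro trace_on_segment_closed[OF open_interior bounded_interior[OF D] u w lim]) auto
qed

lemma trace_on_mono: "trace_on D \<Gamma> u g \<Longrightarrow> \<Gamma>' \<subseteq> \<Gamma> \<Longrightarrow> trace_on D \<Gamma>' u g"
  unfolding trace_on_def by blast

text \<open>A smooth function is approximated by the constant sequence.\<close>

lemma trace_on_segment_smooth:
  assumes U: "open U" "bounded U" and \<phi>: "smooth \<phi>" and g: "\<And>x. x \<in> closed_segment p q \<Longrightarrow> \<phi> x = g x"
  shows "trace_on_segment U p q \<phi> g"
proof -
  have eq: "\<phi> (linepath p q t) = g (linepath p q t)" if "t \<in> {0..1}" for t
    using g[of "linepath p q t"] that linepath_in_path[of t p q] by simp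
  have sq: "square_integrable {0..1} (seg_fun p q g)"
  proof -
    have "square_integrable {0..1} (seg_fun p q \<phi>)" by (rule square_integrable_segment[OF \<phi>])
    moreover have "square_integrable {0..1} (seg_fun p q \<phi>) \<longleftrightarrow> square_integrable {0..1} (seg_fun p q g)"
      unfolding square_integrable_def using eq
      by (intro arg_cong2[where f = "(\<and>)"] measurable_cong Bochner_Integration.integrable_cong) (auto simp: space_restrict_space)
    ultimately show ?thesis by blast
  qed
  interpret H1: semi_inner_space "H1 U" "H1_inner U" by (rule H1_semi_inner_space[OF U])
  have "H1_norm U (\<lambda>x. \<phi> x - \<phi> x) = 0" using H1.ip_zero[OF H1_zero] by (simp add: H1_norm_eq)
  moreover have "(LINT t|lebesgue_on {0..1}. (\<phi> (linepath p q t) - g (linepath p q t))\<^sup>2) = (LINT t|lebesgue_on {0..1::real}. 0)"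
    by (intro Bochner_Integration.integral_cong) (auto simp: space_restrict_space eq)
  ultimately show ?thesis unfolding trace_on_segment_def
    using sq \<phi> by (intro conjI exI[of _ "\<lambda>_. \<phi>"]) simp_all
qed

lemma trace_on_zero: "bounded D \<Longrightarrow> trace_on D \<Gamma> (\<lambda>_. 0) (\<lambda>_. 0)"
  unfolding trace_on_def by (intro allI impI trace_on_segment_smooth) (auto simp: smooth_const bounded_interior)

lemma test_function_H10:
  assumes D: "bounded D" and \<phi>: "test_function (interior D) \<phi>"
  shows "\<phi> \<in> H10 D"
proof -
  note tf = test_function_props[OF \<phi>]
  have "trace_on D (frontier D) \<phi> (\<lambda>_. 0)"
    unfolding trace_on_def
    by (intro allI impI trace_on_segment_smooth open_interior bounded_interior D tf(1) tf(2))
      (auto simp: frontier_def)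
  then show ?thesis unfolding H10_def
    using smooth_H1(1)[OF open_interior bounded_interior[OF D] tf(1)] by blast
qed

lemma H10_zero: "bounded D \<Longrightarrow> (\<lambda>_. 0) \<in> H10 D"
  unfolding H10_def using H1_zero trace_on_zero by blast

lemma H10_lin:
  assumes D: "bounded D" and uv: "u \<in> H10 D" "v \<in> H10 D"
  shows "(\<lambda>x. u x + c * v x) \<in> H10 D"
  using uv trace_on_lin[OF D, of u v "frontier D" "\<lambda>_. 0" "\<lambda>_. 0" c] H1_lin(1)[OF open_interior bounded_interior[OF D]]
  unfolding H10_def by auto

lemma H10_closed:
  assumes D: "bounded D" and u: "\<And>k::nat. u k \<in> H10 D" and w: "w \<in> H1 (interior D)"
    and lim: "(\<lambda>k. H1_norm (interior D) (\<lambda>x. u k x - w x)) \<longlonglongrightarrow> 0"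
  shows "w \<in> H10 D"
proof -
  have "u k \<in> H1 (interior D)" "trace_on D (frontier D) (u k) (\<lambda>_. 0)" for k using u unfolding H10_def by auto
  from trace_on_closed[OF D this(1) w lim this(2)] w show ?thesis unfolding H10_def by blast
qed

text \<open>
  The inequality for smooth functions passes to the limit along a sequence that witnesses the zero
  trace on the left side, where the boundary term tends to zero.
\<close>

lemma H10_Poincare:
  fixes l r :: "real^2"
  assumes lr: "l$1 < r$1" "l$2 < r$2" and u: "u \<in> H10 (cbox l r)"
  shows "L2_inner (box l r) u u \<le> 4 * (r$1 - l$1)\<^sup>2 * grad_inner (box l r) u u"
proof -
  let ?U = "box l r" and ?p = "point2 (l$1) (l$2)" and ?q = "point2 (l$1) (r$2)"
  have U: "open ?U" "bounded ?U" by auto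
  interpret H1: semi_inner_space "H1 ?U" "H1_inner ?U" by (rule H1_semi_inner_space[OF U])
  interpret L: semi_inner_space "H1 ?U" "L2_inner ?U" by (rule L2_semi_inner_space_H1[OF U])
  interpret G: semi_inner_space "H1 ?U" "grad_inner ?U" by (rule grad_semi_inner_space[OF U])
  have uH: "u \<in> H1 ?U" and tr: "trace_on (cbox l r) (frontier (cbox l r)) u (\<lambda>_. 0)"
    using u unfolding H10_def by (auto simp: interior_cbox)
  have pq: "?p \<noteq> ?q" using lr by (auto simp: vec_eq_iff forall_2)
  have "closed_segment ?p ?q \<subseteq> frontier (cbox l r)"
  proof
    fix x assume "x \<in> closed_segment ?p ?q"
    then obtain t where t: "0 \<le> t" "t \<le> 1" and x: "x = (1 - t) *\<^sub>R ?p + t *\<^sub>R ?q"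
      unfolding closed_segment_def by blast
    have 1: "x $ 1 = l $ 1" unfolding x by (simp add: algebra_simps)
    have x2: "x $ 2 = l $ 2 + t * (r $ 2 - l $ 2)" unfolding x by (simp add: algebra_simps)
    have "t * (r $ 2 - l $ 2) \<le> r $ 2 - l $ 2" using t lr by (intro mult_left_le_one_le) auto
    then have "x $ 2 \<le> r $ 2" unfolding x2 by linarith
    moreover have "l $ 2 \<le> x $ 2" unfolding x2 using t lr by simp
    ultimately have "l $ 2 \<le> x $ 2" "x $ 2 \<le> r $ 2" by auto
    then show "x \<in> frontier (cbox l r)"
      unfolding frontier_cbox using 1 lr by (auto simp: mem_box_cart forall_2)
  qed
  then have "trace_on_segment ?U ?p ?q u (\<lambda>_. 0)"
    using tr pq unfolding trace_on_def interior_cbox by blast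
  then obtain \<phi> where "trace_approximation ?U ?p ?q u (\<lambda>_. 0) \<phi>" unfolding trace_on_segment_iff ..
  note \<phi> = trace_approximationD(2)[OF this] and \<phi>u = trace_approximationD(3)[OF this]
    and \<phi>0 = trace_approximationD(4)[OF this]
  note \<phi>H = smooth_H1(1)[OF U \<phi>]
  have nle: "L.nrm v \<le> H1_norm ?U v" "G.nrm v \<le> H1_norm ?U v" if "v \<in> H1 ?U" for v
    unfolding L.nrm_def G.nrm_def H1_norm_eq H1_inner_def using L.ip_nonneg[OF that] G.ip_nonneg[OF that] by auto
  have "(\<lambda>k. L.nrm (\<lambda>x. \<phi> k x - u x)) \<longlonglongrightarrow> 0"
  proof (rule Lim_null_comparison[OF _ \<phi>u])
    show "\<forall>\<^sub>F k in sequentially. norm (L.nrm (\<lambda>x. \<phi> k x - u x)) \<le> H1_norm ?U (\<lambda>x. \<phi> k x - u x)"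
      using nle(1)[OF L.diff_in[OF \<phi>H uH]] L.nrm_nonneg[OF L.diff_in[OF \<phi>H uH]] by (intro always_eventually) simp
  qed
  from L.nrm_tendsto[OF \<phi>H uH this] have "(\<lambda>k. (L.nrm (\<phi> k))\<^sup>2) \<longlonglongrightarrow> (L.nrm u)\<^sup>2" by (rule tendsto_power)
  then have limL: "(\<lambda>k. L2_inner ?U (\<phi> k) (\<phi> k)) \<longlonglongrightarrow> L2_inner ?U u u" by (simp only: L.nrm_sq[OF \<phi>H] L.nrm_sq[OF uH])
  have "(\<lambda>k. G.nrm (\<lambda>x. \<phi> k x - u x)) \<longlonglongrightarrow> 0"
  proof (rule Lim_null_comparison[OF _ \<phi>u])
    show "\<forall>\<^sub>F k in sequentially. norm (G.nrm (\<lambda>x. \<phi> k x - u x)) \<le> H1_norm ?U (\<lambda>x. \<phi> k x - u x)"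
      using nle(2)[OF L.diff_in[OF \<phi>H uH]] G.nrm_nonneg[OF L.diff_in[OF \<phi>H uH]] by (intro always_eventually) simp
  qed
  from G.nrm_tendsto[OF \<phi>H uH this] have "(\<lambda>k. (G.nrm (\<phi> k))\<^sup>2) \<longlonglongrightarrow> (G.nrm u)\<^sup>2" by (rule tendsto_power)
  then have limG: "(\<lambda>k. grad_inner ?U (\<phi> k) (\<phi> k)) \<longlonglongrightarrow> grad_inner ?U u u"
    by (simp only: G.nrm_sq[OF \<phi>H] G.nrm_sq[OF uH])
  define e where "e k = (LINT t|lebesgue_on {0..1}. (norm (\<phi> k (linepath ?p ?q t)))\<^sup>2)" for k
  have "(\<lambda>k. (unit_L2_norm (seg_fun ?p ?q (\<phi> k)))\<^sup>2) \<longlonglongrightarrow> 0\<^sup>2"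
    using \<phi>0 by (intro tendsto_power) simp
  moreover have "(unit_L2_norm (seg_fun ?p ?q (\<phi> k)))\<^sup>2 = e k" for k
    using unit_L2.nrm_sq[of "seg_fun ?p ?q (\<phi> k)"] square_integrable_segment[OF \<phi>] unfolding e_def L2_inner_self by simp
  ultimately have lime: "e \<longlonglongrightarrow> 0" by simp
  let ?C = "2 * (r$1 - l$1) * (r$2 - l$2)" and ?K = "4 * (r$1 - l$1)\<^sup>2"
  have "L2_inner ?U (\<phi> k) (\<phi> k) \<le> ?C * e k + ?K * grad_inner ?U (\<phi> k) (\<phi> k)" for k
  proof -
    have "(LINT x|lebesgue_on ?U. (norm (classical_gradient (\<phi> k) x))\<^sup>2) = grad_inner ?U (\<phi> k) (\<phi> k)"
      unfolding weighted_grad_inner_1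
    proof (rule integral_cong_AE)
      show "(\<lambda>x. (norm (grad ?U (\<phi> k) x))\<^sup>2) \<in> borel_measurable (lebesgue_on ?U)"
        by (rule borel_measurable_integrable[OF square_integrableD(2)[OF grad_H1(2)[OF \<phi>H]]])
      show "(\<lambda>x. (norm (classical_gradient (\<phi> k) x))\<^sup>2) \<in> borel_measurable (lebesgue_on ?U)"
        by (rule borel_measurable_integrable[OF square_integrableD(2)[OF square_integrable_continuous[OF continuous_classical_gradient[OF \<phi>]]]]) auto
      show "AE x in lebesgue_on ?U. (norm (classical_gradient (\<phi> k) x))\<^sup>2 = (norm (grad ?U (\<phi> k) x))\<^sup>2"
        using smooth_H1(2)[OF U \<phi>[of k]] by eventually_elim simp
    qed
    then show ?thesis
      using Poincare_smooth[OF less_imp_le[OF lr(1)] lr(2) \<phi>[of k]] unfolding L2_inner_self e_def by simp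
  qed
  moreover have "(\<lambda>k. ?C * e k + ?K * grad_inner ?U (\<phi> k) (\<phi> k)) \<longlonglongrightarrow> ?C * 0 + ?K * grad_inner ?U u u"
    by (intro tendsto_add tendsto_mult tendsto_const lime limG)
  ultimately show ?thesis using LIMSEQ_le[OF limL] by auto
qed

lemma (in semi_inner_space) ip_diff_tendsto_0:
  assumes "\<And>k. u k \<in> X" "w \<in> X" "(\<lambda>k. nrm (\<lambda>x. u k x - w x)) \<longlonglongrightarrow> 0"
  shows "(\<lambda>k. ip (\<lambda>x. u k x - w x) (\<lambda>x. u k x - w x)) \<longlonglongrightarrow> 0"
  using ip_tendsto_0_iff[of "\<lambda>k x. u k x - w x"] diff_in[OF assms(1,2)] assms(3) by blast

text \<open>
  A rectangle with a coefficient that is bounded above and away from zero on it. It will be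
  instantiated with the oversampling region and with the coarse elements.
\<close>

locale elliptic_box =
  fixes l r :: "real^2" and a :: "real^2 \<Rightarrow> real" and lmin lmax :: real
  assumes lr: "l$1 < r$1" "l$2 < r$2"
    and a_meas: "a \<in> borel_measurable (lebesgue_on (box l r))"
    and lmin: "0 < lmin"
    and a_bounds: "AE x in lebesgue_on (box l r). lmin \<le> a x \<and> a x \<le> lmax"
begin

abbreviation "D \<equiv> cbox l r"
abbreviation "U \<equiv> box l r"
abbreviation "energy \<equiv> energy_form a D"

lemma bounded_D: "bounded D" by simp
lemma open_U: "open U" and bounded_U: "bounded U" by auto

lemma energy_eq: "energy = weighted_grad_inner a U"
  by (simp add: energy_form_def weighted_grad_inner_def fun_eq_iff interior_cbox)

lemma a_nonneg: "AE x in lebesgue_on U. 0 \<le> a x \<and> a x \<le> lmax"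
  using a_bounds by eventually_elim (use lmin in auto)

lemma a_abs: "AE x in lebesgue_on U. \<bar>a x\<bar> \<le> lmax"
  using a_nonneg by eventually_elim auto

lemma unit_weight: "(\<lambda>_. 1::real) \<in> borel_measurable (lebesgue_on U)" "AE x in lebesgue_on U. \<bar>1::real\<bar> \<le> 1"
  by auto

sublocale H1: semi_Hilbert_space "H1 U" "H1_inner U" by (rule H1_complete[OF open_U bounded_U])
sublocale L: semi_inner_space "{u. square_integrable U u}" "L2_inner U" by (rule L2_semi_inner_space)
sublocale L1: semi_inner_space "H1 U" "L2_inner U" by (rule L2_semi_inner_space_H1[OF open_U bounded_U])
sublocale G: semi_inner_space "H1 U" "grad_inner U" by (rule grad_semi_inner_space[OF open_U bounded_U])
sublocale E: semi_inner_space "H1 U" energy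
  unfolding energy_eq by (rule weighted_grad_semi_inner_space[OF open_U bounded_U a_meas a_nonneg])

lemma H10_H1: "u \<in> H10 D \<Longrightarrow> u \<in> H1 U"
  unfolding H10_def by (simp add: interior_cbox)

lemma H1_square_integrable: "u \<in> H1 U \<Longrightarrow> square_integrable U u"
  by (rule grad_H1(1))

lemma energy_bounds:
  assumes u: "u \<in> H1 U"
  shows "lmin * grad_inner U u u \<le> energy u u"
    and "energy u u \<le> lmax * grad_inner U u u"
proof -
  note g = grad_H1(2)[OF u]
  note i1 = integrable_weighted_grad[OF unit_weight g g] and ia = integrable_weighted_grad[OF a_meas a_abs g g]
  have "lmin * grad_inner U u u = (LINT x|lebesgue_on U. lmin * (1 * (grad U u x \<bullet> grad U u x)))"
    unfolding weighted_grad_inner_def by (rule integral_mult_right_zero[symmetric])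
  also have "\<dots> \<le> (LINT x|lebesgue_on U. a x * (grad U u x \<bullet> grad U u x))"
  proof (rule integral_mono_AE[OF integrable_mult_right[OF i1] ia])
    show "AE x in lebesgue_on U. lmin * (1 * (grad U u x \<bullet> grad U u x)) \<le> a x * (grad U u x \<bullet> grad U u x)"
      using a_bounds by eventually_elim (auto intro: mult_right_mono)
  qed
  finally show "lmin * grad_inner U u u \<le> energy u u" unfolding energy_eq weighted_grad_inner_def .
  have "(LINT x|lebesgue_on U. a x * (grad U u x \<bullet> grad U u x)) \<le> (LINT x|lebesgue_on U. lmax * (1 * (grad U u x \<bullet> grad U u x)))"
  proof (rule integral_mono_AE[OF ia integrable_mult_right[OF i1]])
    show "AE x in lebesgue_on U. a x * (grad U u x \<bullet> grad U u x) \<le> lmax * (1 * (grad U u x \<bullet> grad U u x))"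
      using a_bounds by eventually_elim (auto intro: mult_right_mono)
  qed
  also have "\<dots> = lmax * grad_inner U u u"
    unfolding weighted_grad_inner_def by (rule integral_mult_right_zero)
  finally show "energy u u \<le> lmax * grad_inner U u u" unfolding energy_eq weighted_grad_inner_def .
qed

lemma energy_le_H1: "u \<in> H1 U \<Longrightarrow> energy u u \<le> max lmax 0 * H1_inner U u u"
proof -
  assume u: "u \<in> H1 U"
  have "energy u u \<le> lmax * grad_inner U u u" by (rule energy_bounds(2)[OF u])
  also have "\<dots> \<le> max lmax 0 * grad_inner U u u" using G.ip_nonneg[OF u] by (intro mult_right_mono) auto
  also have "\<dots> \<le> max lmax 0 * H1_inner U u u"
    unfolding H1_inner_def using L1.ip_nonneg[OF u] by (intro mult_left_mono) auto
  finally show "energy u u \<le> max lmax 0 * H1_inner U u u" .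
qed

text \<open>
  Coercivity of the energy on functions with zero trace.
\<close>

lemma H1_le_energy: "u \<in> H10 D \<Longrightarrow> H1_inner U u u \<le> (4 * (r$1 - l$1)\<^sup>2 + 1) / lmin * energy u u"
proof -
  assume u: "u \<in> H10 D"
  have "H1_inner U u u \<le> (4 * (r$1 - l$1)\<^sup>2 + 1) * grad_inner U u u"
    unfolding H1_inner_def using H10_Poincare[OF lr u] by (simp add: algebra_simps)
  also have "\<dots> \<le> (4 * (r$1 - l$1)\<^sup>2 + 1) * (energy u u / lmin)"
    using energy_bounds(1)[OF H10_H1[OF u]] lmin by (intro mult_left_mono) (auto simp: field_simps)
  finally show "H1_inner U u u \<le> (4 * (r$1 - l$1)\<^sup>2 + 1) / lmin * energy u u" by simp
qed

lemma H10_Hilbert: "semi_Hilbert_space (H10 D) (H1_inner U)"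
proof (rule H1.closed_subspace)
  show "H10 D \<subseteq> H1 U" using H10_H1 by blast
  show "(\<lambda>_. 0) \<in> H10 D" by (rule H10_zero[OF bounded_D])
  show "(\<lambda>x. u x + c * v x) \<in> H10 D" if "u \<in> H10 D" "v \<in> H10 D" for u v c by (rule H10_lin[OF bounded_D that])
  show "w \<in> H10 D" if "\<And>k. u k \<in> H10 D" "w \<in> H1 U" "(\<lambda>k. H1.nrm (\<lambda>x. u k x - w x)) \<longlonglongrightarrow> 0" for u :: "nat \<Rightarrow> real^2 \<Rightarrow> real" and w
  proof (rule H10_closed[OF bounded_D that(1)])
    show "w \<in> H1 (interior D)" using that(2) by (simp add: interior_cbox)
    show "(\<lambda>k. H1_norm (interior D) (\<lambda>x. u k x - w x)) \<longlonglongrightarrow> 0"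
      using that(3) unfolding interior_cbox H1_norm_nrm[OF open_U bounded_U] .
  qed
qed

sublocale E0: semi_Hilbert_space "H10 D" energy
proof (rule semi_Hilbert_space.equivalent_inner_product[OF H10_Hilbert])
  show "semi_inner_space (H10 D) energy"
    by (rule E.subspace_semi_inner_space) (use H10_H1 H10_zero[OF bounded_D] H10_lin[OF bounded_D] in auto)
  show "H1_inner U u u \<le> (4 * (r$1 - l$1)\<^sup>2 + 1) / lmin * energy u u" if "u \<in> H10 D" for u by (rule H1_le_energy[OF that])
  show "energy u u \<le> max lmax 0 * H1_inner U u u" if "u \<in> H10 D" for u by (rule energy_le_H1[OF H10_H1[OF that]])
  show "0 \<le> (4 * (r$1 - l$1)\<^sup>2 + 1) / lmin" using lmin by simp
qed simp

lemma H10_diff: "u \<in> H10 D \<Longrightarrow> v \<in> H10 D \<Longrightarrow> (\<lambda>x. u x - v x) \<in> H10 D"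
  using H10_lin[OF bounded_D, of u v "-1"] by simp

lemma H10_energy_null: "u \<in> H10 D \<Longrightarrow> energy u u = 0 \<Longrightarrow> H1_inner U u u = 0"
  using H1_le_energy[of u] H1.ip_nonneg[OF H10_H1] by fastforce

lemma weak_div_iff:
  "weak_div a D u f \<longleftrightarrow> square_integrable U f \<and> (\<forall>\<phi>\<in>H10 D. energy u \<phi> = - L2_inner U f \<phi>)"
  unfolding weak_div_def interior_cbox L2_inner_def ..

lemma weak_div_lin:
  assumes u: "u \<in> H1 U" "weak_div a D u f" and v: "v \<in> H1 U" "weak_div a D v g"
  shows "weak_div a D (\<lambda>x. u x + c * v x) (\<lambda>x. f x + c * g x)"
  using u v unfolding weak_div_iff
  by (auto simp: square_integrable_lin_real E.ip_lin H10_H1 L.ip_lin H1_square_integrable)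

text \<open>Test functions have zero trace, so they are admissible in the definition of \<open>weak_div\<close>.\<close>

lemma weak_div_unique:
  assumes "weak_div a D u f" "weak_div a D u g"
  shows "AE x in lebesgue_on U. f x = g x"
proof -
  have f: "square_integrable U f" and g: "square_integrable U g" using assms unfolding weak_div_iff by auto
  have fg: "square_integrable U (\<lambda>x. f x - g x)" using square_integrable_lin_real[OF f g, of "-1"] by simp
  have "AE x in lebesgue_on U. f x - g x = 0"
  proof (rule fundamental_lemma[OF open_U])
    show "integrable (lebesgue_on U) (\<lambda>x. f x - g x)"
      using square_integrable_imp_integrable[OF fg bounded_U, of 1] open_U by auto
    fix \<phi> assume \<phi>: "test_function U \<phi>"
    have H: "\<phi> \<in> H10 D" by (rule test_function_H10[OF bounded_D]) (simp add: interior_cbox \<phi>)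
    have "L2_inner U f \<phi> = L2_inner U g \<phi>" using assms H unfolding weak_div_iff by (metis neg_equal_iff_equal)
    then have "L2_inner U (\<lambda>x. f x - g x) \<phi> = 0"
      using L.ip_diff[of f g \<phi>] f g H1_square_integrable[OF H10_H1[OF H]] by simp
    then show "(LINT x|lebesgue_on U. (f x - g x) * \<phi> x) = 0" unfolding L2_inner_def .
  qed
  then show ?thesis by eventually_elim simp
qed

lemma L2_inner_cong_AE:
  assumes "square_integrable U f" "square_integrable U f'" "square_integrable U g" "square_integrable U g'"
    and "AE x in lebesgue_on U. f x = f' x" "AE x in lebesgue_on U. g x = g' x"
  shows "L2_inner U f g = L2_inner U f' g'"
  unfolding L2_inner_def
proof (rule integral_cong_AE)
  show "(\<lambda>x. f x * g x) \<in> borel_measurable (lebesgue_on U)" "(\<lambda>x. f' x * g' x) \<in> borel_measurable (lebesgue_on U)"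
    using square_integrableD(1) assms(1-4) by (intro borel_measurable_times; blast)+
  show "AE x in lebesgue_on U. f x * g x = f' x * g' x" using assms(5,6) by eventually_elim simp
qed

lemma a_harmonic_iff: "a_harmonic a D w \<longleftrightarrow> w \<in> H1 U \<and> (\<forall>\<phi>\<in>H10 D. energy w \<phi> = 0)"
  unfolding a_harmonic_def weak_div_iff interior_cbox
  by (auto simp: L2_inner_def square_integrable_zero)

lemma a_harmonic_lin: "a_harmonic a D u \<Longrightarrow> a_harmonic a D v \<Longrightarrow> a_harmonic a D (\<lambda>x. u x + c * v x)"
  unfolding a_harmonic_iff by (auto simp: H1.lin_in E.ip_lin H10_H1)

lemma a_harmonic_unique:
  assumes "a_harmonic a D u" "a_harmonic a D v" "(\<lambda>x. u x - v x) \<in> H10 D"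
  shows "H1_inner U (\<lambda>x. u x - v x) (\<lambda>x. u x - v x) = 0"
proof (rule H10_energy_null[OF assms(3)])
  have "u \<in> H1 U" "v \<in> H1 U" using assms unfolding a_harmonic_iff by auto
  from E.ip_diff[OF this H10_H1[OF assms(3)]] assms
  show "energy (\<lambda>x. u x - v x) (\<lambda>x. u x - v x) = 0" unfolding a_harmonic_iff by simp
qed

text \<open>
  Subtract the energy-orthogonal projection onto the functions with zero trace, which is the Riesz
  representer of \<open>energy u\<close>.
\<close>

lemma ex_harmonic_part:
  assumes u: "u \<in> H1 U"
  shows "\<exists>w. a_harmonic a D w \<and> (\<lambda>x. u x - w x) \<in> H10 D"
proof -
  have "\<exists>z\<in>H10 D. \<forall>v\<in>H10 D. energy z v = energy u v"
  proof (rule E0.Riesz_representation)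
    show "energy u (\<lambda>x. v x + c * w x) = energy u v + c * energy u w" if "v \<in> H10 D" "w \<in> H10 D" for v w c
      by (rule E.ip_lin_right[OF H10_H1[OF that(1)] H10_H1[OF that(2)] u])
    show "\<bar>energy u v\<bar> \<le> E.nrm u * E0.nrm v" if "v \<in> H10 D" for v
      by (rule E.abs_ip_le[OF u H10_H1[OF that]])
  qed
  then obtain z where z: "z \<in> H10 D" "\<And>v. v \<in> H10 D \<Longrightarrow> energy z v = energy u v" by blast
  have "a_harmonic a D (\<lambda>x. u x - z x)"
    unfolding a_harmonic_iff using z by (auto simp: E.ip_diff u H10_H1 H1.diff_in)
  moreover have "(\<lambda>x. u x - (u x - z x)) \<in> H10 D" using z(1) by simp
  ultimately show ?thesis by blast
qed

lemma ex_Poisson_solution: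
  assumes f: "square_integrable U f"
  shows "\<exists>z\<in>H10 D. weak_div a D z f"
proof -
  have fL: "f \<in> {u. square_integrable U u}" using f by simp
  have vL: "v \<in> {u. square_integrable U u}" if "v \<in> H10 D" for v using H1_square_integrable[OF H10_H1[OF that]] by simp
  have "\<exists>z\<in>H10 D. \<forall>v\<in>H10 D. energy z v = - L2_inner U f v"
  proof (rule E0.Riesz_representation)
    show "- L2_inner U f (\<lambda>x. v x + c * w x) = - L2_inner U f v + c * - L2_inner U f w" if "v \<in> H10 D" "w \<in> H10 D" for v w c
      using L.ip_lin_right[OF vL[OF that(1)] vL[OF that(2)] fL, of c] by simp
    show "\<bar>- L2_inner U f v\<bar> \<le> (L.nrm f * sqrt ((4 * (r$1 - l$1)\<^sup>2 + 1) / lmin)) * E0.nrm v" if v: "v \<in> H10 D" for v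
    proof -
      have "L2_inner U v v \<le> H1_inner U v v" unfolding H1_inner_def using G.ip_nonneg[OF H10_H1[OF v]] by simp
      also have "\<dots> \<le> (4 * (r$1 - l$1)\<^sup>2 + 1) / lmin * energy v v" by (rule H1_le_energy[OF v])
      finally have "L.nrm v \<le> sqrt ((4 * (r$1 - l$1)\<^sup>2 + 1) / lmin) * E0.nrm v"
        unfolding L.nrm_def E0.nrm_def real_sqrt_mult[symmetric] by simp
      then have "L.nrm f * L.nrm v \<le> L.nrm f * (sqrt ((4 * (r$1 - l$1)\<^sup>2 + 1) / lmin) * E0.nrm v)"
        using L.nrm_nonneg[OF fL] by (rule mult_left_mono)
      then show ?thesis using L.abs_ip_le[OF fL vL[OF v]] by (simp only: abs_minus_cancel mult.assoc)
    qed
  qed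
  then show ?thesis unfolding weak_div_iff using f by blast
qed

section \<open>The space \<open>V\<close> is a Hilbert space\<close>

text \<open>
  \<open>decomposes u w f\<close> collects what determines the norm of \<open>u\<close>: its harmonic part \<open>w\<close> and
  \<open>f = div (a \<nabla> u)\<close>, each of which is unique as an element of its function space.
\<close>

definition decomposes :: "(real^2 \<Rightarrow> real) \<Rightarrow> (real^2 \<Rightarrow> real) \<Rightarrow> (real^2 \<Rightarrow> real) \<Rightarrow> bool" where
  "decomposes u w f \<longleftrightarrow> a_harmonic a D w \<and> (\<lambda>x. u x - w x) \<in> H10 D \<and> weak_div a D u f"

text \<open>
  The part of the inner product of \<open>V\<close> that comes from the harmonic parts. It is equivalent to the
  inner product of \<open>H\<^sup>1\<close>.
\<close>

definition harmonic_inner :: "(real^2 \<Rightarrow> real) \<Rightarrow> (real^2 \<Rightarrow> real) \<Rightarrow> real" where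
  "harmonic_inner u v = energy u v + L2_inner U u v"

sublocale M: semi_inner_space "H1 U" harmonic_inner
  unfolding harmonic_inner_def[abs_def] by (rule semi_inner_space_add[OF E.semi_inner_space_axioms L1.semi_inner_space_axioms])

lemma M_le_H1: "u \<in> H1 U \<Longrightarrow> harmonic_inner u u \<le> (max lmax 0 + 1) * H1_inner U u u"
  using energy_le_H1[of u] G.ip_nonneg[of u] unfolding harmonic_inner_def
  by (simp add: distrib_right) (simp add: H1_inner_def)

lemma H1_le_M: "u \<in> H1 U \<Longrightarrow> H1_inner U u u \<le> (1 / lmin + 1) * harmonic_inner u u"
proof -
  assume u: "u \<in> H1 U"
  have 1: "grad_inner U u u \<le> 1 / lmin * energy u u"
    using energy_bounds(1)[OF u] lmin by (simp add: field_simps)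
  have 2: "0 \<le> 1 / lmin * L2_inner U u u" using lmin L1.ip_nonneg[OF u] by simp
  have 3: "0 \<le> energy u u" by (rule E.ip_nonneg[OF u])
  have "(1 / lmin + 1) * harmonic_inner u u = 1 / lmin * energy u u + 1 / lmin * L2_inner U u u + energy u u + L2_inner U u u"
    unfolding harmonic_inner_def by (simp add: algebra_simps)
  then show "H1_inner U u u \<le> (1 / lmin + 1) * harmonic_inner u u"
    unfolding H1_inner_def using 1 2 3 by linarith
qed

sublocale M: semi_Hilbert_space "H1 U" harmonic_inner
  by (rule H1.equivalent_inner_product[OF M.semi_inner_space_axioms H1_le_M M_le_H1]) (use lmin in auto)

lemma decomposesD:
  assumes "decomposes u w f"
  shows "w \<in> H1 U" "a_harmonic a D w" "(\<lambda>x. u x - w x) \<in> H10 D" "weak_div a D u f" "square_integrable U f" "u \<in> H1 U"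
proof -
  show w: "w \<in> H1 U" and "a_harmonic a D w" and z: "(\<lambda>x. u x - w x) \<in> H10 D" and "weak_div a D u f" and "square_integrable U f"
    using assms unfolding decomposes_def a_harmonic_iff weak_div_iff by auto
  show "u \<in> H1 U" using H1.add_in[OF H10_H1[OF z] w] by simp
qed

lemma decomposes_lin:
  assumes u: "decomposes u w f" and v: "decomposes v z g"
  shows "decomposes (\<lambda>x. u x + c * v x) (\<lambda>x. w x + c * z x) (\<lambda>x. f x + c * g x)"
proof -
  have "(\<lambda>x. (u x - w x) + c * (v x - z x)) \<in> H10 D"
    by (rule H10_lin[OF bounded_D decomposesD(3)[OF u] decomposesD(3)[OF v]])
  then have "(\<lambda>x. (u x + c * v x) - (w x + c * z x)) \<in> H10 D" by (simp add: algebra_simps)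
  then show ?thesis unfolding decomposes_def
    using a_harmonic_lin[OF decomposesD(2)[OF u] decomposesD(2)[OF v]]
      weak_div_lin[OF decomposesD(6,4)[OF u] decomposesD(6,4)[OF v]] by blast
qed

lemma ex_decomposes:
  assumes "u \<in> V a D"
  shows "decomposes u (harmonic_part a D u) (div_a a D u)"
proof -
  have u: "u \<in> H1 U" and f: "\<exists>f. weak_div a D u f" using assms unfolding V_def by (auto simp: interior_cbox)
  show ?thesis unfolding decomposes_def harmonic_part_def div_a_def
    using someI_ex[OF ex_harmonic_part[OF u]] someI_ex[OF f] by blast
qed

lemma decomposes_unique:
  assumes "decomposes u w f" "decomposes u w' f'"
  shows "harmonic_inner (\<lambda>x. w x - w' x) (\<lambda>x. w x - w' x) = 0" "AE x in lebesgue_on U. f x = f' x"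
proof -
  have "(\<lambda>x. (u x - w' x) - (u x - w x)) \<in> H10 D"
    by (rule H10_diff[OF decomposesD(3)[OF assms(2)] decomposesD(3)[OF assms(1)]])
  then have "(\<lambda>x. w x - w' x) \<in> H10 D" by simp
  from a_harmonic_unique[OF decomposesD(2)[OF assms(1)] decomposesD(2)[OF assms(2)] this]
  show "harmonic_inner (\<lambda>x. w x - w' x) (\<lambda>x. w x - w' x) = 0"
    using M_le_H1[OF H1.diff_in[OF decomposesD(1)[OF assms(1)] decomposesD(1)[OF assms(2)]]]
      M.ip_nonneg[OF H1.diff_in[OF decomposesD(1)[OF assms(1)] decomposesD(1)[OF assms(2)]]] by simp
  show "AE x in lebesgue_on U. f x = f' x"
    by (rule weak_div_unique[OF decomposesD(4)[OF assms(1)] decomposesD(4)[OF assms(2)]])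
qed

text \<open>
  The inner product may be computed from any decomposition instead of the chosen one. Bilinearity
  follows, since decompositions can be combined linearly.
\<close>

lemma V_inner_eq:
  assumes u: "u \<in> V a D" "decomposes u w f" and v: "v \<in> V a D" "decomposes v z g"
  shows "V_inner a D u v = harmonic_inner w z + L2_inner U f g"
proof -
  note du = ex_decomposes[OF u(1)] and dv = ex_decomposes[OF v(1)]
  let ?w = "harmonic_part a D u" and ?z = "harmonic_part a D v"
  have "harmonic_inner ?w ?z = harmonic_inner w ?z"
    by (rule M.ip_cong_null[OF decomposesD(1)[OF du] decomposesD(1)[OF u(2)] decomposesD(1)[OF dv] decomposes_unique(1)[OF du u(2)]])
  also have "\<dots> = harmonic_inner ?z w" by (rule M.ip_sym[OF decomposesD(1)[OF u(2)] decomposesD(1)[OF dv]])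
  also have "\<dots> = harmonic_inner z w"
    by (rule M.ip_cong_null[OF decomposesD(1)[OF dv] decomposesD(1)[OF v(2)] decomposesD(1)[OF u(2)] decomposes_unique(1)[OF dv v(2)]])
  also have "\<dots> = harmonic_inner w z" by (rule M.ip_sym[OF decomposesD(1)[OF v(2)] decomposesD(1)[OF u(2)]])
  finally have "harmonic_inner ?w ?z = harmonic_inner w z" .
  moreover have "L2_inner U (div_a a D u) (div_a a D v) = L2_inner U f g"
    by (rule L2_inner_cong_AE[OF decomposesD(5)[OF du] decomposesD(5)[OF u(2)] decomposesD(5)[OF dv] decomposesD(5)[OF v(2)]
        decomposes_unique(2)[OF du u(2)] decomposes_unique(2)[OF dv v(2)]])
  ultimately show ?thesis unfolding V_inner_def harmonic_inner_def L2_inner_def interior_cbox by simp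
qed

lemma V_memI:
  assumes "decomposes u w f" "trace_on D (frontier D \<inter> frontier Omega) u (\<lambda>_. 0)"
  shows "u \<in> V a D"
  using assms decomposesD(4,6)[OF assms(1)] unfolding V_def by (auto simp: interior_cbox)

lemma V_trace: "u \<in> V a D \<Longrightarrow> trace_on D (frontier D \<inter> frontier Omega) u (\<lambda>_. 0)"
  unfolding V_def by simp

lemma zero_trace_lin:
  assumes "u \<in> H1 U" "v \<in> H1 U" "trace_on D \<Gamma> u (\<lambda>_. 0)" "trace_on D \<Gamma> v (\<lambda>_. 0)"
  shows "trace_on D \<Gamma> (\<lambda>x. u x + c * v x) (\<lambda>_. 0)"
  using trace_on_lin[OF bounded_D _ _ assms(3,4), of c] assms(1,2) by (simp add: interior_cbox)

lemma V_lin: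
  assumes u: "u \<in> V a D" and v: "v \<in> V a D"
  shows "(\<lambda>x. u x + c * v x) \<in> V a D"
  by (rule V_memI[OF decomposes_lin[OF ex_decomposes[OF u] ex_decomposes[OF v]]])
    (rule zero_trace_lin[OF decomposesD(6)[OF ex_decomposes[OF u]] decomposesD(6)[OF ex_decomposes[OF v]] V_trace[OF u] V_trace[OF v]])

lemma decomposes_zero: "decomposes (\<lambda>_. 0) (\<lambda>_. 0) (\<lambda>_. 0)"
  unfolding decomposes_def a_harmonic_iff weak_div_iff
  by (auto simp: H1_zero E.ip_zero H10_H1 H10_zero square_integrable_zero L2_inner_def)

lemma V_zero: "(\<lambda>_. 0) \<in> V a D"
  by (rule V_memI[OF decomposes_zero trace_on_zero[OF bounded_D]])

sublocale V: semi_inner_space "V a D" "V_inner a D"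
proof
  fix u v w c assume u: "u \<in> V a D"
  note du = ex_decomposes[OF u]
  show "0 \<le> V_inner a D u u"
    unfolding V_inner_eq[OF u du u du] using M.ip_nonneg[OF decomposesD(1)[OF du]] L.ip_nonneg[of "div_a a D u"] decomposesD(5)[OF du]
    by simp
  assume v: "v \<in> V a D"
  note dv = ex_decomposes[OF v]
  show "V_inner a D u v = V_inner a D v u"
    unfolding V_inner_def energy_eq weighted_grad_inner_def by (simp add: inner_commute mult.commute)
  show "(\<lambda>x. u x + c * v x) \<in> V a D" by (rule V_lin[OF u v])
  assume w: "w \<in> V a D"
  note dw = ex_decomposes[OF w]
  show "V_inner a D (\<lambda>x. u x + c * v x) w = V_inner a D u w + c * V_inner a D v w"
    unfolding V_inner_eq[OF V_lin[OF u v] decomposes_lin[OF du dv] w dw] V_inner_eq[OF u du w dw] V_inner_eq[OF v dv w dw]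
    using decomposesD(1)[OF du] decomposesD(1)[OF dv] decomposesD(1)[OF dw] decomposesD(5)[OF du] decomposesD(5)[OF dv] decomposesD(5)[OF dw]
    by (simp add: M.ip_lin L.ip_lin algebra_simps)
qed (rule V_zero)

text \<open>
  The limit is \<open>v = w' + z\<close>, where \<open>w'\<close> is the \<open>H\<^sup>1\<close>-limit of the harmonic parts and \<open>z\<close> has zero
  trace and divergence the \<open>L\<^sup>2\<close>-limit \<open>f'\<close>. Harmonicity and the zero trace on the outer boundary
  are closed conditions, so \<open>w'\<close> inherits them.
\<close>

sublocale V: semi_Hilbert_space "V a D" "V_inner a D"
proof
  fix u :: "nat \<Rightarrow> real^2 \<Rightarrow> real" assume u: "\<And>k. u k \<in> V a D" and Cau: "V.Cauchy_seq u"
  define w f where "w k = harmonic_part a D (u k)" and "f k = div_a a D (u k)" for k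
  have d: "decomposes (u k) (w k) (f k)" for k unfolding w_def f_def by (rule ex_decomposes[OF u])
  note wH = decomposesD(1)[OF d] and fL = decomposesD(5)[OF d] and uH = decomposesD(6)[OF d]
  have V_diff: "V_inner a D (\<lambda>x. u k x - v x) (\<lambda>x. u k x - v x) =
      harmonic_inner (\<lambda>x. w k x - w' x) (\<lambda>x. w k x - w' x) + L2_inner U (\<lambda>x. f k x - f' x) (\<lambda>x. f k x - f' x)"
    if v: "v \<in> V a D" "decomposes v w' f'" for v w' f' k
  proof -
    have dd: "decomposes (\<lambda>x. u k x - v x) (\<lambda>x. w k x - w' x) (\<lambda>x. f k x - f' x)"
      using decomposes_lin[OF d v(2), of k "-1"] by simp
    show ?thesis by (rule V_inner_eq[OF V.diff_in[OF u v(1)] dd V.diff_in[OF u v(1)] dd])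
  qed
  have Mnn: "0 \<le> harmonic_inner (\<lambda>x. w k x - w m x) (\<lambda>x. w k x - w m x)" for k m
    by (rule M.ip_nonneg[OF H1.diff_in[OF wH wH]])
  have Lnn: "0 \<le> L2_inner U (\<lambda>x. f k x - f m x) (\<lambda>x. f k x - f m x)" for k m
    unfolding L2_inner_self by simp
  have small: "\<exists>N. \<forall>k\<ge>N. \<forall>m\<ge>N. V_inner a D (\<lambda>x. u k x - u m x) (\<lambda>x. u k x - u m x) < c" if c: "c > 0" for c
  proof -
    have "sqrt c > 0" using c by simp
    then obtain N where N: "\<And>k m. k \<ge> N \<Longrightarrow> m \<ge> N \<Longrightarrow> V.nrm (\<lambda>x. u k x - u m x) < sqrt c"
      using Cau unfolding V.Cauchy_seq_def by blast
    have "V_inner a D (\<lambda>x. u k x - u m x) (\<lambda>x. u k x - u m x) < c" if "k \<ge> N" "m \<ge> N" for k m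
      using N[OF that] unfolding V.nrm_def by (simp only: real_sqrt_less_iff)
    then show ?thesis by blast
  qed
  have "M.Cauchy_seq w" unfolding M.Cauchy_seq_def
  proof (intro allI impI)
    fix c :: real assume c: "c > 0"
    then have "c\<^sup>2 > 0" by simp
    from small[OF this] obtain N where N: "\<And>k m. k \<ge> N \<Longrightarrow> m \<ge> N \<Longrightarrow> V_inner a D (\<lambda>x. u k x - u m x) (\<lambda>x. u k x - u m x) < c\<^sup>2"
      by blast
    have "M.nrm (\<lambda>x. w k x - w m x) < c" if "k \<ge> N" "m \<ge> N" for k m
    proof -
      have "harmonic_inner (\<lambda>x. w k x - w m x) (\<lambda>x. w k x - w m x) < c\<^sup>2"
        using N[OF that] V_diff[OF u d, of k m] Lnn[of k m] by linarith
      then have "sqrt (harmonic_inner (\<lambda>x. w k x - w m x) (\<lambda>x. w k x - w m x)) < sqrt (c\<^sup>2)" by (simp only: real_sqrt_less_iff)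
      then show ?thesis unfolding M.nrm_def using c by simp
    qed
    then show "\<exists>N. \<forall>k\<ge>N. \<forall>m\<ge>N. M.nrm (\<lambda>x. w k x - w m x) < c" by blast
  qed
  from M.complete[OF wH this] obtain w' where w': "w' \<in> H1 U" and Mlim: "(\<lambda>k. M.nrm (\<lambda>x. w k x - w' x)) \<longlonglongrightarrow> 0" by blast
  note Mlim2 = M.ip_diff_tendsto_0[OF wH w' Mlim]
  have "\<exists>g. g \<in> borel_measurable (lebesgue_on U) \<and> integrable (lebesgue_on U) (\<lambda>x. (norm (g x))\<^sup>2) \<and>
             (\<lambda>k. LINT x|lebesgue_on U. (norm (f k x - g x))\<^sup>2) \<longlonglongrightarrow> 0"
  proof (rule L2_complete)
    fix c :: real assume c: "c > 0"
    from small[OF this] obtain N where N: "\<And>k m. k \<ge> N \<Longrightarrow> m \<ge> N \<Longrightarrow> V_inner a D (\<lambda>x. u k x - u m x) (\<lambda>x. u k x - u m x) < c"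
      by blast
    have "(LINT x|lebesgue_on U. (norm (f k x - f m x))\<^sup>2) < c" if "k \<ge> N" "m \<ge> N" for k m
      using N[OF that] V_diff[OF u d, of k m] Mnn[of k m] unfolding L2_inner_self by linarith
    then show "\<exists>N. \<forall>k\<ge>N. \<forall>m\<ge>N. (LINT x|lebesgue_on U. (norm (f k x - f m x))\<^sup>2) < c" by blast
  qed (use square_integrableD[OF fL] in auto)
  then obtain f' where f': "square_integrable U f'" and Llim: "(\<lambda>k. LINT x|lebesgue_on U. (norm (f k x - f' x))\<^sup>2) \<longlonglongrightarrow> 0"
    unfolding square_integrable_def by blast
  obtain z where z: "z \<in> H10 D" "weak_div a D z f'" using ex_Poisson_solution[OF f'] by blast
  have "(\<lambda>k. H1_norm U (\<lambda>x. w k x - w' x)) \<longlonglongrightarrow> 0"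
  proof (rule Lim_null_comparison)
    have "H1_norm U (\<lambda>x. w k x - w' x) \<le> sqrt (1 / lmin + 1) * M.nrm (\<lambda>x. w k x - w' x)" for k
      unfolding H1_norm_eq M.nrm_def real_sqrt_mult[symmetric] using H1_le_M[OF H1.diff_in[OF wH w']] by simp
    moreover have "H1_norm U (\<lambda>x. w k x - w' x) \<ge> 0" for k
      unfolding H1_norm_eq using H1.ip_nonneg[OF H1.diff_in[OF wH w']] by simp
    ultimately show "\<forall>\<^sub>F k in sequentially. norm (H1_norm U (\<lambda>x. w k x - w' x)) \<le> sqrt (1 / lmin + 1) * M.nrm (\<lambda>x. w k x - w' x)"
      by (intro always_eventually) simp
    show "(\<lambda>k. sqrt (1 / lmin + 1) * M.nrm (\<lambda>x. w k x - w' x)) \<longlonglongrightarrow> 0" by (rule tendsto_mult_right_zero[OF Mlim])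
  qed
  note Hlim = this
  have Elim: "(\<lambda>k. E.nrm (\<lambda>x. w k x - w' x)) \<longlonglongrightarrow> 0"
  proof (rule Lim_null_comparison[OF _ Mlim])
    show "\<forall>\<^sub>F k in sequentially. norm (E.nrm (\<lambda>x. w k x - w' x)) \<le> M.nrm (\<lambda>x. w k x - w' x)"
      unfolding E.nrm_def M.nrm_def harmonic_inner_def
      using E.ip_nonneg[OF H1.diff_in[OF wH w']] L1.ip_nonneg[OF H1.diff_in[OF wH w']] by (intro always_eventually) simp
  qed
  have "energy w' \<phi> = 0" if \<phi>: "\<phi> \<in> H10 D" for \<phi>
  proof -
    have "(\<lambda>k. energy (w k) \<phi>) \<longlonglongrightarrow> energy w' \<phi>" by (rule E.ip_tendsto[OF wH w' H10_H1[OF \<phi>] Elim])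
    moreover have "energy (w k) \<phi> = 0" for k using decomposesD(2)[OF d] \<phi> unfolding a_harmonic_iff by blast
    ultimately show ?thesis by (simp add: LIMSEQ_const_iff)
  qed
  then have harm: "a_harmonic a D w'" unfolding a_harmonic_iff using w' by blast
  define v where "v x = w' x + 1 * z x" for x
  have dv: "decomposes v w' f'"
  proof -
    have "weak_div a D w' (\<lambda>_. 0)" using harm unfolding a_harmonic_def by blast
    from weak_div_lin[OF w' this H10_H1[OF z(1)] z(2), of 1] have "weak_div a D v f'" unfolding v_def by simp
    then show ?thesis unfolding decomposes_def using harm z(1) by (simp add: v_def)
  qed
  let ?\<Gamma> = "frontier D \<inter> frontier Omega"
  have H10_trace: "trace_on D ?\<Gamma> y (\<lambda>_. 0)" if "y \<in> H10 D" for y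
    by (rule trace_on_mono[of _ "frontier D"]) (use that in \<open>auto simp: H10_def\<close>)
  \<comment> \<open>\<open>w k\<close> differs from \<open>u k\<close> by a function with zero trace on the whole boundary.\<close>
  have "trace_on D ?\<Gamma> (w k) (\<lambda>_. 0)" for k
    using zero_trace_lin[OF uH[of k] H10_H1[OF decomposesD(3)[OF d[of k]]] V_trace[OF u[of k]]
        H10_trace[OF decomposesD(3)[OF d[of k]]], of "-1"] by simp
  note wtr = this
  have "trace_on D ?\<Gamma> w' (\<lambda>_. 0)"
  proof (rule trace_on_closed[OF bounded_D _ _ _ wtr])
    show "w k \<in> H1 (interior D)" for k using wH by (simp only: interior_cbox)
    show "w' \<in> H1 (interior D)" using w' by (simp only: interior_cbox)
    show "(\<lambda>k. H1_norm (interior D) (\<lambda>x. w k x - w' x)) \<longlonglongrightarrow> 0" using Hlim by (simp only: interior_cbox)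
  qed
  from zero_trace_lin[OF w' H10_H1[OF z(1)] this H10_trace[OF z(1)], of 1]
  have vV: "v \<in> V a D" by (intro V_memI[OF dv]) (simp add: v_def[abs_def])
  have "(\<lambda>k. V_inner a D (\<lambda>x. u k x - v x) (\<lambda>x. u k x - v x)) \<longlonglongrightarrow> 0"
    unfolding V_diff[OF vV dv] using tendsto_add[OF Mlim2 Llim] unfolding L2_inner_self by simp
  then have "(\<lambda>k. V.nrm (\<lambda>x. u k x - v x)) \<longlonglongrightarrow> 0"
    using V.ip_tendsto_0_iff[of "\<lambda>k x. u k x - v x"] V.diff_in[OF u vV] by blast
  then show "\<exists>v\<in>V a D. (\<lambda>k. V.nrm (\<lambda>x. u k x - v x)) \<longlonglongrightarrow> 0" using vV by blast
qed

section \<open>Harmonic extensions\<close>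

text \<open>
  A harmonic function is determined by its boundary values up to energy zero. Reasoning with the relation
  instead of the chosen extension gives linearity of the energy in the boundary values.
\<close>

definition extends :: "(real^2 \<Rightarrow> real) \<Rightarrow> (real^2 \<Rightarrow> real) \<Rightarrow> bool" where
  "extends g w \<longleftrightarrow> a_harmonic a D w \<and> trace_on D (frontier D) w g"

lemma extends_harmonic_extension:
  assumes "zero_extension e v \<in> H_half_boundary D"
  shows "extends (zero_extension e v) (harmonic_extension a D e v)"
proof -
  let ?g = "zero_extension e v"
  obtain w where w: "w \<in> H1 U" "trace_on D (frontier D) w ?g"
    using assms unfolding H_half_boundary_def by (auto simp: interior_cbox)
  obtain z where z: "a_harmonic a D z" "(\<lambda>x. w x - z x) \<in> H10 D" using ex_harmonic_part[OF w(1)] by blast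
  have "trace_on D (frontier D) (\<lambda>x. w x - z x) (\<lambda>_. 0)" using z(2) unfolding H10_def by blast
  from trace_on_lin[OF bounded_D _ _ w(2) this, of "-1"] w(1) H10_H1[OF z(2)]
  have "trace_on D (frontier D) z ?g" by (simp add: interior_cbox)
  then have "\<exists>z. a_harmonic a D z \<and> trace_on D (frontier D) z ?g" using z(1) by blast
  from someI_ex[OF this] show ?thesis unfolding extends_def harmonic_extension_def .
qed

lemma extends_unique:
  assumes "extends g w" "extends g z"
  shows "energy (\<lambda>x. w x - z x) (\<lambda>x. w x - z x) = 0"
proof -
  have H: "w \<in> H1 U" "z \<in> H1 U" using assms unfolding extends_def a_harmonic_iff by auto
  have "trace_on D (frontier D) (\<lambda>x. w x - z x) (\<lambda>_. 0)"
    using trace_on_lin[OF bounded_D, of w z "frontier D" g g "-1"] assms H unfolding extends_def by (simp add: interior_cbox)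
  then have z0: "(\<lambda>x. w x - z x) \<in> H10 D" unfolding H10_def using H1.diff_in[OF H] by (simp add: interior_cbox)
  from a_harmonic_unique[OF _ _ z0] assms have "H1_inner U (\<lambda>x. w x - z x) (\<lambda>x. w x - z x) = 0"
    unfolding extends_def by blast
  then show ?thesis using energy_le_H1[OF H1.diff_in[OF H]] E.ip_nonneg[OF H1.diff_in[OF H]] by simp
qed

lemma extends_lin:
  assumes "extends g w" "extends h z"
  shows "extends (\<lambda>x. g x + c * h x) (\<lambda>x. w x + c * z x)"
  using assms a_harmonic_lin[of w z c] trace_on_lin[OF bounded_D, of w z "frontier D" g h c]
  unfolding extends_def a_harmonic_iff by (simp add: interior_cbox)

lemma energy_harmonic_extension_semi_inner_space:
  "semi_inner_space {v. zero_extension e v \<in> H_half_boundary D}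
     (\<lambda>v w. energy (harmonic_extension a D e v) (harmonic_extension a D e w))"
proof
  let ?X = "{v. zero_extension e v \<in> H_half_boundary D}" and ?h = "harmonic_extension a D e"
  have zl: "zero_extension e (\<lambda>x. u x + c * v x) = (\<lambda>x. zero_extension e u x + c * zero_extension e v x)" for u v c
    by (auto simp: zero_extension_def)
  have ext: "extends (zero_extension e v) (?h v)" if "v \<in> ?X" for v using extends_harmonic_extension that by blast
  have H: "?h v \<in> H1 U" if "v \<in> ?X" for v using ext[OF that] unfolding extends_def a_harmonic_iff by blast
  have "zero_extension e (\<lambda>_. 0) = (\<lambda>_. 0)" by (auto simp: zero_extension_def)
  then show "(\<lambda>_. 0) \<in> ?X" unfolding H_half_boundary_def
    using H1_zero trace_on_zero[OF bounded_D, of "frontier D"] by auto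
  fix u v w c assume u: "u \<in> ?X"
  show "0 \<le> energy (?h u) (?h u)" by (rule E.ip_nonneg[OF H[OF u]])
  assume v: "v \<in> ?X"
  show "energy (?h u) (?h v) = energy (?h v) (?h u)" by (rule E.ip_sym[OF H[OF u] H[OF v]])
  note el = extends_lin[OF ext[OF u] ext[OF v], of c]
  show uv: "(\<lambda>x. u x + c * v x) \<in> ?X"
    using el unfolding extends_def a_harmonic_iff H_half_boundary_def by (auto simp: zl interior_cbox)
  assume w: "w \<in> ?X"
  have "energy (?h (\<lambda>x. u x + c * v x)) (?h w) = energy (\<lambda>x. ?h u x + c * ?h v x) (?h w)"
  proof (rule E.ip_cong_null[OF H[OF uv] H1.lin_in[OF H[OF u] H[OF v]] H[OF w]])
    show "energy (\<lambda>x. ?h (\<lambda>x. u x + c * v x) x - (?h u x + c * ?h v x)) (\<lambda>x. ?h (\<lambda>x. u x + c * v x) x - (?h u x + c * ?h v x)) = 0"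
      by (rule extends_unique[OF ext[OF uv] el[folded zl]])
  qed
  also have "\<dots> = energy (?h u) (?h w) + c * energy (?h v) (?h w)" by (rule E.ip_lin[OF H[OF u] H[OF v] H[OF w]])
  finally show "energy (?h (\<lambda>x. u x + c * v x)) (?h w) = energy (?h u) (?h w) + c * energy (?h v) (?h w)" .
qed

end

section \<open>Point values\<close>

text \<open>
  If \<open>d x \<noteq> 0\<close>, then \<open>d\<close> is nonzero on a relatively open neighbourhood of \<open>x\<close>, which meets the interior
  of the box in a nonempty open set, even if \<open>x\<close> lies on the boundary.
\<close>

lemma continuous_AE_zero_on_box:
  fixes l r :: "'a::euclidean_space"
  assumes lr: "box l r \<noteq> {}" and S: "open S" and c: "continuous_on (S \<inter> cbox l r) d"
    and ae: "AE y in lebesgue_on (S \<inter> cbox l r). d y = (0::real)" and x: "x \<in> S \<inter> cbox l r"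
  shows "d x = 0"
proof (rule ccontr)
  assume nz: "d x \<noteq> 0"
  have "openin (top_of_set (S \<inter> cbox l r)) ((S \<inter> cbox l r) \<inter> d -` (- {0}))"
    by (rule continuous_openin_preimage_gen[OF c]) auto
  then obtain T where T: "open T" "(S \<inter> cbox l r) \<inter> d -` (- {0}) = (S \<inter> cbox l r) \<inter> T"
    unfolding openin_open by blast
  have Sm: "S \<inter> cbox l r \<in> sets lebesgue" using S by auto
  define B where "B = T \<inter> S \<inter> box l r"
  have Bo: "open B" unfolding B_def using T(1) S by (intro open_Int open_box)
  have "AE y in lebesgue. y \<in> S \<inter> cbox l r \<longrightarrow> d y = 0"
    using ae AE_restrict_space_iff[of "S \<inter> cbox l r" lebesgue] Sm by simp
  then have "AE y in lebesgue. y \<notin> B"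
  proof eventually_elim
    case (elim y)
    show ?case
    proof
      assume "y \<in> B"
      then have y: "y \<in> S \<inter> cbox l r" "y \<in> T" using box_subset_cbox[of l r] unfolding B_def by auto
      then have "d y \<noteq> 0" using T(2) by blast
      then show False using elim y by blast
    qed
  qed
  then have "negligible B" using Bo by (simp add: negligible_iff_null_sets AE_iff_null_sets)
  then have "B = {}" using open_not_negligible[OF Bo] by blast
  moreover have "x \<in> T \<inter> S" using x nz T(2) by blast
  moreover have "x \<in> closure (box l r)" using x closure_box[OF lr] by simp
  ultimately show False
    using open_Int_closure_eq_empty[of "T \<inter> S" "box l r"] T(1) S unfolding B_def by blast
qed

lemma continuous_representative_unique:
  assumes lr: "box l r \<noteq> {}"
    and v: "continuous_representative_near (cbox l r) E u v" "x \<in> E"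
    and w: "continuous_representative_near (cbox l r) F u w" "x \<in> F" and x: "x \<in> cbox l r"
  shows "v x = w x"
proof -
  let ?W = "cbox l r"
  obtain S where S: "open S" "E \<subseteq> S" "continuous_on (S \<inter> ?W) v" "AE y in lebesgue_on (S \<inter> ?W). u y = v y"
    using v(1) unfolding continuous_representative_near_def by blast
  obtain T where T: "open T" "F \<subseteq> T" "continuous_on (T \<inter> ?W) w" "AE y in lebesgue_on (T \<inter> ?W). u y = w y"
    using w(1) unfolding continuous_representative_near_def by blast
  have m: "S \<inter> ?W \<in> sets lebesgue" "T \<inter> ?W \<in> sets lebesgue" "(S \<inter> T) \<inter> ?W \<in> sets lebesgue" using S(1) T(1) by auto
  have "(\<lambda>y. v y - w y) x = 0"
  proof (rule continuous_AE_zero_on_box[OF lr])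
    show "open (S \<inter> T)" using S(1) T(1) by blast
    show "continuous_on (S \<inter> T \<inter> ?W) (\<lambda>y. v y - w y)"
      by (intro continuous_on_diff continuous_on_subset[OF S(3)] continuous_on_subset[OF T(3)]) auto
    have "AE y in lebesgue. y \<in> S \<inter> ?W \<longrightarrow> u y = v y" "AE y in lebesgue. y \<in> T \<inter> ?W \<longrightarrow> u y = w y"
      using S(4) T(4) AE_restrict_space_iff[of "S \<inter> ?W" lebesgue] AE_restrict_space_iff[of "T \<inter> ?W" lebesgue] m by simp_all
    then have "AE y in lebesgue. y \<in> S \<inter> T \<inter> ?W \<longrightarrow> v y - w y = 0" by eventually_elim auto
    then show "AE y in lebesgue_on (S \<inter> T \<inter> ?W). v y - w y = 0"
      using AE_restrict_space_iff[of "S \<inter> T \<inter> ?W" lebesgue] m by simp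
    show "x \<in> S \<inter> T \<inter> ?W" using x v(2) w(2) S(2) T(2) by blast
  qed
  then show ?thesis by simp
qed

lemma point_value_eq:
  assumes lr: "box l r \<noteq> {}" and v: "continuous_representative_near (cbox l r) E u v"
    and x: "x \<in> E" "x \<in> cbox l r"
  shows "point_value (cbox l r) u x = v x"
  unfolding point_value_def
proof (rule the_equality)
  have "continuous_representative_near (cbox l r) {x} u v"
    using v x(1) unfolding continuous_representative_near_def by blast
  then show "\<exists>v'. continuous_representative_near (cbox l r) {x} u v' \<and> v' x = v x" by blast
  fix c assume "\<exists>v'. continuous_representative_near (cbox l r) {x} u v' \<and> v' x = c"
  then show "c = v x" using continuous_representative_unique[OF lr _ _ v x(1) x(2)] by blast
qed

lemma continuous_representative_lin:
  assumes v: "continuous_representative_near W E u v" and w: "continuous_representative_near W E z w"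
    and W: "W \<in> sets lebesgue"
  shows "continuous_representative_near W E (\<lambda>x. u x + c * z x) (\<lambda>x. v x + c * w x)"
proof -
  obtain S where S: "open S" "E \<subseteq> S" "continuous_on (S \<inter> W) v" "AE y in lebesgue_on (S \<inter> W). u y = v y"
    using v unfolding continuous_representative_near_def by blast
  obtain T where T: "open T" "E \<subseteq> T" "continuous_on (T \<inter> W) w" "AE y in lebesgue_on (T \<inter> W). z y = w y"
    using w unfolding continuous_representative_near_def by blast
  have m: "S \<inter> W \<in> sets lebesgue" "T \<inter> W \<in> sets lebesgue" "(S \<inter> T) \<inter> W \<in> sets lebesgue" using S(1) T(1) W by auto
  have "AE y in lebesgue. y \<in> S \<inter> W \<longrightarrow> u y = v y" "AE y in lebesgue. y \<in> T \<inter> W \<longrightarrow> z y = w y"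
    using S(4) T(4) AE_restrict_space_iff[of "S \<inter> W" lebesgue] AE_restrict_space_iff[of "T \<inter> W" lebesgue] m by simp_all
  then have "AE y in lebesgue. y \<in> S \<inter> T \<inter> W \<longrightarrow> u y + c * z y = v y + c * w y" by eventually_elim auto
  then have "AE y in lebesgue_on (S \<inter> T \<inter> W). u y + c * z y = v y + c * w y"
    using AE_restrict_space_iff[of "S \<inter> T \<inter> W" lebesgue] m by simp
  moreover have "continuous_on (S \<inter> T \<inter> W) (\<lambda>x. v x + c * w x)"
    by (intro continuous_on_add continuous_on_mult continuous_on_const continuous_on_subset[OF S(3)] continuous_on_subset[OF T(3)]) auto
  ultimately show ?thesis unfolding continuous_representative_near_def
    using S(1,2) T(1,2) by (intro exI[of _ "S \<inter> T"]) auto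
qed

lemma point_value_lin:
  assumes lr: "box l r \<noteq> {}"
    and "\<exists>v. continuous_representative_near (cbox l r) E u v" "\<exists>v. continuous_representative_near (cbox l r) E z v"
    and x: "x \<in> E" "x \<in> cbox l r"
  shows "point_value (cbox l r) (\<lambda>x. u x + c * z x) x = point_value (cbox l r) u x + c * point_value (cbox l r) z x"
proof -
  obtain v w where v: "continuous_representative_near (cbox l r) E u v" and w: "continuous_representative_near (cbox l r) E z w"
    using assms(2,3) by blast
  have "continuous_representative_near (cbox l r) E (\<lambda>x. u x + c * z x) (\<lambda>x. v x + c * w x)"
    by (rule continuous_representative_lin[OF v w]) auto
  from point_value_eq[OF lr this x] point_value_eq[OF lr v x] point_value_eq[OF lr w x] show ?thesis by simp
qed

section \<open>Geometry of the mesh\<close>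

lemma node_nth [simp]: "node n j k $ 1 = real j / real n" "node n j k $ 2 = real k / real n"
  by (simp_all add: node_def)

lemma mem_cbox_node:
  "x \<in> cbox (node n j k) (node n j' k') \<longleftrightarrow>
     real j / real n \<le> x $ 1 \<and> x $ 1 \<le> real j' / real n \<and> real k / real n \<le> x $ 2 \<and> x $ 2 \<le> real k' / real n"
  by (auto simp: mem_box_cart forall_2)

lemma box_node_subset_Omega:
  assumes "n > 0" "j' \<le> n" "k' \<le> n"
  shows "box (node n j k) (node n j' k') \<subseteq> Omega"
proof
  fix x assume "x \<in> box (node n j k) (node n j' k')"
  then have x: "real j / real n < x $ 1" "x $ 1 < real j' / real n" "real k / real n < x $ 2" "x $ 2 < real k' / real n"
    by (auto simp: mem_box_cart forall_2)
  have "0 \<le> real j / real n" "0 \<le> real k / real n" "real j' / real n \<le> 1" "real k' / real n \<le> 1"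
    using assms by (auto simp: divide_le_eq)
  then have "0 < x $ 1" "x $ 1 < 1" "0 < x $ 2" "x $ 2 < 1" using x by linarith+
  then show "x \<in> Omega" unfolding Omega_def by (simp add: mem_box_cart forall_2)
qed

text \<open>
  The squared distance of two nodes is a sum of two squares of integers divided by \<open>n\<^sup>2\<close>, and \<open>1\<close>
  is such a sum only with summands \<open>0\<close> and \<open>1\<close>.
\<close>

lemma adjacent_nodes:
  assumes n: "n > 0" and d: "dist (node n j k) (node n j' k') = 1 / real n"
  shows "(j = j' \<and> (k' = k + 1 \<or> k = k' + 1)) \<or> (k = k' \<and> (j' = j + 1 \<or> j = j' + 1))"
proof -
  have "(dist (node n j k) (node n j' k'))\<^sup>2 = (real j / real n - real j' / real n)\<^sup>2 + (real k / real n - real k' / real n)\<^sup>2"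
    by (simp add: dist_norm norm_vec_def L2_set_def UNIV_2)
  also have "\<dots> = ((real j - real j')\<^sup>2 + (real k - real k')\<^sup>2) / (real n)\<^sup>2"
    by (simp add: diff_divide_distrib[symmetric] power_divide add_divide_distrib)
  finally have "(real j - real j')\<^sup>2 + (real k - real k')\<^sup>2 = 1"
    using d n by (simp add: power_divide)
  then have "real_of_int ((int j - int j')\<^sup>2 + (int k - int k')\<^sup>2) = real_of_int 1" by simp
  then have sq: "(int j - int j')\<^sup>2 + (int k - int k')\<^sup>2 = 1" by (simp only: of_int_eq_iff)
  have "(int j - int j')\<^sup>2 \<le> 1" using sq by (smt (verit) zero_le_power2)
  then have "\<bar>int j - int j'\<bar> \<le> 1" by (simp add: abs_square_le_1)
  then consider "int j - int j' = 0" | "int j - int j' = 1" | "int j - int j' = -1" by linarith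
  then show ?thesis
  proof cases
    case 1
    then have "(int k - int k')\<^sup>2 = 1" using sq by simp
    then have "int k - int k' = 1 \<or> int k - int k' = -1" by (simp add: power2_eq_1_iff)
    then show ?thesis using 1 by auto
  qed (use sq in auto)
qed

lemma grid_interval:
  fixes A B n :: nat
  assumes n: "n > 0" and AB: "A \<le> B" and x: "real A / real n \<le> x" "x \<le> real (B + 1) / real n"
  shows "\<exists>i. A \<le> i \<and> i \<le> B \<and> real i / real n \<le> x \<and> x \<le> real (Suc i) / real n"
proof -
  have x': "real A \<le> x * real n" "x * real n \<le> real (B + 1)" using x n by (simp_all add: field_simps)
  define f where "f = nat \<lfloor>x * real n\<rfloor>"
  have nn: "0 \<le> x * real n" using x'(1) by (meson of_nat_0_le_iff order_trans)
  have f: "real f \<le> x * real n" "x * real n < real f + 1" unfolding f_def using nn by linarith+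
  have "real A < real f + 1" using x' f by linarith
  then have Af: "A \<le> f" by linarith
  show ?thesis
  proof (cases "f \<le> B")
    case True
    then show ?thesis using Af f n by (intro exI[of _ f]) (auto simp: field_simps)
  next
    case False
    then have "real B + 1 \<le> real f" by linarith
    then have "x * real n = real B + 1" using x' f by simp
    then show ?thesis using AB n by (intro exI[of _ B]) (auto simp: field_simps)
  qed
qed

text \<open>
  An element meets the edge if and only if its index ranges meet those of the endpoints, and these
  elements fill a rectangular block of the mesh.
\<close>

lemma oversampling_region_box:
  assumes n: "n > 0" and e: "interior_edge n p q"
  obtains l r where "oversampling_region n (closed_segment p q) = cbox l r" "l$1 < r$1" "l$2 < r$2"
    "box l r \<subseteq> Omega" "p \<in> cbox l r" "q \<in> cbox l r"
proof -
  obtain j k j' k' where p: "p = node n j k" "j \<le> n" "k \<le> n" and q: "q = node n j' k'" "j' \<le> n" "k' \<le> n"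
    using e unfolding interior_edge_def nodes_def by blast
  have adj: "(j = j' \<and> (k' = k + 1 \<or> k = k' + 1)) \<or> (k = k' \<and> (j' = j + 1 \<or> j = j' + 1))"
    using e unfolding interior_edge_def p(1) q(1) by (intro adjacent_nodes[OF n]) blast
  define j0 j1 k0 k1 where "j0 = min j j'" and "j1 = max j j'" and "k0 = min k k'" and "k1 = max k k'"
  have meets: "cbox (node n a b) (node n (Suc a) (Suc b)) \<inter> closed_segment p q \<noteq> {} \<longleftrightarrow>
      a \<le> j1 \<and> j0 \<le> Suc a \<and> b \<le> k1 \<and> k0 \<le> Suc b" for a b
  proof
    assume "cbox (node n a b) (node n (Suc a) (Suc b)) \<inter> closed_segment p q \<noteq> {}"
    then obtain x where x: "x \<in> cbox (node n a b) (node n (Suc a) (Suc b))" and xs: "x \<in> closed_segment p q" by blast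
    have "closed_segment p q \<subseteq> cbox (node n j0 k0) (node n j1 k1)"
    proof (rule closed_segment_subset)
      show "p \<in> cbox (node n j0 k0) (node n j1 k1)" "q \<in> cbox (node n j0 k0) (node n j1 k1)"
        unfolding p q mem_cbox_node j0_def j1_def k0_def k1_def node_nth by (auto intro!: divide_right_mono)
    qed (rule convex_box)
    then have x2: "x \<in> cbox (node n j0 k0) (node n j1 k1)" using xs by blast
    have "real a / real n \<le> real j1 / real n" "real j0 / real n \<le> real (Suc a) / real n"
      "real b / real n \<le> real k1 / real n" "real k0 / real n \<le> real (Suc b) / real n"
      using x x2 unfolding mem_cbox_node by linarith+
    then show "a \<le> j1 \<and> j0 \<le> Suc a \<and> b \<le> k1 \<and> k0 \<le> Suc b" using n by (simp add: divide_le_cancel)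
  next
    assume "a \<le> j1 \<and> j0 \<le> Suc a \<and> b \<le> k1 \<and> k0 \<le> Suc b"
    \<comment> \<open>The edge has length one mesh width in one direction and zero in the other, so the common index
      in each direction belongs to one and the same endpoint.\<close>
    then have "(a \<le> j \<and> j \<le> Suc a \<and> b \<le> k \<and> k \<le> Suc b) \<or> (a \<le> j' \<and> j' \<le> Suc a \<and> b \<le> k' \<and> k' \<le> Suc b)"
      using adj unfolding j0_def j1_def k0_def k1_def by auto
    then have "p \<in> cbox (node n a b) (node n (Suc a) (Suc b)) \<or> q \<in> cbox (node n a b) (node n (Suc a) (Suc b))"
      unfolding p q mem_cbox_node node_nth using n by (auto simp: divide_le_cancel simp del: of_nat_Suc)
    then show "cbox (node n a b) (node n (Suc a) (Suc b)) \<inter> closed_segment p q \<noteq> {}"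
      using ends_in_segment by blast
  qed
  \<comment> \<open>Natural subtraction and the minimum with \<open>n - 1\<close> cut the block off at the boundary of the square.\<close>
  define A B A' B' where "A = j0 - 1" and "B = k0 - 1" and "A' = min j1 (n - 1)" and "B' = min k1 (n - 1)"
  have AB: "A \<le> A'" "B \<le> B'" "A' < n" "B' < n"
    unfolding A_def B_def A'_def B'_def j0_def j1_def k0_def k1_def using p q n by auto
  have range: "a < n \<and> a \<le> j1 \<and> j0 \<le> Suc a \<longleftrightarrow> A \<le> a \<and> a \<le> A'" "b < n \<and> b \<le> k1 \<and> k0 \<le> Suc b \<longleftrightarrow> B \<le> b \<and> b \<le> B'" for a b
    unfolding A_def B_def A'_def B'_def using n by auto
  let ?l = "node n A B" and ?r = "node n (A' + 1) (B' + 1)"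
  have "oversampling_region n (closed_segment p q) = cbox ?l ?r"
  proof (rule set_eqI)
    fix x
    have "x \<in> oversampling_region n (closed_segment p q) \<longleftrightarrow>
        (\<exists>a b. a < n \<and> b < n \<and> x \<in> cbox (node n a b) (node n (Suc a) (Suc b)) \<and>
           cbox (node n a b) (node n (Suc a) (Suc b)) \<inter> closed_segment p q \<noteq> {})"
      unfolding oversampling_region_def elements_def by blast
    also have "\<dots> \<longleftrightarrow> (\<exists>a b. (a < n \<and> a \<le> j1 \<and> j0 \<le> Suc a) \<and> (b < n \<and> b \<le> k1 \<and> k0 \<le> Suc b) \<and>
           x \<in> cbox (node n a b) (node n (Suc a) (Suc b)))"
      unfolding meets by blast
    also have "\<dots> \<longleftrightarrow> (\<exists>a b. (A \<le> a \<and> a \<le> A') \<and> (B \<le> b \<and> b \<le> B') \<and> x \<in> cbox (node n a b) (node n (Suc a) (Suc b)))"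
      unfolding range ..
    also have "\<dots> \<longleftrightarrow> x \<in> cbox ?l ?r"
    proof
      assume "\<exists>a b. (A \<le> a \<and> a \<le> A') \<and> (B \<le> b \<and> b \<le> B') \<and> x \<in> cbox (node n a b) (node n (Suc a) (Suc b))"
      then obtain a b where ab: "A \<le> a" "a \<le> A'" "B \<le> b" "b \<le> B'" and x: "x \<in> cbox (node n a b) (node n (Suc a) (Suc b))" by blast
      have "real A / real n \<le> real a / real n" "real (Suc a) / real n \<le> real (A' + 1) / real n"
        "real B / real n \<le> real b / real n" "real (Suc b) / real n \<le> real (B' + 1) / real n"
        using ab by (auto intro!: divide_right_mono)
      then show "x \<in> cbox ?l ?r" using x unfolding mem_cbox_node by linarith
    next
      assume x: "x \<in> cbox ?l ?r"
      then have x': "real A / real n \<le> x $ 1" "x $ 1 \<le> real (A' + 1) / real n"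
        "real B / real n \<le> x $ 2" "x $ 2 \<le> real (B' + 1) / real n" unfolding mem_cbox_node by blast+
      from grid_interval[OF n AB(1) x'(1,2)] grid_interval[OF n AB(2) x'(3,4)]
      show "\<exists>a b. (A \<le> a \<and> a \<le> A') \<and> (B \<le> b \<and> b \<le> B') \<and> x \<in> cbox (node n a b) (node n (Suc a) (Suc b))"
        unfolding mem_cbox_node by blast
    qed
    finally show "x \<in> oversampling_region n (closed_segment p q) \<longleftrightarrow> x \<in> cbox ?l ?r" .
  qed
  moreover have "?l $ 1 < ?r $ 1" "?l $ 2 < ?r $ 2"
    using AB n by (auto intro!: divide_strict_right_mono)
  moreover have "box ?l ?r \<subseteq> Omega" using AB by (intro box_node_subset_Omega[OF n]) auto
  moreover have "p \<in> cbox ?l ?r" "q \<in> cbox ?l ?r"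
    unfolding p q mem_cbox_node node_nth A_def B_def A'_def B'_def j0_def j1_def k0_def k1_def
    using p q n adj by (auto intro!: divide_right_mono)
  ultimately show thesis by (rule that)
qed

lemma elliptic_box_in_Omega:
  assumes "a \<in> borel_measurable (lebesgue_on Omega)" "0 < lmin"
    and ae: "AE x in lebesgue_on Omega. lmin \<le> a x \<and> a x \<le> lmax"
    and lr: "l$1 < r$1" "l$2 < r$2" and sub: "box l r \<subseteq> Omega"
  shows "elliptic_box l r a lmin lmax"
proof
  show "a \<in> borel_measurable (lebesgue_on (box l r))" by (rule measurable_restrict_mono[OF assms(1) sub])
  have O: "Omega \<inter> space lebesgue \<in> sets lebesgue" "box l r \<inter> space lebesgue \<in> sets lebesgue"
    unfolding Omega_def by auto
  show "AE x in lebesgue_on (box l r). lmin \<le> a x \<and> a x \<le> lmax"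
    using ae sub unfolding AE_restrict_space_iff[OF O(1)] AE_restrict_space_iff[OF O(2)]
    by (auto elim!: eventually_mono)
qed (use assms in auto)

lemma element_elliptic_box:
  assumes n: "n > 0" and "a \<in> borel_measurable (lebesgue_on Omega)" "0 < lmin"
    and "AE x in lebesgue_on Omega. lmin \<le> a x \<and> a x \<le> lmax" and D: "D \<in> elements n"
  obtains l r where "D = cbox l r" "elliptic_box l r a lmin lmax"
proof -
  obtain j k where D: "D = cbox (node n j k) (node n (Suc j) (Suc k))" "j < n" "k < n"
    using D unfolding elements_def by blast
  have "elliptic_box (node n j k) (node n (Suc j) (Suc k)) a lmin lmax"
  proof (rule elliptic_box_in_Omega[OF assms(2-4)])
    show "box (node n j k) (node n (Suc j) (Suc k)) \<subseteq> Omega" using D by (intro box_node_subset_Omega[OF n]) auto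
  qed (use n in \<open>auto intro!: divide_strict_right_mono\<close>)
  then show thesis using that D(1) by blast
qed

section \<open>The space on the edge\<close>

lemma H_half_semi_inner_space:
  assumes n: "n > 0" and a: "a \<in> borel_measurable (lebesgue_on Omega)" "0 < lmin"
    "AE x in lebesgue_on Omega. lmin \<le> a x \<and> a x \<le> lmax"
  shows "semi_inner_space (H_half n p q) (H_half_inner n a p q)"
proof -
  let ?e = "closed_segment p q"
  let ?I = "edge_elements n ?e"
  let ?f = "\<lambda>D v w. energy_form a D (harmonic_extension a D ?e v) (harmonic_extension a D ?e w)"
  have S: "semi_inner_space {v. zero_extension ?e v \<in> H_half_boundary D} (?f D)" if D: "D \<in> ?I" for D
  proof -
    have "D \<in> elements n" using D unfolding edge_elements_def by blast
    from element_elliptic_box[OF n a this] obtain l r where lr: "D = cbox l r" "elliptic_box l r a lmin lmax" by blast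
    show ?thesis unfolding lr(1) by (rule elliptic_box.energy_harmonic_extension_semi_inner_space[OF lr(2)])
  qed
  have X: "v \<in> {v. zero_extension ?e v \<in> H_half_boundary D}" if "v \<in> H_half n p q" "D \<in> ?I" for v D
    using that unfolding H_half_def by blast
  show ?thesis
  proof
    fix u v w c
    show "(\<lambda>_. 0) \<in> H_half n p q"
      using semi_inner_space.zero_in[OF S] unfolding H_half_def by blast
    assume u: "u \<in> H_half n p q"
    show "0 \<le> H_half_inner n a p q u u" unfolding H_half_inner_def
    proof (rule sum_nonneg)
      fix D assume D: "D \<in> ?I"
      show "0 \<le> 1 / 2 * ?f D u u" using semi_inner_space.ip_nonneg[OF S[OF D] X[OF u D]] by simp
    qed
    assume v: "v \<in> H_half n p q"
    show "H_half_inner n a p q u v = H_half_inner n a p q v u" unfolding H_half_inner_def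
    proof (rule sum.cong[OF refl])
      fix D assume D: "D \<in> ?I"
      show "1 / 2 * ?f D u v = 1 / 2 * ?f D v u" using semi_inner_space.ip_sym[OF S[OF D] X[OF u D] X[OF v D]] by simp
    qed
    have "(\<lambda>x. u x + c * v x) \<in> {v. zero_extension ?e v \<in> H_half_boundary D}" if D: "D \<in> ?I" for D
      by (rule semi_inner_space.lin_in[OF S[OF D] X[OF u D] X[OF v D]])
    then show "(\<lambda>x. u x + c * v x) \<in> H_half n p q" using u v unfolding H_half_def by auto
    assume w: "w \<in> H_half n p q"
    have "H_half_inner n a p q (\<lambda>x. u x + c * v x) w = (\<Sum>D\<in>?I. 1 / 2 * ?f D u w + c * (1 / 2 * ?f D v w))"
      unfolding H_half_inner_def
    proof (rule sum.cong[OF refl])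
      fix D assume D: "D \<in> ?I"
      show "1 / 2 * ?f D (\<lambda>x. u x + c * v x) w = 1 / 2 * ?f D u w + c * (1 / 2 * ?f D v w)"
        using semi_inner_space.ip_lin[OF S[OF D] X[OF u D] X[OF v D] X[OF w D], of c] by (simp add: algebra_simps)
    qed
    then show "H_half_inner n a p q (\<lambda>x. u x + c * v x) w = H_half_inner n a p q u w + c * H_half_inner n a p q v w"
      unfolding H_half_inner_def by (simp only: sum.distrib sum_distrib_left)
  qed
qed

text \<open>
  Away from the edge point values may fail to exist, so the linearity of the oversampling operators
  and the identity that compares them are known only on the edge. That is enough inside this inner
  product.
\<close>

lemma H_half_inner_cong:
  assumes "\<And>x. x \<in> closed_segment p q \<Longrightarrow> u x = u' x" "\<And>x. x \<in> closed_segment p q \<Longrightarrow> v x = v' x"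
  shows "H_half_inner n a p q u v = H_half_inner n a p q u' v'"
proof -
  have "zero_extension (closed_segment p q) u = zero_extension (closed_segment p q) u'"
    "zero_extension (closed_segment p q) v = zero_extension (closed_segment p q) v'"
    using assms by (auto simp: zero_extension_def)
  then show ?thesis unfolding H_half_inner_def harmonic_extension_def by simp
qed

section \<open>The compact form of an operator\<close>

lemma compact_form_of_operator:
  assumes X: "semi_Hilbert_space X ipX" and Y: "semi_inner_space Y ipY"
    and T: "compact_operator X ipX Y ipY T"
    and lin: "\<And>u v c w. u \<in> X \<Longrightarrow> v \<in> X \<Longrightarrow> w \<in> Y \<Longrightarrow>
       ipY (T (\<lambda>x. u x + c * v x)) w = ipY (\<lambda>x. T u x + c * T v x) w"
  shows "compact_form X ipX (\<lambda>u v. ipY (T u) (T v))"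
proof -
  interpret X: semi_Hilbert_space X ipX by fact
  interpret Y: semi_inner_space Y ipY by fact
  let ?q = "\<lambda>u v. ipY (T u) (T v)"
  have TY: "T u \<in> Y" if "u \<in> X" for u using T that unfolding compact_operator_def by blast
  interpret Q: semi_inner_space X ?q
  proof
    fix u v w c assume u: "u \<in> X"
    show "0 \<le> ?q u u" by (rule Y.ip_nonneg[OF TY[OF u]])
    assume v: "v \<in> X"
    show "?q u v = ?q v u" by (rule Y.ip_sym[OF TY[OF u] TY[OF v]])
    show "(\<lambda>x. u x + c * v x) \<in> X" by (rule X.lin_in[OF u v])
    assume w: "w \<in> X"
    show "?q (\<lambda>x. u x + c * v x) w = ?q u w + c * ?q v w"
      using lin[OF u v TY[OF w]] Y.ip_lin[OF TY[OF u] TY[OF v] TY[OF w]] by simp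
  qed (rule X.zero_in)
  show ?thesis
  proof
    fix u :: "nat \<Rightarrow> _" assume u: "\<And>k. u k \<in> X" and bdd: "\<exists>C. \<forall>k. ipX (u k) (u k) \<le> C"
    obtain r y where r: "strict_mono r" and y: "y \<in> Y"
      and lim: "(\<lambda>k. ipY (\<lambda>x. T (u (r k)) x - y x) (\<lambda>x. T (u (r k)) x - y x)) \<longlonglongrightarrow> 0"
      using T u bdd unfolding compact_operator_def by blast
    have "(\<lambda>k. Y.nrm (\<lambda>x. T (u (r k)) x - y x)) \<longlonglongrightarrow> 0"
      using Y.ip_tendsto_0_iff[of "\<lambda>k x. T (u (r k)) x - y x"] Y.diff_in[OF TY[OF u] y] lim by blast
    from Y.Cauchy_seqI_tendsto[OF TY[OF u] y this]
    have C: "Y.Cauchy_seq (\<lambda>k. T (u (r k)))" .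
    have "Q.nrm (\<lambda>x. u k x - u m x) = Y.nrm (\<lambda>x. T (u k) x - T (u m) x)" for k m
    proof -
      have d: "(\<lambda>x. u k x - u m x) \<in> X" by (rule X.diff_in[OF u u])
      have dY: "(\<lambda>x. T (u k) x - T (u m) x) \<in> Y" by (rule Y.diff_in[OF TY[OF u] TY[OF u]])
      have e: "ipY (T (\<lambda>x. u k x - u m x)) w = ipY (\<lambda>x. T (u k) x - T (u m) x) w" if "w \<in> Y" for w
        using lin[OF u u that, of k "-1" m] by simp
      have "?q (\<lambda>x. u k x - u m x) (\<lambda>x. u k x - u m x) = ipY (T (\<lambda>x. u k x - u m x)) (\<lambda>x. T (u k) x - T (u m) x)"
        using e[OF TY[OF d]] Y.ip_sym[OF TY[OF d] dY] by simp
      also have "\<dots> = ipY (\<lambda>x. T (u k) x - T (u m) x) (\<lambda>x. T (u k) x - T (u m) x)" by (rule e[OF dY])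
      finally show ?thesis unfolding Q.nrm_def Y.nrm_def by simp
    qed
    then have "Q.Cauchy_seq (\<lambda>k. u (r k))" using C unfolding Q.Cauchy_seq_def Y.Cauchy_seq_def by simp
    then show "\<exists>r. strict_mono r \<and> Q.Cauchy_seq (\<lambda>k. u (r k))" using r by blast
  qed
qed

section \<open>Orthogonality of minimizers\<close>

lemma minimizer_orthogonal:
  assumes X: "semi_inner_space X ip" and p: "p \<in> X" and v: "v \<in> X"
    and min: "\<And>t. sqrt (ip p p) \<le> sqrt (ip (\<lambda>x. p x + t * v x) (\<lambda>x. p x + t * v x))"
  shows "ip p v = 0"
proof -
  interpret semi_inner_space X ip by fact
  have "(ip p v)\<^sup>2 \<le> 0 * ip v v"
  proof (rule discriminant_nonneg_quadratic)
    show "0 \<le> 0 + 2 * c * ip p v + c\<^sup>2 * ip v v" for c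
      using min[of c] ip_expand[OF p v, of c] by simp
  qed (rule ip_nonneg[OF v])
  then show ?thesis by simp
qed

section \<open>Comparison of the oversampling operators\<close>

text \<open>
  The interpolation functions \<open>\<psi>1\<close> and \<open>\<psi>2\<close> disappear from \<open>P (T u)\<close>, because \<open>T u\<close> vanishes at
  both endpoints.
\<close>

theorem theorem3p1:
  fixes n :: nat and a :: "real^2 \<Rightarrow> real" and lmin lmax :: real
    and x1 x2 :: "real^2"
    and \<psi>s1 \<psi>s2 \<psi>1 \<psi>2 :: "real^2 \<Rightarrow> real"
    and \<sigma>s \<sigma> :: "nat \<Rightarrow> real"
  defines "e \<equiv> closed_segment x1 x2"
  defines "W \<equiv> oversampling_region n e"
  defines "Ps \<equiv> P_OS W x1 x2 (point_value W \<psi>s1) (point_value W \<psi>s2)"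
  defines "P \<equiv> P_OS W x1 x2 \<psi>1 \<psi>2"
  assumes mesh: "n > 0"
    and a_measurable: "a \<in> borel_measurable (lebesgue_on Omega)"
    and lmin_pos: "0 < lmin" and lmin_le_lmax: "lmin \<le> lmax"
    and a_bounds: "AE x in lebesgue_on Omega. lmin \<le> a x \<and> a x \<le> lmax"
    and edge: "interior_edge n x1 x2"
    and continuous_near_e: "\<forall>u \<in> V a W. \<exists>v. continuous_representative_near W e u v"
    and opt1: "constrained_minimizer a W x1 x2 \<psi>s1"
    and opt2: "constrained_minimizer a W x2 x1 \<psi>s2"
    and basis1: "ms_basis_function n a x1 \<psi>1"
    and basis2: "ms_basis_function n a x2 \<psi>2"
    and compact_Ps: "compact_operator (V a W) (V_inner a W) (H_half n x1 x2) (H_half_inner n a x1 x2) Ps"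
    and compact_P: "compact_operator (V a W) (V_inner a W) (H_half n x1 x2) (H_half_inner n a x1 x2) P"
    and sv_Ps: "singular_values (V a W) (V_inner a W) (H_half_inner n a x1 x2) Ps \<sigma>s"
    and sv_P: "singular_values (V a W) (V_inner a W) (H_half_inner n a x1 x2) P \<sigma>"
  shows "\<forall>i. \<sigma>s i \<le> \<sigma> i"
proof -
  obtain l r where W: "W = cbox l r" and lr: "l$1 < r$1" "l$2 < r$2" and sub: "box l r \<subseteq> Omega"
    and xW: "x1 \<in> W" "x2 \<in> W"
    using oversampling_region_box[OF mesh edge] unfolding W_def e_def by metis
  have eW: "e \<subseteq> W" unfolding e_def by (rule closed_segment_subset[OF xW]) (simp add: W convex_box)
  have xe: "x1 \<in> e" "x2 \<in> e" unfolding e_def by auto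
  have ne: "box l r \<noteq> {}" using lr by (simp add: interval_ne_empty_cart forall_2)
  interpret B: elliptic_box l r a lmin lmax
    by (rule elliptic_box_in_Omega[OF a_measurable lmin_pos a_bounds lr sub])
  let ?X = "V a W" and ?ip = "V_inner a W" and ?ipY = "H_half_inner n a x1 x2" and ?pv = "point_value W"
  have XH: "semi_Hilbert_space ?X ?ip" unfolding W by (rule B.V.semi_Hilbert_space_axioms)
  interpret X: semi_Hilbert_space ?X ?ip by (rule XH)
  have Y: "semi_inner_space (H_half n x1 x2) ?ipY"
    by (rule H_half_semi_inner_space[OF mesh a_measurable lmin_pos a_bounds])
  have pv_lin: "?pv (\<lambda>x. u x + c * v x) x = ?pv u x + c * ?pv v x" if "u \<in> ?X" "v \<in> ?X" "x \<in> e" for u v c x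
    unfolding W using that continuous_near_e eW unfolding W by (intro point_value_lin[OF ne]) auto
  have P_lin: "P (\<lambda>x. u x + c * v x) x = P u x + c * P v x" if "u \<in> ?X" "v \<in> ?X" "x \<in> e" for u v c x
    unfolding P_def P_OS_def using pv_lin[OF that] pv_lin[OF that(1,2) xe(1)] pv_lin[OF that(1,2) xe(2)]
    by (simp add: algebra_simps)
  interpret C: compact_form ?X ?ip "\<lambda>u v. ?ipY (P u) (P v)"
  proof (rule compact_form_of_operator[OF XH Y compact_P])
    fix u v c w assume uv: "u \<in> ?X" "v \<in> ?X"
    show "?ipY (P (\<lambda>x. u x + c * v x)) w = ?ipY (\<lambda>x. P u x + c * P v x) w"
      by (rule H_half_inner_cong) (simp_all add: P_lin[OF uv] e_def[symmetric])
  qed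
  have \<psi>1: "\<psi>s1 \<in> ?X" "?pv \<psi>s1 x1 = 1" "?pv \<psi>s1 x2 = 0"
    and min1: "\<And>\<phi>. \<phi> \<in> ?X \<Longrightarrow> ?pv \<phi> x1 = 1 \<Longrightarrow> ?pv \<phi> x2 = 0 \<Longrightarrow> V_norm a W \<psi>s1 \<le> V_norm a W \<phi>"
    using opt1 unfolding constrained_minimizer_def Let_def by auto
  have \<psi>2: "\<psi>s2 \<in> ?X" "?pv \<psi>s2 x2 = 1" "?pv \<psi>s2 x1 = 0"
    and min2: "\<And>\<phi>. \<phi> \<in> ?X \<Longrightarrow> ?pv \<phi> x2 = 1 \<Longrightarrow> ?pv \<phi> x1 = 0 \<Longrightarrow> V_norm a W \<psi>s2 \<le> V_norm a W \<phi>"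
    using opt2 unfolding constrained_minimizer_def Let_def by auto
  define T where "T u = (\<lambda>x. (u x + (- ?pv u x1) * \<psi>s1 x) + (- ?pv u x2) * \<psi>s2 x)" for u
  have T1: "(\<lambda>x. u x + (- ?pv u x1) * \<psi>s1 x) \<in> ?X" if "u \<in> ?X" for u by (rule X.lin_in[OF that \<psi>1(1)])
  have T_in: "T u \<in> ?X" if "u \<in> ?X" for u unfolding T_def by (rule X.lin_in[OF T1[OF that] \<psi>2(1)])
  have T_pv: "?pv (T u) x = ?pv u x - ?pv u x1 * ?pv \<psi>s1 x - ?pv u x2 * ?pv \<psi>s2 x" if "u \<in> ?X" "x \<in> e" for u x
    unfolding T_def
    by (simp only: pv_lin[OF T1[OF that(1)] \<psi>2(1) that(2)] pv_lin[OF that(1) \<psi>1(1) that(2)])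
  have T_pv0: "?pv (T u) x1 = 0" "?pv (T u) x2 = 0" if "u \<in> ?X" for u
    using T_pv[OF that xe(1)] T_pv[OF that xe(2)] \<psi>1 \<psi>2 by simp_all
  have T_lin: "T (\<lambda>x. u x + c * v x) = (\<lambda>x. T u x + c * T v x)" if "u \<in> ?X" "v \<in> ?X" for u v c
    unfolding T_def using pv_lin[OF that xe(1)] pv_lin[OF that xe(2)] by (simp add: fun_eq_iff algebra_simps)
  have PT: "P (T u) x = Ps u x" if "u \<in> ?X" "x \<in> e" for u x
    unfolding P_def Ps_def P_OS_def using T_pv0[OF that(1)] T_pv[OF that] by simp
  have orth1: "?ip \<psi>s1 v = 0" if v: "v \<in> ?X" "?pv v x1 = 0" "?pv v x2 = 0" for v
  proof (rule minimizer_orthogonal[OF X.semi_inner_space_axioms \<psi>1(1) v(1)])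
    fix t
    have "?pv (\<lambda>x. \<psi>s1 x + t * v x) x1 = 1" "?pv (\<lambda>x. \<psi>s1 x + t * v x) x2 = 0"
      using pv_lin[OF \<psi>1(1) v(1) xe(1)] pv_lin[OF \<psi>1(1) v(1) xe(2)] \<psi>1 v by simp_all
    from min1[OF X.lin_in[OF \<psi>1(1) v(1)] this]
    show "sqrt (?ip \<psi>s1 \<psi>s1) \<le> sqrt (?ip (\<lambda>x. \<psi>s1 x + t * v x) (\<lambda>x. \<psi>s1 x + t * v x))" unfolding V_norm_def .
  qed
  have orth2: "?ip \<psi>s2 v = 0" if v: "v \<in> ?X" "?pv v x1 = 0" "?pv v x2 = 0" for v
  proof (rule minimizer_orthogonal[OF X.semi_inner_space_axioms \<psi>2(1) v(1)])
    fix t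
    have "?pv (\<lambda>x. \<psi>s2 x + t * v x) x2 = 1" "?pv (\<lambda>x. \<psi>s2 x + t * v x) x1 = 0"
      using pv_lin[OF \<psi>2(1) v(1) xe(1)] pv_lin[OF \<psi>2(1) v(1) xe(2)] \<psi>2 v by simp_all
    from min2[OF X.lin_in[OF \<psi>2(1) v(1)] this]
    show "sqrt (?ip \<psi>s2 \<psi>s2) \<le> sqrt (?ip (\<lambda>x. \<psi>s2 x + t * v x) (\<lambda>x. \<psi>s2 x + t * v x))" unfolding V_norm_def .
  qed
  have T_contr: "?ip (T u) (T u) \<le> ?ip u u" if u: "u \<in> ?X" for u
  proof -
    define s where "s = (\<lambda>x. ?pv u x1 * \<psi>s1 x + ?pv u x2 * \<psi>s2 x)"
    have s: "s \<in> ?X" unfolding s_def by (rule X.lin_in[OF X.scale_in[OF \<psi>1(1)] \<psi>2(1)])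
    note Tu = T_in[OF u] and o = orth1[OF T_in[OF u] T_pv0[OF u]] orth2[OF T_in[OF u] T_pv0[OF u]]
    have "?ip s (T u) = 0"
      unfolding s_def X.ip_lin[OF X.scale_in[OF \<psi>1(1)] \<psi>2(1) Tu] X.ip_scale[OF \<psi>1(1) Tu] using o by simp
    then have "?ip (T u) s = 0" using X.ip_sym[OF s Tu] by simp
    moreover have "u = (\<lambda>x. T u x + s x)" unfolding T_def s_def by (simp add: fun_eq_iff)
    ultimately have "?ip u u = ?ip (T u) (T u) + ?ip s s" using X.ip_add_expand[OF Tu s] by simp
    then show ?thesis using X.ip_nonneg[OF s] by simp
  qed
  obtain u where \<sigma>: "antimono \<sigma>" "\<And>i. 0 \<le> \<sigma> i"
    and u: "\<And>i. \<sigma> i > 0 \<Longrightarrow> gram_eigen ?X ?ip ?ipY P ((\<sigma> i)\<^sup>2) (u i)"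
      "\<And>i j. \<sigma> i > 0 \<Longrightarrow> \<sigma> j > 0 \<Longrightarrow> ?ip (u i) (u j) = (if i = j then 1 else 0)"
      "\<And>\<mu> w. \<mu> > 0 \<Longrightarrow> gram_eigen ?X ?ip ?ipY P \<mu> w \<Longrightarrow> (\<And>i. \<sigma> i > 0 \<Longrightarrow> ?ip w (u i) = 0) \<Longrightarrow> ?ip w w = 0"
    using sv_P unfolding singular_values_def by blast
  obtain us where \<sigma>s: "antimono \<sigma>s"
    and us: "\<And>i. \<sigma>s i > 0 \<Longrightarrow> gram_eigen ?X ?ip ?ipY Ps ((\<sigma>s i)\<^sup>2) (us i)"
      "\<And>i j. \<sigma>s i > 0 \<Longrightarrow> \<sigma>s j > 0 \<Longrightarrow> ?ip (us i) (us j) = (if i = j then 1 else 0)"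
    using sv_Ps unfolding singular_values_def by blast
  have "\<sigma>s i \<le> \<sigma> i" for i
  proof (rule C.singular_values_contraction[OF \<sigma> _ _ u(2) _ T_in T_lin T_contr \<sigma>s _ _ us(2)])
    show "u i \<in> ?X" if "\<sigma> i > 0" for i using u(1)[OF that] unfolding gram_eigen_def by blast
    show "?ipY (P (u i)) (P v) = (\<sigma> i)\<^sup>2 * ?ip (u i) v" if "\<sigma> i > 0" "v \<in> ?X" for i v
      using u(1)[OF that(1)] that(2) unfolding gram_eigen_def by blast
    show "?ip w w = 0" if "\<mu> > 0" "w \<in> ?X" "\<And>v. v \<in> ?X \<Longrightarrow> ?ipY (P w) (P v) = \<mu> * ?ip w v"
      "\<And>i. \<sigma> i > 0 \<Longrightarrow> ?ip w (u i) = 0" for \<mu> w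
      by (rule u(3)[OF that(1) _ that(4)]) (use that(2,3) in \<open>auto simp: gram_eigen_def\<close>)
    show usX: "us i \<in> ?X" if "\<sigma>s i > 0" for i using us(1)[OF that] unfolding gram_eigen_def by blast
    show "?ipY (P (T (us i))) (P (T v)) = (\<sigma>s i)\<^sup>2 * ?ip (us i) v" if i: "\<sigma>s i > 0" and v: "v \<in> ?X" for i v
    proof -
      have "?ipY (P (T (us i))) (P (T v)) = ?ipY (Ps (us i)) (Ps v)"
        by (rule H_half_inner_cong) (simp_all add: PT usX[OF i] v e_def[symmetric])
      then show ?thesis using us(1)[OF i] v unfolding gram_eigen_def by simp
    qed
  qed auto
  then show ?thesis by blast
qed

end
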